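(* Each of the subsets $\Omega_T$, $\Omega_L$ and $\Omega_T^*=\Omega_L^*$ of $\mathbb{R}^2$ is compact.
   Context: A convex disk is a compact convex subset of $\mathbb{R}^2$ with nonempty interior; $\mathcal{K}^2$ denotes the set of all convex disks and $\mathcal{K}^{*2}\subset\mathcal{K}^2$ the set of centrally symmetric ones. $|S|$ is the area of $S$. A family $\mathcal F=\{K_i\}$ of sets congruent to a convex disk $K$ is a packing if the interiors of its members are mutually disjoint, and a covering if the union of its members is $\mathbb{R}^2$. With $B_r$ the disk of radius $r$ centered at the origin and $|\mathcal F\cap B_r|=\sum_i|K_i\cap B_r|$, the density of $\mathcal F$ is $d(\mathcal F)=\lim_{r\to\infty}|\mathcal F\cap B_r|/|B_r|$; if the limit does not exist, the upper limit is used for a packing and the lower limit for a covering. The translative packing density $\delta_T(K)$ is the supremum of $d(\mathcal F)$ over all packings by translates of $K$, and the translative covering density $\vartheta_T(K)$ is the infimum of $d(\mathcal F)$ over all coverings by translates of $K$. The lattice densities $\delta_L(K),\vartheta_L(K)$ are defined in the same way, using only families of translates of $K$ by the vectors of a lattice. Define $\Omega_T=\{(\delta_T(K),\vartheta_T(K)):K\in\mathcal K^2\}$ and $\Omega_L=\{(\delta_L(K),\vartheta_L(K)):K\in\mathcal K^2\}$, and define $\Omega_T^*,\Omega_L^*$ in the same way with $\mathcal K^2$ replaced by $\mathcal K^{*2}$. *)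

theory Defs
  imports "HOL-Analysis.Analysis"
begin

definition convex_disk :: "(real^2) set \<Rightarrow> bool" where
  "convex_disk K \<longleftrightarrow> compact K \<and> convex K \<and> interior K \<noteq> {}"

text \<open>The center of symmetry is arbitrary, not necessarily the origin.\<close>

definition centrally_symmetric :: "(real^2) set \<Rightarrow> bool" where
  "centrally_symmetric K \<longleftrightarrow> (\<exists>c. (\<lambda>x. 2 *\<^sub>R c - x) ` K = K)"

definition translates :: "(real^2) set \<Rightarrow> (real^2) set \<Rightarrow> (real^2) set set" where
  "translates K V = (\<lambda>v. (+) v ` K) ` V"

definition is_lattice :: "(real^2) set \<Rightarrow> bool" where
  "is_lattice L \<longleftrightarrow>
     (\<exists>u v. u \<noteq> v \<and> independent {u, v} \<and>
            L = {of_int a *\<^sub>R u + of_int b *\<^sub>R v | (a::int) (b::int). True})"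

definition packing :: "(real^2) set set \<Rightarrow> bool" where
  "packing F \<longleftrightarrow> pairwise (\<lambda>A B. interior A \<inter> interior B = {}) F"

definition covering :: "(real^2) set set \<Rightarrow> bool" where
  "covering F \<longleftrightarrow> \<Union>F = UNIV"

text \<open>
  Areas are summed in the extended nonnegative reals, so that the sum is meaningful for
  every family; for large \<open>r\<close> it is infinite if the family is not locally finite.
\<close>

definition density_in_disk :: "(real^2) set set \<Rightarrow> real \<Rightarrow> ennreal" where
  "density_in_disk F r =
     (\<Sum>\<^sub>\<infinity>A\<in>F. emeasure lborel (A \<inter> cball 0 r)) / emeasure lborel (cball 0 r :: (real^2) set)"

text \<open>
  The upper limit (for packings) and the lower limit (for coverings) coincide with the limit
  whenever the latter exists.
\<close>

definition density_of_packing :: "(real^2) set set \<Rightarrow> ennreal" where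
  "density_of_packing F = Limsup at_top (density_in_disk F)"

definition density_of_covering :: "(real^2) set set \<Rightarrow> ennreal" where
  "density_of_covering F = Liminf at_top (density_in_disk F)"

text \<open>
  The extremal densities of a convex disk are finite, so the conversion \<open>enn2real\<close>
  loses no information in the following four definitions.
\<close>

definition delta_T :: "(real^2) set \<Rightarrow> real" where
  "delta_T K = enn2real (SUP F \<in> {translates K V | V. packing (translates K V)}.
     density_of_packing F)"

definition theta_T :: "(real^2) set \<Rightarrow> real" where
  "theta_T K = enn2real (INF F \<in> {translates K V | V. covering (translates K V)}.
     density_of_covering F)"

definition delta_L :: "(real^2) set \<Rightarrow> real" where
  "delta_L K = enn2real (SUP F \<in> {translates K L | L. is_lattice L \<and> packing (translates K L)}.
     density_of_packing F)"

definition theta_L :: "(real^2) set \<Rightarrow> real" where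
  "theta_L K = enn2real (INF F \<in> {translates K L | L. is_lattice L \<and> covering (translates K L)}.
     density_of_covering F)"

definition Omega_T :: "(real \<times> real) set" where
  "Omega_T = {(delta_T K, theta_T K) | K. convex_disk K}"

definition Omega_L :: "(real \<times> real) set" where
  "Omega_L = {(delta_L K, theta_L K) | K. convex_disk K}"

definition Omega_T_sym :: "(real \<times> real) set" where
  "Omega_T_sym = {(delta_T K, theta_T K) | K. convex_disk K \<and> centrally_symmetric K}"

definition Omega_L_sym :: "(real \<times> real) set" where
  "Omega_L_sym = {(delta_L K, theta_L K) | K. convex_disk K \<and> centrally_symmetric K}"

end

theory Submission
  imports Defs "HOL-Complex_Analysis.Great_Picard"
begin

text \<open>Each of the four densities is monotone up to the area ratio of nested disks and invariant
  under affine maps, the latter because arrangements can be made periodic at arbitrarily small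
  cost.  Both facts together give continuity along sequences sandwiched between dilates, and every
  disk has an affine image between two fixed disks, so Blaschke selection yields compactness.

  For a centrally symmetric disk, continuity allows to assume that it is the unit ball of a
  strictly convex norm.  The Delaunay polygons of a discrete set (convex hulls of the points
  nearest to some center) do not overlap and, by Brouwer's theorem, cover the plane; when
  triangulated, they have on average two triangles per point.  In a covering every such triangle
  has at most the area of a largest inscribed triangle, whose edge lattice is a covering lattice;
  in a saturated packing it has at least the area of an equilateral triangle of side one, whose
  edge lattice is a packing lattice.  Hence translative and lattice densities agree.\<close>

text \<open>Densities are measured in round disks, and a linear map turns these into ellipses, so
  the density of a single arrangement need not be invariant. What is invariant is the extremal
  value: the contents of one large cell, repeated periodically, have a density that depends only on
  the area of \<open>K\<close>, a point count and a determinant.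

  The Delaunay argument has to work for norms whose circles have no algebraic equation and for which
  three points need not have a circumcenter. The role of radical axes is taken by
  \<open>disks_cross\<close>, a homothety argument that excludes the configurations forced by
  overlapping polygons or crossing chords. Strict convexity puts the points of a circle into convex
  position.

  The factor two in the count of triangles is obtained without Euler's formula. With respect to a
  generic direction \<open>u\<close>, a polygon with \<open>k\<close> vertices has
  \<open>k - 2\<close> vertices that are neither first nor last, as many as triangles in a
  triangulation; and each point of the set is such a vertex of one polygon on either side of it
  along \<open>rot u\<close>.\<close>

definition cross :: "real^2 \<Rightarrow> real^2 \<Rightarrow> real" where
  "cross x y = x $ 1 * y $ 2 - x $ 2 * y $ 1"

text \<open>The matrix with columns \<open>u\<close> and \<open>v\<close>, of determinant
  \<open>cross u v\<close>. All linear maps of the plane have this form, so affine invariance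
  amounts to invariance under these maps and translations.\<close>

definition lin :: "real^2 \<Rightarrow> real^2 \<Rightarrow> real^2 \<Rightarrow> real^2" where
  "lin u v x = x $ 1 *\<^sub>R u + x $ 2 *\<^sub>R v"

abbreviation area :: "(real^2) set \<Rightarrow> real" where
  "area S \<equiv> measure lebesgue S"

lemma vec2_eq_iff: "x = y \<longleftrightarrow> x $ 1 = y $ 1 \<and> x $ 2 = y $ 2" for x y :: "real^2"
  by (simp add: vec_eq_iff forall_2)

lemma cross_simps:
  "cross (x + y) z = cross x z + cross y z" "cross x (y + z) = cross x y + cross x z"
  "cross (x - y) z = cross x z - cross y z" "cross x (y - z) = cross x y - cross x z"
  "cross (a *\<^sub>R x) y = a * cross x y" "cross x (a *\<^sub>R y) = a * cross x y"
  "cross x x = 0" "cross 0 x = 0" "cross x 0 = 0"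
  "cross (- x) y = - cross x y" "cross x (- y) = - cross x y"
  by (simp_all add: cross_def algebra_simps)

lemma cross_commute: "cross x y = - cross y x"
  by (simp add: cross_def)

lemma linear_lin: "linear (lin u v)"
  by (rule linearI) (simp_all add: lin_def algebra_simps)

lemma lin_simps:
  "lin u v (x + y) = lin u v x + lin u v y" "lin u v (x - y) = lin u v x - lin u v y"
  "lin u v (a *\<^sub>R x) = a *\<^sub>R lin u v x"
  by (simp_all add: lin_def algebra_simps)

lemma cross_lin: "cross (lin u v x) (lin u v y) = cross u v * cross x y"
  by (simp add: lin_def cross_def algebra_simps)

lemma lin_lin: "lin u v (lin a b x) = lin (lin u v a) (lin u v b) x"
  by (simp add: lin_def algebra_simps)

text \<open>Cramer's rule. Coordinates in the basis \<open>u\<close>, \<open>v\<close> are quotients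
  of signed areas, which later turns maximality of areas into bounds on coordinates.\<close>

lemma cross_expand:
  assumes "cross u v \<noteq> 0"
  shows "x = (cross x v / cross u v) *\<^sub>R u + (cross u x / cross u v) *\<^sub>R v"
proof -
  have "cross u v * x $ i = cross x v * u $ i + cross u x * v $ i" for i
    using exhaust_2[of i] by (auto simp: cross_def algebra_simps)
  then show ?thesis using assms
    by (simp add: vec_eq_iff field_simps)
qed

lemma lin_inverse:
  assumes "cross u v \<noteq> 0"
  obtains a b where "cross a b \<noteq> 0" "\<And>x. lin u v (lin a b x) = x" "\<And>x. lin a b (lin u v x) = x"
    "cross u v * cross a b = 1"
proof
  define D where "D = cross u v"
  \<comment> \<open>The columns of the adjugate matrix divided by the determinant.\<close>
  define a :: "real^2" where "a = vector [v $ 2 / D, - u $ 2 / D]"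
  define b :: "real^2" where "b = vector [- v $ 1 / D, u $ 1 / D]"
  have D: "D \<noteq> 0" "u $ 1 * v $ 2 = D + u $ 2 * v $ 1" using assms by (auto simp: D_def cross_def)
  show 1: "lin u v (lin a b x) = x" for x
  proof -
    have "D * (lin u v (lin a b x)) $ i = D * x $ i" for i
      using D(1) exhaust_2[of i]
      by (auto simp: lin_def a_def b_def vec2_eq_iff algebra_simps)
        (simp add: D_def cross_def algebra_simps)+
    then show ?thesis using D by (simp add: vec_eq_iff)
  qed
  show "lin a b (lin u v x) = x" for x
  proof -
    have "D * (lin a b (lin u v x)) $ i = D * x $ i" for i
      using D(1) exhaust_2[of i]
      by (auto simp: lin_def a_def b_def vec2_eq_iff algebra_simps)
        (simp add: D_def cross_def algebra_simps)+
    then show ?thesis using D by (simp add: vec_eq_iff)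
  qed
  have "cross u v * (cross a b * cross (axis 1 1) (axis 2 1)) = cross (axis 1 1) (axis 2 1)"
    using cross_lin[of u v "lin a b (axis 1 1)" "lin a b (axis 2 1)"] 1 cross_lin[of a b]
    by metis
  then show "cross u v * cross a b = 1" by (simp add: cross_def axis_def)
  then show "cross a b \<noteq> 0" by auto
qed

lemma det_matrix_lin: "det (matrix (lin u v)) = cross u v"
  by (simp add: det_2 matrix_def lin_def cross_def axis_def)

lemma area_lin:
  assumes "S \<in> lmeasurable"
  shows "area (lin u v ` S) = \<bar>cross u v\<bar> * area S"
  using measure_linear_image[OF linear_lin assms] det_matrix_lin by simp

lemma lmeasurable_lin:
  assumes "S \<in> lmeasurable"
  shows "lin u v ` S \<in> lmeasurable"
  using measurable_linear_image[OF linear_lin assms] .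

lemma inj_lin: "cross u v \<noteq> 0 \<Longrightarrow> inj (lin u v)"
  by (metis injI lin_inverse)

lemma compact_lin: "compact S \<Longrightarrow> compact (lin u v ` S)"
  by (intro compact_continuous_image linear_continuous_on)
    (auto simp: linear_lin linear_linear)

lemma area_triangle: "area (convex hull {a, b, c}) = \<bar>cross (b - a) (c - a)\<bar> / 2"
proof -
  have "compact (convex hull {a, b, c})"
    by (intro finite_imp_compact_convex_hull) auto
  then have "area (convex hull {a, b, c}) = measure lborel (convex hull {a, b, c})"
    by (intro measure_completion) (auto dest: compact_imp_closed)
  also have "\<dots> = \<bar>cross (b - a) (c - a)\<bar> / 2"
    unfolding content_triangle cross_def by (simp add: algebra_simps)
  finally show ?thesis .
qed

lemma area_scaleR:
  assumes "compact S"
  shows "area ((*\<^sub>R) a ` S) = a\<^sup>2 * area S"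
proof -
  have "lin (a *\<^sub>R axis 1 1) (a *\<^sub>R axis 2 1) = (*\<^sub>R) a"
    by (auto simp: fun_eq_iff lin_def vec2_eq_iff axis_def)
  moreover have "cross (a *\<^sub>R axis 1 1) (a *\<^sub>R axis 2 1) = a\<^sup>2"
    by (simp add: cross_def axis_def power2_eq_square)
  ultimately show ?thesis
    using area_lin[of S "a *\<^sub>R axis 1 1" "a *\<^sub>R axis 2 1"] assms
    by (simp add: lmeasurable_compact)
qed

lemma emeasure_lborel_compact: "compact S \<Longrightarrow> emeasure lborel S = ennreal (area S)"
  for S :: "(real^2) set"
  by (metis emeasure_compact_finite emeasure_eq_ennreal_measure borel_compact infinity_ennreal_def
      measure_completion order_less_irrefl sets_lborel)

definition disk_area :: "real \<Rightarrow> real" where "disk_area r = area (cball 0 r)"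

lemma disk_area: "r \<ge> 0 \<Longrightarrow> disk_area r = pi * r\<^sup>2"
proof -
  assume "r \<ge> 0"
  moreover have "area (cball 0 r) = measure lborel (cball (0::real^2) r)"
    by (intro measure_completion) auto
  moreover have "unit_ball_vol (real CARD(2)) = pi"
    using unit_ball_vol_numeral by simp
  ultimately show ?thesis
    by (simp add: disk_area_def content_cball)
qed

lemma disk_area_pos: "r > 0 \<Longrightarrow> disk_area r > 0"
  by (simp add: disk_area)

lemma emeasure_disk: "emeasure lborel (cball (0::real^2) r) = ennreal (disk_area r)"
  by (simp add: disk_area_def emeasure_lborel_compact)

lemma convex_disk_area_pos: "convex_disk K \<Longrightarrow> area K > 0"
  unfolding convex_disk_def
  by (metis lmeasurable_compact measure_nonneg negligible_iff_measure0 negligible_convex_interior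
      order_less_le)

lemma convex_disk_lin:
  assumes "convex_disk K" "cross u v \<noteq> 0"
  shows "convex_disk (lin u v ` K)"
  using assms interior_surjective_linear_image linear_lin
    interior_injective_linear_image[OF linear_lin inj_lin[OF assms(2)], of K]
  unfolding convex_disk_def
  by (auto simp: compact_lin convex_linear_image linear_lin)

lemma convex_disk_translation: "convex_disk K \<Longrightarrow> convex_disk ((+) a ` K)"
  unfolding convex_disk_def
  by (auto simp: compact_translation convex_translation interior_translation)

lemma area_translation: "area ((+) a ` S) = area S"
  by (rule measure_translation)

text \<open>Taking \<open>\<eta> = 1\<close> first shows that \<open>x\<close> is finite if
  \<open>y\<close> is; after that the limit is one of real numbers.\<close>

lemma ennreal_le_mult_eps:
  fixes x y :: ennreal
  assumes "\<And>\<eta>::real. \<eta> > 0 \<Longrightarrow> x \<le> ennreal (1 + \<eta>) * y"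
  shows "x \<le> y"
proof (cases y)
  case (real b)
  have "x \<le> ennreal (2 * b)"
    using assms[of 1] real by (simp add: ennreal_mult')
  then obtain a where a: "x = ennreal a" "a \<ge> 0"
    by (metis ennreal_cases neq_top_trans ennreal_neq_top)
  have le: "a \<le> (1 + \<eta>) * b" if "\<eta> > 0" for \<eta>
  proof -
    have "ennreal ((1 + \<eta>) * b) = ennreal (1 + \<eta>) * ennreal b"
      using that real by (intro ennreal_mult) auto
    then have "ennreal a \<le> ennreal ((1 + \<eta>) * b)"
      using assms[OF that] a real by simp
    then show ?thesis using that real by (simp add: ennreal_le_iff)
  qed
  have "a \<le> b"
  proof (rule field_le_epsilon)
    fix e :: real assume "e > 0"
    \<comment> \<open>Dividing by \<open>b + 1\<close> instead of \<open>b\<close> allows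
      \<open>b = 0\<close>.\<close>
    have "a \<le> (1 + e / (b + 1)) * b"
      using \<open>e > 0\<close> real by (intro le) auto
    also have "\<dots> \<le> b + e"
      using \<open>e > 0\<close> real by (simp add: field_simps)
    finally show "a \<le> b + e" .
  qed
  then show ?thesis using a real by (simp add: ennreal_leI)
qed auto

text \<open>With \<open>q\<^sup>2 = 1 + \<eta>\<close>, the condition
  \<open>r \<ge> d / (q - 1)\<close> says exactly that \<open>r + d \<le> q * r\<close>, and areas
  grow quadratically.\<close>

lemma disk_area_ratio:
  assumes "d \<ge> 0" "\<eta> > 0"
  shows "eventually (\<lambda>r. r > 0 \<and> disk_area (r + d) \<le> (1 + \<eta>) * disk_area r) at_top"
proof -
  define q where "q = sqrt (1 + \<eta>)"
  have q: "q > 1" "q\<^sup>2 = 1 + \<eta>" using assms by (auto simp: q_def)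
  have "disk_area (r + d) \<le> (1 + \<eta>) * disk_area r" if "r \<ge> d / (q - 1)" "r > 0" for r
  proof -
    have "r + d \<le> q * r" using that q by (simp add: field_simps)
    then have "(r + d)\<^sup>2 \<le> (q * r)\<^sup>2"
      using assms that by (intro power_mono) auto
    then have "pi * (r + d)\<^sup>2 \<le> pi * ((1 + \<eta>) * r\<^sup>2)"
      using q(2) by (intro mult_left_mono) (auto simp: power_mult_distrib)
    then show ?thesis
      using assms that by (simp add: disk_area algebra_simps)
  qed
  note le = this
  show ?thesis
    using eventually_ge_at_top[of "d / (q - 1)"] eventually_gt_at_top[of 0]
    by eventually_elim (use le in auto)
qed

section \<open>Density of translates and point counts\<close>

lemma filtermap_shift_at_top: "filtermap (\<lambda>r::real. r + d) at_top = at_top"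
proof (rule filtermap_fun_inverse[where g = "\<lambda>r. r - d"])
  show "filterlim (\<lambda>r. r - d) at_top (at_top::real filter)"
    using filterlim_tendsto_add_at_top[OF tendsto_const[of "-d"] filterlim_ident]
    by (simp add: algebra_simps)
  show "filterlim (\<lambda>r. r + d) at_top (at_top::real filter)"
    using filterlim_tendsto_add_at_top[OF tendsto_const[of "d"] filterlim_ident]
    by (simp add: algebra_simps)
qed simp

lemma Limsup_shift: "Limsup at_top (\<lambda>r::real. g (r + d)) = Limsup at_top g"
  for g :: "real \<Rightarrow> ennreal"
  using Limsup_filtermap_eq[of "\<lambda>r. r + d" at_top g] by (simp add: filtermap_shift_at_top)

lemma Liminf_shift: "Liminf at_top (\<lambda>r::real. g (r + d)) = Liminf at_top g"
  for g :: "real \<Rightarrow> ennreal"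
  using Liminf_filtermap_eq[of "\<lambda>r. r + d" at_top g] by (simp add: filtermap_shift_at_top)

lemma Limsup_cmult:
  fixes g :: "real \<Rightarrow> ennreal"
  shows "Limsup at_top (\<lambda>r. ennreal k * g r) = ennreal k * Limsup at_top g"
  by (rule Limsup_compose_continuous_mono[of "\<lambda>x. ennreal k * x"])
    (auto intro!: ennreal_continuous_on_cmult monoI mult_left_mono)

lemma Liminf_cmult:
  fixes g :: "real \<Rightarrow> ennreal"
  shows "Liminf at_top (\<lambda>r. ennreal k * g r) = ennreal k * Liminf at_top g"
  by (rule Liminf_compose_continuous_mono[of "\<lambda>x. ennreal k * x"])
    (auto intro!: ennreal_continuous_on_cmult monoI mult_left_mono)

text \<open>Boundary effects are discarded here once and for all. An estimate between totals over
  disks of radius \<open>r\<close> and \<open>r + d\<close> survives as one between limits of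
  averages, because the areas of these disks are asymptotically equal.\<close>

lemma Limsup_Liminf_disk_ratio:
  fixes f g :: "real \<Rightarrow> ennreal"
  assumes "d \<ge> 0" "C \<ge> 0"
    and le: "\<And>r. r > 0 \<Longrightarrow>
      f r * ennreal (disk_area r) \<le> ennreal C * (g (r + d) * ennreal (disk_area (r + d)))"
  shows "Limsup at_top f \<le> ennreal C * Limsup at_top g"
    and "Liminf at_top f \<le> ennreal C * Liminf at_top g"
proof -
  have ev: "eventually (\<lambda>r. f r \<le> ennreal ((1 + \<eta>) * C) * g (r + d)) at_top" if "\<eta> > 0" for \<eta>
    using disk_area_ratio[OF assms(1) that]
  proof eventually_elim
    case (elim r)
    have "f r * ennreal (disk_area r) \<le> ennreal C * (g (r + d) * ennreal ((1 + \<eta>) * disk_area r))"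
      using elim by (intro order.trans[OF le] mult_left_mono ennreal_leI) auto
    also have "\<dots> = (ennreal ((1 + \<eta>) * C) * g (r + d)) * ennreal (disk_area r)"
      using that assms elim disk_area_pos[of r]
      by (simp add: ennreal_mult' ennreal_mult mult_ac)
    finally show ?case
      using disk_area_pos[of r] elim by (simp add: ennreal_mult_le_mult_iff mult.commute[of _ "ennreal (disk_area r)"])
  qed
  show "Limsup at_top f \<le> ennreal C * Limsup at_top g"
  proof (rule ennreal_le_mult_eps)
    fix \<eta> :: real assume \<eta>: "\<eta> > 0"
    have "Limsup at_top f \<le> Limsup at_top (\<lambda>r. ennreal ((1 + \<eta>) * C) * g (r + d))"
      by (rule Limsup_mono[OF ev[OF \<eta>]])
    also have "\<dots> = ennreal ((1 + \<eta>) * C) * Limsup at_top g"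
      by (simp only: Limsup_cmult Limsup_shift)
    finally show "Limsup at_top f \<le> ennreal (1 + \<eta>) * (ennreal C * Limsup at_top g)"
      using \<eta> assms by (simp add: ennreal_mult mult_ac)
  qed
  show "Liminf at_top f \<le> ennreal C * Liminf at_top g"
  proof (rule ennreal_le_mult_eps)
    fix \<eta> :: real assume \<eta>: "\<eta> > 0"
    have "Liminf at_top f \<le> Liminf at_top (\<lambda>r. ennreal ((1 + \<eta>) * C) * g (r + d))"
      by (rule Liminf_mono[OF ev[OF \<eta>]])
    also have "\<dots> = ennreal ((1 + \<eta>) * C) * Liminf at_top g"
      by (simp only: Liminf_cmult Liminf_shift)
    finally show "Liminf at_top f \<le> ennreal (1 + \<eta>) * (ennreal C * Liminf at_top g)"
      using \<eta> assms by (simp add: ennreal_mult mult_ac)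
  qed
qed

text \<open>The functional \<open>t \<bullet> x\<close> attains its minimum on \<open>K\<close>, and
  a translation by \<open>t\<close> raises the minimum by \<open>t \<bullet> t\<close>. Since a
  family is a set of sets, this is what guarantees that different vectors give different
  members.\<close>

lemma translation_eq_self_imp_0:
  fixes K :: "(real^2) set"
  assumes "compact K" "K \<noteq> {}" "(+) t ` K = K"
  shows "t = 0"
proof -
  have "continuous_on K (\<lambda>x. t \<bullet> x)" by (intro continuous_intros)
  then obtain x where x: "x \<in> K" "\<And>y. y \<in> K \<Longrightarrow> t \<bullet> x \<le> t \<bullet> y"
    using continuous_attains_inf[OF assms(1,2)] by blast
  then obtain y where y: "y \<in> K" "x = t + y" using assms(3) by auto
  then have "t \<bullet> t \<le> 0" using x(2)[of y] by (simp add: inner_right_distrib)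
  then show ?thesis using inner_ge_zero[of t] inner_eq_zero_iff[of t] by linarith
qed

lemma inj_on_translates:
  assumes "compact K" "K \<noteq> {}"
  shows "inj_on (\<lambda>v. (+) v ` K) (V :: (real^2) set)"
proof (rule inj_onI)
  fix v w assume "(+) v ` K = (+) w ` K"
  then have "(+) (-w) ` (+) v ` K = (+) (-w) ` (+) w ` K" by simp
  then have "(+) (v - w) ` K = K" by (simp add: image_image algebra_simps)
  from translation_eq_self_imp_0[OF assms this] show "v = w" by simp
qed

definition area_in_disk :: "(real^2) set \<Rightarrow> (real^2) set \<Rightarrow> real \<Rightarrow> ennreal" where
  "area_in_disk K V r = (\<Sum>\<^sub>\<infinity>v\<in>V. emeasure lborel ((+) v ` K \<inter> cball 0 r))"

lemma convex_disk_nonempty: "convex_disk K \<Longrightarrow> K \<noteq> {}" and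
  convex_disk_compact: "convex_disk K \<Longrightarrow> compact K"
  by (auto simp: convex_disk_def)

lemma density_in_disk_translates:
  assumes "convex_disk K" "r > 0"
  shows "density_in_disk (translates K V) r * ennreal (disk_area r) = area_in_disk K V r"
proof -
  have "(\<Sum>\<^sub>\<infinity>A\<in>translates K V. emeasure lborel (A \<inter> cball 0 r)) = area_in_disk K V r"
    unfolding translates_def area_in_disk_def
    using infsum_reindex[OF inj_on_translates[OF convex_disk_compact convex_disk_nonempty],
        OF assms(1) assms(1)] by (simp add: o_def)
  then show ?thesis
    using disk_area_pos[OF assms(2)]
    by (simp add: density_in_disk_def emeasure_disk ennreal_divide_times)
qed

text \<open>Counting measure, because \<open>card\<close> assigns 0 to an infinite set, whereas an
  accumulation of points has to count as infinite.\<close>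

definition pt_count :: "(real^2) set \<Rightarrow> real \<Rightarrow> ennreal" where
  "pt_count V r = emeasure (count_space UNIV) (V \<inter> cball 0 r)"

lemma pt_count_finite: "finite (V \<inter> cball 0 r) \<Longrightarrow> pt_count V r = ennreal (card (V \<inter> cball 0 r))"
  by (simp add: pt_count_def ennreal_of_nat_eq_real_of_nat)

lemma pt_count_infinite: "infinite (V \<inter> cball 0 r) \<Longrightarrow> pt_count V r = top"
  by (simp add: pt_count_def)

text \<open>A translate of \<open>K\<close> that meets the disk has its vector within
  \<open>r + R\<close>. If infinitely many vectors lie there, the bound is infinite.\<close>

lemma area_in_disk_le:
  assumes K: "convex_disk K" "K \<subseteq> cball 0 R"
  shows "area_in_disk K V r \<le> ennreal (area K) * pt_count V (r + R)"
proof (cases "finite (V \<inter> cball 0 (r + R))")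
  case True
  have zero: "(+) v ` K \<inter> cball 0 r = {}" if "v \<in> V - V \<inter> cball 0 (r + R)" for v
  proof (rule ccontr)
    assume "(+) v ` K \<inter> cball 0 r \<noteq> {}"
    then obtain x where x: "x \<in> K" "norm (v + x) \<le> r" by auto
    then have "norm x \<le> R" using K by auto
    then have "norm v \<le> r + R" using x norm_triangle_ineq4[of "v + x" x] by simp
    then show False using that by auto
  qed
  have "area_in_disk K V r = (\<Sum>\<^sub>\<infinity>v\<in>V \<inter> cball 0 (r + R). emeasure lborel ((+) v ` K \<inter> cball 0 r))"
    unfolding area_in_disk_def
    by (rule infsum_cong_neutral) (use zero in auto)
  also have "\<dots> = (\<Sum>v\<in>V \<inter> cball 0 (r + R). emeasure lborel ((+) v ` K \<inter> cball 0 r))"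
    using True by simp
  also have "\<dots> \<le> (\<Sum>v\<in>V \<inter> cball 0 (r + R). ennreal (area K))"
  proof (rule sum_mono)
    fix v
    have c: "compact ((+) v ` K)"
      using convex_disk_compact[OF K(1)] compact_translation by blast
    then have "emeasure lborel ((+) v ` K \<inter> cball 0 r) \<le> emeasure lborel ((+) v ` K)"
      by (intro emeasure_mono) (auto dest: compact_imp_closed)
    then show "emeasure lborel ((+) v ` K \<inter> cball 0 r) \<le> ennreal (area K)"
      using c by (simp add: emeasure_lborel_compact area_translation)
  qed
  also have "\<dots> = ennreal (area K) * pt_count V (r + R)"
    using True by (simp add: pt_count_finite ennreal_of_nat_eq_real_of_nat mult.commute)
  finally show ?thesis .
next
  case False
  then show ?thesis
    using convex_disk_area_pos[OF K(1)] by (simp add: pt_count_infinite ennreal_mult_top)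
qed

text \<open>Translates by vectors within \<open>r\<close> lie completely in the larger disk.
  Infinitely many of them have infinite total area, because all summands equal the positive number
  \<open>area K\<close>.\<close>

lemma area_in_disk_ge:
  assumes K: "convex_disk K" "K \<subseteq> cball 0 R"
  shows "ennreal (area K) * pt_count V r \<le> area_in_disk K V (r + R)"
proof -
  have full: "emeasure lborel ((+) v ` K \<inter> cball 0 (r + R)) = ennreal (area K)"
    if "v \<in> V \<inter> cball 0 r" for v
  proof -
    have "(+) v ` K \<subseteq> cball 0 (r + R)"
    proof
      fix y assume "y \<in> (+) v ` K"
      then obtain x where x: "x \<in> K" "y = v + x" by auto
      then have "norm x \<le> R" "norm v \<le> r" using K that by auto
      then show "y \<in> cball 0 (r + R)" using x norm_triangle_ineq[of v x] by simp
    qed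
    moreover have "compact ((+) v ` K)"
      using convex_disk_compact[OF K(1)] compact_translation by blast
    ultimately show ?thesis
      by (simp add: Int_absorb2 emeasure_lborel_compact area_translation)
  qed
  have "(\<Sum>\<^sub>\<infinity>v\<in>V \<inter> cball 0 r. ennreal (area K)) =
      (\<Sum>\<^sub>\<infinity>v\<in>V \<inter> cball 0 r. emeasure lborel ((+) v ` K \<inter> cball 0 (r + R)))"
    by (rule infsum_cong) (simp only: full)
  also have "\<dots> \<le> area_in_disk K V (r + R)"
    unfolding area_in_disk_def by (intro infsum_mono_neutral nonneg_summable_on_complete) auto
  finally have le: "(\<Sum>\<^sub>\<infinity>v\<in>V \<inter> cball 0 r. ennreal (area K)) \<le> area_in_disk K V (r + R)" .
  show ?thesis
  proof (cases "finite (V \<inter> cball 0 r)")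
    case True
    then show ?thesis
      using le by (simp add: pt_count_finite ennreal_of_nat_eq_real_of_nat mult.commute)
  next
    case False
    then have "(\<Sum>\<^sub>\<infinity>v\<in>V \<inter> cball 0 r. ennreal (area K)) = \<infinity>"
      using convex_disk_area_pos[OF K(1)]
      by (intro infsum_superconst_infinite_ennreal[of _ "ennreal (area K)"]) auto
    then show ?thesis using le by (simp add: top_unique)
  qed
qed

lemma convex_disk_bounded:
  assumes "convex_disk K"
  obtains R where "R > 0" "K \<subseteq> cball 0 R"
proof -
  have "bounded K" using assms by (simp add: convex_disk_def compact_imp_bounded)
  then obtain R where "R > 0" "\<forall>x\<in>K. norm x \<le> R" by (auto simp: bounded_pos)
  then show ?thesis by (intro that[of R]) auto
qed

text \<open>Either density is the area of the body times the asymptotic number of points of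
  \<open>V\<close> per unit area, and the latter does not depend on the body.\<close>

lemma density_compare:
  assumes K: "convex_disk K" and K': "convex_disk K'"
  shows "density_of_packing (translates K' V) \<le>
      ennreal (area K' / area K) * density_of_packing (translates K V)"
    and "density_of_covering (translates K' V) \<le>
      ennreal (area K' / area K) * density_of_covering (translates K V)"
proof -
  obtain R where R: "R > 0" "K \<subseteq> cball 0 R" using convex_disk_bounded[OF K] .
  obtain R' where R': "R' > 0" "K' \<subseteq> cball 0 R'" using convex_disk_bounded[OF K'] .
  have a: "area K > 0" "area K' > 0" using K K' convex_disk_area_pos by auto
  have le: "density_in_disk (translates K' V) r * ennreal (disk_area r) \<le>
      ennreal (area K' / area K) *
        (density_in_disk (translates K V) (r + (R' + R)) * ennreal (disk_area (r + (R' + R))))"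
    if "r > 0" for r
  proof -
    have "density_in_disk (translates K' V) r * ennreal (disk_area r) \<le>
        ennreal (area K') * pt_count V (r + R')"
      by (simp add: density_in_disk_translates[OF K' that] area_in_disk_le[OF K' R'(2)])
    also have "\<dots> = ennreal (area K' / area K) * (ennreal (area K) * pt_count V (r + R'))"
      using a by (simp add: mult.assoc[symmetric] flip: ennreal_mult)
    also have "\<dots> \<le> ennreal (area K' / area K) * area_in_disk K V (r + R' + R)"
      by (intro mult_left_mono area_in_disk_ge[OF K R(2)]) auto
    also have "area_in_disk K V (r + R' + R) =
        density_in_disk (translates K V) (r + (R' + R)) * ennreal (disk_area (r + (R' + R)))"
      using density_in_disk_translates[OF K, of "r + (R' + R)"] that R R' by (simp add: add.assoc)
    finally show ?thesis .
  qed
  show "density_of_packing (translates K' V) \<le>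
      ennreal (area K' / area K) * density_of_packing (translates K V)"
    "density_of_covering (translates K' V) \<le>
      ennreal (area K' / area K) * density_of_covering (translates K V)"
    using Limsup_Liminf_disk_ratio[OF _ _ le] R R' a
    by (auto simp: density_of_packing_def density_of_covering_def)
qed

text \<open>The quotient \<open>m / a\<close> bounds the number of points per unit area;
  \<open>d\<close> absorbs what happens near the boundary of the disk.\<close>

lemma density_le_count:
  fixes a m d :: real
  assumes K: "convex_disk K" and "a > 0" "m \<ge> 0" "d \<ge> 0"
    and count: "\<And>r. r > 0 \<Longrightarrow> finite (V \<inter> cball 0 r) \<and>
      card (V \<inter> cball 0 r) * a \<le> m * disk_area (r + d)"
  shows "density_of_packing (translates K V) \<le> ennreal (area K * m / a)"
    and "density_of_covering (translates K V) \<le> ennreal (area K * m / a)"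
proof -
  obtain R where R: "R > 0" "K \<subseteq> cball 0 R" using convex_disk_bounded[OF K] .
  have pos: "area K > 0" using K convex_disk_area_pos by auto
  have le: "density_in_disk (translates K V) r * ennreal (disk_area r) \<le>
      ennreal (area K * m / a) * (1 * ennreal (disk_area (r + (R + d))))" if "r > 0" for r
  proof -
    have c: "finite (V \<inter> cball 0 (r + R))"
      "card (V \<inter> cball 0 (r + R)) * a \<le> m * disk_area (r + (R + d))"
      using count[of "r + R"] that R by (auto simp: add.assoc)
    have "density_in_disk (translates K V) r * ennreal (disk_area r) \<le>
        ennreal (area K) * pt_count V (r + R)"
      by (simp add: density_in_disk_translates[OF K that] area_in_disk_le[OF K R(2)])
    also have "\<dots> = ennreal (area K * card (V \<inter> cball 0 (r + R)))"
      using pos by (simp add: pt_count_finite[OF c(1)] ennreal_mult)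
    also have "\<dots> \<le> ennreal (area K * m / a * disk_area (r + (R + d)))"
      using c(2) pos \<open>a > 0\<close> by (intro ennreal_leI) (simp add: field_simps)
    also have "\<dots> = ennreal (area K * m / a) * ennreal (disk_area (r + (R + d)))"
      using pos assms(2-4) R that disk_area_pos[of "r + (R + d)"] by (intro ennreal_mult) auto
    finally show ?thesis by simp
  qed
  show "density_of_packing (translates K V) \<le> ennreal (area K * m / a)"
    "density_of_covering (translates K V) \<le> ennreal (area K * m / a)"
    using Limsup_Liminf_disk_ratio[where g = "\<lambda>_. 1", OF _ _ le] R pos assms(2-4)
    by (auto simp: density_of_packing_def density_of_covering_def Limsup_const Liminf_const)
qed

text \<open>The estimate is only requested for finite counts, since \<open>card\<close> is 0 on
  infinite sets; an infinite count makes the bound trivial.\<close>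

lemma density_ge_count:
  fixes a m d :: real
  assumes K: "convex_disk K" and "a > 0" "m \<ge> 0" "d \<ge> 0"
    and count: "\<And>r. r > 0 \<Longrightarrow> finite (V \<inter> cball 0 (r + d)) \<Longrightarrow>
      m * disk_area r \<le> card (V \<inter> cball 0 (r + d)) * a"
  shows "ennreal (area K * m / a) \<le> density_of_covering (translates K V)"
    and "ennreal (area K * m / a) \<le> density_of_packing (translates K V)"
proof -
  obtain R where R: "R > 0" "K \<subseteq> cball 0 R" using convex_disk_bounded[OF K] .
  have pos: "area K > 0" using K convex_disk_area_pos by auto
  have le: "ennreal (area K * m / a) * ennreal (disk_area r) \<le>
      ennreal 1 * (density_in_disk (translates K V) (r + (d + R)) * ennreal (disk_area (r + (d + R))))"
    if "r > 0" for r
  proof -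
    have "ennreal (area K * m / a) * ennreal (disk_area r) \<le> ennreal (area K) * pt_count V (r + d)"
    proof (cases "finite (V \<inter> cball 0 (r + d))")
      case True
      have "ennreal (area K * m / a) * ennreal (disk_area r) = ennreal (area K * m / a * disk_area r)"
        using pos assms(2,3) disk_area_pos[OF that] by (intro ennreal_mult[symmetric]) auto
      also have "\<dots> \<le> ennreal (area K * card (V \<inter> cball 0 (r + d)))"
        using count[OF that True] pos \<open>a > 0\<close> by (intro ennreal_leI) (simp add: field_simps)
      also have "\<dots> = ennreal (area K) * pt_count V (r + d)"
        using pos by (simp add: pt_count_finite[OF True] ennreal_mult)
      finally show ?thesis .
    next
      case False
      then show ?thesis using pos by (simp add: pt_count_infinite ennreal_mult_top)
    qed
    also have "\<dots> \<le> area_in_disk K V (r + d + R)"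
      by (rule area_in_disk_ge[OF K R(2)])
    also have "\<dots> = density_in_disk (translates K V) (r + (d + R)) * ennreal (disk_area (r + (d + R)))"
      using density_in_disk_translates[OF K, of "r + (d + R)"] that R \<open>d \<ge> 0\<close> by (simp add: add.assoc)
    finally show ?thesis by simp
  qed
  have "d + R \<ge> 0" using R assms by auto
  from Limsup_Liminf_disk_ratio(2)[where f = "\<lambda>_. ennreal (area K * m / a)", OF this _ le]
  show *: "ennreal (area K * m / a) \<le> density_of_covering (translates K V)"
    by (simp add: density_of_covering_def Liminf_const)
  have "density_of_covering (translates K V) \<le> density_of_packing (translates K V)"
    unfolding density_of_covering_def density_of_packing_def
    by (rule Liminf_le_Limsup) simp
  with * show "ennreal (area K * m / a) \<le> density_of_packing (translates K V)" by simp
qed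

section \<open>Lattice cells\<close>

definition int_points :: "(real^2) set" where
  "int_points = {x. x $ 1 \<in> \<int> \<and> x $ 2 \<in> \<int>}"

text \<open>Half-open, so that the integer translates partition the plane and no point is counted
  twice.\<close>

definition unit_cell :: "(real^2) set" where
  "unit_cell = {x. 0 \<le> x $ 1 \<and> x $ 1 < 1 \<and> 0 \<le> x $ 2 \<and> x $ 2 < 1}"

definition vfloor :: "real^2 \<Rightarrow> real^2" where
  "vfloor x = (\<chi> i. of_int \<lfloor>x $ i\<rfloor>)"

definition cell :: "real^2 \<Rightarrow> real^2 \<Rightarrow> real^2 \<Rightarrow> (real^2) set" where
  "cell u v z = lin u v ` (+) z ` unit_cell"

lemma int_points_simps:
  "x \<in> int_points \<Longrightarrow> y \<in> int_points \<Longrightarrow> x + y \<in> int_points"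
  "x \<in> int_points \<Longrightarrow> y \<in> int_points \<Longrightarrow> x - y \<in> int_points"
  "vfloor x \<in> int_points" "0 \<in> int_points"
  by (auto simp: int_points_def vfloor_def)

lemma vfloor_in_cell: "x - vfloor x \<in> unit_cell"
  by (auto simp: unit_cell_def vfloor_def) linarith+

lemma mem_unit_cell_iff: 
  assumes "z \<in> int_points"
  shows "x - z \<in> unit_cell \<longleftrightarrow> z = vfloor x"
proof
  assume "x - z \<in> unit_cell"
  then have b: "0 \<le> x $ i - z $ i \<and> x $ i - z $ i < 1" for i
    using exhaust_2[of i] by (auto simp: unit_cell_def)
  have "z $ i = of_int \<lfloor>x $ i\<rfloor>" for i
  proof -
    have "z $ i \<in> \<int>" using assms exhaust_2[of i] by (auto simp: int_points_def)
    then obtain k where k: "z $ i = of_int k" by (auto elim: Ints_cases)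
    then have "\<lfloor>x $ i\<rfloor> = k" using b[of i] by (intro floor_unique) auto
    then show ?thesis using k by simp
  qed
  then show "z = vfloor x" by (simp add: vfloor_def vec_eq_iff)
qed (simp add: vfloor_in_cell)

lemma lin_in_cell_iff:
  assumes "cross u v \<noteq> 0" "z \<in> int_points"
  shows "lin u v y \<in> cell u v z \<longleftrightarrow> z = vfloor y"
proof -
  have "lin u v y \<in> cell u v z \<longleftrightarrow> y \<in> (+) z ` unit_cell"
    unfolding cell_def using inj_lin[OF assms(1)] by (simp add: inj_image_mem_iff)
  also have "\<dots> \<longleftrightarrow> y - z \<in> unit_cell" by (force simp: image_iff)
  finally show ?thesis using mem_unit_cell_iff[OF assms(2)] by simp
qed

lemma lin_surj: "cross u v \<noteq> 0 \<Longrightarrow> \<exists>y. x = lin u v y"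
  by (metis lin_inverse)

lemma cell_disjoint:
  assumes "cross u v \<noteq> 0" "z \<in> int_points" "z' \<in> int_points" "z \<noteq> z'"
  shows "cell u v z \<inter> cell u v z' = {}"
proof (rule equals0I)
  fix x assume "x \<in> cell u v z \<inter> cell u v z'"
  moreover obtain y where "x = lin u v y" using lin_surj[OF assms(1)] by blast
  ultimately show False using assms by (simp add: lin_in_cell_iff)
qed

lemma cell_cover:
  assumes "cross u v \<noteq> 0"
  obtains z where "z \<in> int_points" "x \<in> cell u v z"
proof -
  obtain y where "x = lin u v y" using lin_surj[OF assms(1)] by blast
  then show ?thesis
    using that[of "vfloor y"] lin_in_cell_iff[OF assms] int_points_simps(3) by metis
qed

lemma norm_lin_le: "norm (lin u v x) \<le> \<bar>x $ 1\<bar> * norm u + \<bar>x $ 2\<bar> * norm v"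
  unfolding lin_def by (rule norm_triangle_le) simp

lemma cell_dist:
  assumes "x \<in> cell u v z" "y \<in> cell u v z"
  shows "norm (x - y) \<le> norm u + norm v"
proof -
  obtain p q where p: "p \<in> unit_cell" "x = lin u v (z + p)" and q: "q \<in> unit_cell" "y = lin u v (z + q)"
    using assms by (auto simp: cell_def)
  have "norm (x - y) = norm (lin u v (p - q))" by (simp add: p q lin_simps)
  also have "\<dots> \<le> \<bar>(p - q) $ 1\<bar> * norm u + \<bar>(p - q) $ 2\<bar> * norm v" by (rule norm_lin_le)
  also have "\<dots> \<le> 1 * norm u + 1 * norm v"
    using p(1) q(1) by (intro add_mono mult_right_mono) (auto simp: unit_cell_def abs_le_iff)
  finally show ?thesis by simp
qed

lemma unit_cell_area: "unit_cell \<in> lmeasurable" "area unit_cell = 1"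
proof -
  have sub: "box 0 1 \<subseteq> unit_cell" "unit_cell \<subseteq> cbox 0 (1::real^2)"
    by (auto simp: unit_cell_def mem_box_cart forall_2)
  have "unit_cell = {x. 0 \<le> x $ 1} \<inter> {x. x $ 1 < 1} \<inter> {x. 0 \<le> x $ 2} \<inter> {x. x $ 2 < 1}"
    by (auto simp: unit_cell_def)
  also have "\<dots> \<in> sets borel"
    by (intro sets.Int borel_closed borel_open closed_Collect_le open_Collect_less continuous_intros)
  finally have "unit_cell \<in> sets lebesgue" by simp
  then show m: "unit_cell \<in> lmeasurable"
    using sub(2) bounded_cbox bounded_subset bounded_set_imp_lmeasurable by blast
  have "area (cbox 0 (1::real^2)) = measure lborel (cbox 0 (1::real^2))"
    "area (box 0 (1::real^2)) = measure lborel (box 0 (1::real^2))"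
    by (auto intro!: measure_completion)
  moreover have "measure lborel (cbox 0 (1::real^2)) = 1"
    using content_cbox_cart[of 0 "1::real^2"] sub by (simp add: interval_ne_empty_cart)
  moreover have "measure lborel (box 0 (1::real^2)) = measure lborel (cbox 0 (1::real^2))"
    by (simp add: measure_def emeasure_lborel_box_eq emeasure_lborel_cbox_eq)
  moreover have "area (box 0 1) \<le> area unit_cell" "area unit_cell \<le> area (cbox 0 1)"
    using sub m by (intro measure_mono_fmeasurable; simp)+
  ultimately show "area unit_cell = 1" by simp
qed

lemma cell_area: "cell u v z \<in> lmeasurable" "area (cell u v z) = \<bar>cross u v\<bar>"
proof -
  have m: "(+) z ` unit_cell \<in> lmeasurable"
    using unit_cell_area(1) measurable_translation by blast
  show "cell u v z \<in> lmeasurable" unfolding cell_def by (rule lmeasurable_lin[OF m])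
  show "area (cell u v z) = \<bar>cross u v\<bar>"
    unfolding cell_def by (simp add: area_lin[OF m] area_translation unit_cell_area)
qed

lemma area_cell_Union:
  assumes "cross u v \<noteq> 0" "finite J" "J \<subseteq> int_points"
  shows "(\<Union>z\<in>J. cell u v z) \<in> lmeasurable" "area (\<Union>z\<in>J. cell u v z) = card J * \<bar>cross u v\<bar>"
proof -
  show "(\<Union>z\<in>J. cell u v z) \<in> lmeasurable"
    using assms(2) by (intro fmeasurable.finite_UN cell_area) auto
  have "area (\<Union>z\<in>J. cell u v z) = (\<Sum>z\<in>J. area (cell u v z))"
    using assms cell_disjoint[OF assms(1)] cell_area(1)
    by (intro measure_UNION') (auto simp: pairwise_def disjnt_def subset_iff)
  then show "area (\<Union>z\<in>J. cell u v z) = card J * \<bar>cross u v\<bar>" by (simp add: cell_area)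
qed

text \<open>Cells are disjoint and all have area \<open>\<bar>cross u v\<bar>\<close>. Those that
  meet a disk cover it and stay in the disk enlarged by the diameter bound
  \<open>norm u + norm v\<close>, so comparing areas bounds their number on both sides and gives
  finiteness.\<close>

lemma finite_cells_meeting_disk:
  assumes "cross u v \<noteq> 0" "r > 0"
  defines "I \<equiv> {z\<in>int_points. cell u v z \<inter> cball 0 r \<noteq> {}}"
  shows "finite I" "card I * \<bar>cross u v\<bar> \<le> disk_area (r + (norm u + norm v))"
    "disk_area r \<le> card I * \<bar>cross u v\<bar>"
    "\<And>z. z \<in> I \<Longrightarrow> cell u v z \<subseteq> cball 0 (r + (norm u + norm v))"
    "cball 0 r \<subseteq> (\<Union>z\<in>I. cell u v z)"
proof -
  show sub: "cell u v z \<subseteq> cball 0 (r + (norm u + norm v))" if "z \<in> I" for z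
  proof
    fix x assume x: "x \<in> cell u v z"
    obtain y where y: "y \<in> cell u v z" "norm y \<le> r" using \<open>z \<in> I\<close> by (auto simp: I_def)
    have "norm x \<le> norm y + norm (x - y)" using norm_triangle_ineq[of y "x - y"] by simp
    then show "x \<in> cball 0 (r + (norm u + norm v))" using cell_dist[OF x y(1)] y(2) by simp
  qed
  have le: "card J * \<bar>cross u v\<bar> \<le> disk_area (r + (norm u + norm v))" if J: "J \<subseteq> I" "finite J" for J
  proof -
    have "J \<subseteq> int_points" using J by (auto simp: I_def)
    note c = area_cell_Union[OF assms(1) J(2) this]
    have "area (\<Union>z\<in>J. cell u v z) \<le> area (cball 0 (r + (norm u + norm v)))"
      using J sub c by (intro measure_mono_fmeasurable) (auto simp: lmeasurable_cball)
    then show ?thesis using c by (simp add: disk_area_def)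
  qed
  show fin: "finite I"
  proof (rule ccontr)
    assume "infinite I"
    obtain n :: nat where n: "disk_area (r + (norm u + norm v)) < n * \<bar>cross u v\<bar>"
      using assms(1) reals_Archimedean3[of "\<bar>cross u v\<bar>"] by auto
    obtain J where "J \<subseteq> I" "finite J" "card J = n"
      using infinite_arbitrarily_large[OF \<open>infinite I\<close>] by metis
    then show False using le[of J] n by simp
  qed
  show "card I * \<bar>cross u v\<bar> \<le> disk_area (r + (norm u + norm v))" using le fin by blast
  show cov: "cball 0 r \<subseteq> (\<Union>z\<in>I. cell u v z)"
  proof
    fix x :: "real^2" assume "x \<in> cball 0 r"
    moreover obtain z where "z \<in> int_points" "x \<in> cell u v z" using cell_cover[OF assms(1)] .
    ultimately show "x \<in> (\<Union>z\<in>I. cell u v z)" unfolding I_def by blast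
  qed
  have "I \<subseteq> int_points" by (auto simp: I_def)
  note c = area_cell_Union[OF assms(1) fin this]
  have "area (cball 0 r) \<le> area (\<Union>z\<in>I. cell u v z)"
    using cov c by (intro measure_mono_fmeasurable) auto
  then show "disk_area r \<le> card I * \<bar>cross u v\<bar>" using c by (simp add: disk_area_def)
qed

lemma count_le_of_cells:
  fixes m :: real
  assumes uv: "cross u v \<noteq> 0" "r > 0"
    and m: "\<And>z. z \<in> int_points \<Longrightarrow> finite (V \<inter> cell u v z) \<and> card (V \<inter> cell u v z) \<le> m"
  shows "finite (V \<inter> cball 0 r) \<and>
    card (V \<inter> cball 0 r) * \<bar>cross u v\<bar> \<le> m * disk_area (r + (norm u + norm v))"
proof
  define I where "I = {z\<in>int_points. cell u v z \<inter> cball 0 r \<noteq> {}}"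
  note I = finite_cells_meeting_disk[OF uv, folded I_def]
  have sub: "V \<inter> cball 0 r \<subseteq> (\<Union>z\<in>I. V \<inter> cell u v z)" using I(5) by blast
  have fin: "finite (\<Union>z\<in>I. V \<inter> cell u v z)"
    using I(1) m by (intro finite_UN_I) (auto simp: I_def)
  show "finite (V \<inter> cball 0 r)" using finite_subset[OF sub fin] .
  have m0: "m \<ge> 0" using m[OF int_points_simps(4)] by linarith
  have "card (V \<inter> cball 0 r) \<le> card (\<Union>z\<in>I. V \<inter> cell u v z)" by (rule card_mono[OF fin sub])
  also have "\<dots> \<le> (\<Sum>z\<in>I. card (V \<inter> cell u v z))" by (rule card_UN_le[OF I(1)])
  finally have "real (card (V \<inter> cball 0 r)) \<le> (\<Sum>z\<in>I. real (card (V \<inter> cell u v z)))"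
    by (simp flip: of_nat_sum)
  also have "\<dots> \<le> (\<Sum>z\<in>I. m)" by (rule sum_mono) (use m in \<open>auto simp: I_def\<close>)
  finally have "real (card (V \<inter> cball 0 r)) \<le> m * card I" by (simp add: mult_ac)
  then have "real (card (V \<inter> cball 0 r)) * \<bar>cross u v\<bar> \<le> (m * card I) * \<bar>cross u v\<bar>"
    by (rule mult_right_mono) simp
  then have "real (card (V \<inter> cball 0 r)) * \<bar>cross u v\<bar> \<le> m * (card I * \<bar>cross u v\<bar>)"
    by (simp add: mult_ac)
  also have "\<dots> \<le> m * disk_area (r + (norm u + norm v))" by (rule mult_left_mono[OF I(2) m0])
  finally show "card (V \<inter> cball 0 r) * \<bar>cross u v\<bar> \<le> m * disk_area (r + (norm u + norm v))" .
qed

lemma count_ge_of_cells: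
  fixes m :: real
  assumes uv: "cross u v \<noteq> 0" "r > 0" and "m \<ge> 0"
    and m: "\<And>z. z \<in> int_points \<Longrightarrow> finite (V \<inter> cell u v z) \<Longrightarrow> m \<le> card (V \<inter> cell u v z)"
    and fin: "finite (V \<inter> cball 0 (r + (norm u + norm v)))"
  shows "m * disk_area r \<le> card (V \<inter> cball 0 (r + (norm u + norm v))) * \<bar>cross u v\<bar>"
proof -
  define I where "I = {z\<in>int_points. cell u v z \<inter> cball 0 r \<noteq> {}}"
  note I = finite_cells_meeting_disk[OF uv, folded I_def]
  have Iint: "I \<subseteq> int_points" by (auto simp: I_def)
  have sub: "(\<Union>z\<in>I. V \<inter> cell u v z) \<subseteq> V \<inter> cball 0 (r + (norm u + norm v))" using I(4) by blast
  then have fz: "finite (V \<inter> cell u v z)" if "z \<in> I" for z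
    using that fin by (meson UN_upper finite_subset order_trans)
  have "m * disk_area r \<le> m * (card I * \<bar>cross u v\<bar>)" by (rule mult_left_mono[OF I(3) \<open>m \<ge> 0\<close>])
  also have "\<dots> = (\<Sum>z\<in>I. m) * \<bar>cross u v\<bar>" by simp
  also have "\<dots> \<le> (\<Sum>z\<in>I. real (card (V \<inter> cell u v z))) * \<bar>cross u v\<bar>"
    using m fz Iint by (intro mult_right_mono sum_mono) auto
  also have "(\<Sum>z\<in>I. real (card (V \<inter> cell u v z))) = card (\<Union>z\<in>I. V \<inter> cell u v z)"
  proof (subst card_UN_disjoint)
    show "\<forall>i\<in>I. \<forall>j\<in>I. i \<noteq> j \<longrightarrow> V \<inter> cell u v i \<inter> (V \<inter> cell u v j) = {}"
      using cell_disjoint[OF uv(1)] Iint by blast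
  qed (use I(1) fz in auto)
  also have "\<dots> * \<bar>cross u v\<bar> \<le> card (V \<inter> cball 0 (r + (norm u + norm v))) * \<bar>cross u v\<bar>"
    using card_mono[OF fin sub] by (intro mult_right_mono) auto
  finally show ?thesis .
qed

text \<open>Bounds in every single cell are required, not on average; periodic sets satisfy them,
  and so do the rescaled arrangements in the proof of affine invariance.\<close>

lemma density_le_of_cells:
  fixes m :: real
  assumes K: "convex_disk K" and uv: "cross u v \<noteq> 0"
    and m: "\<And>z. z \<in> int_points \<Longrightarrow> finite (V \<inter> cell u v z) \<and> card (V \<inter> cell u v z) \<le> m"
  shows "density_of_packing (translates K V) \<le> ennreal (area K * m / \<bar>cross u v\<bar>)"
    and "density_of_covering (translates K V) \<le> ennreal (area K * m / \<bar>cross u v\<bar>)"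
proof -
  have "m \<ge> 0" using m[OF int_points_simps(4)] by linarith
  then show "density_of_packing (translates K V) \<le> ennreal (area K * m / \<bar>cross u v\<bar>)"
    "density_of_covering (translates K V) \<le> ennreal (area K * m / \<bar>cross u v\<bar>)"
    using uv count_le_of_cells[OF uv _ m]
    by (auto intro!: density_le_count[OF K, where d = "norm u + norm v"])
qed

lemma density_ge_of_cells:
  fixes m :: real
  assumes K: "convex_disk K" and uv: "cross u v \<noteq> 0" and "m \<ge> 0"
    and m: "\<And>z. z \<in> int_points \<Longrightarrow> finite (V \<inter> cell u v z) \<Longrightarrow> m \<le> card (V \<inter> cell u v z)"
  shows "ennreal (area K * m / \<bar>cross u v\<bar>) \<le> density_of_covering (translates K V)"
    and "ennreal (area K * m / \<bar>cross u v\<bar>) \<le> density_of_packing (translates K V)"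
  using uv \<open>m \<ge> 0\<close> count_ge_of_cells[OF uv _ \<open>m \<ge> 0\<close> m]
  by (auto intro!: density_ge_count[OF K, where d = "norm u + norm v"])

lemma is_lattice_iff:
  "is_lattice L \<longleftrightarrow> (\<exists>u v. cross u v \<noteq> 0 \<and> L = lin u v ` int_points)"
proof -
  have "(u \<noteq> v \<and> independent {u, v}) \<longleftrightarrow> cross u v \<noteq> 0" for u v :: "real^2"
  proof
    assume uv: "u \<noteq> v \<and> independent {u, v}"
    show "cross u v \<noteq> 0"
    proof
      assume c: "cross u v = 0"
      have 0: "v $ i *\<^sub>R u - u $ i *\<^sub>R v = 0" for i
        using c exhaust_2[of i] by (auto simp: vec2_eq_iff cross_def algebra_simps)
      have "v $ i = 0 \<and> u $ i = 0" for i
      proof (rule ccontr)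
        assume n: "\<not> (v $ i = 0 \<and> u $ i = 0)"
        have "dependent {u, v}"
          unfolding dependent_explicit
          using 0[of i] n uv
          by (intro exI[of _ "{u, v}"] exI[of _ "\<lambda>x. if x = u then v $ i else - u $ i"]) auto
        then show False using uv by blast
      qed
      then have "u = 0" by (simp add: vec_eq_iff)
      then show False using uv dependent_zero by blast
    qed
  next
    assume c: "cross u v \<noteq> 0"
    have "a = 0 \<and> b = 0" if "a *\<^sub>R u + b *\<^sub>R v = 0" for a b
    proof -
      have "cross (a *\<^sub>R u + b *\<^sub>R v) v = 0" "cross u (a *\<^sub>R u + b *\<^sub>R v) = 0"
        using that by (auto simp: cross_simps)
      then show ?thesis using c by (simp add: cross_simps)
    qed
    moreover have "u \<noteq> v" using c by (auto simp: cross_simps)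
    moreover have "independent {u, v}"
    proof -
      have "v \<noteq> 0" using c by (auto simp: cross_simps)
      moreover have "u \<notin> span {v}"
        using c by (auto simp: span_singleton cross_simps)
      ultimately show ?thesis using \<open>u \<noteq> v\<close> by (simp add: independent_insert)
    qed
    ultimately show "u \<noteq> v \<and> independent {u, v}" by blast
  qed
  moreover have "{of_int a *\<^sub>R u + of_int b *\<^sub>R v | (a::int) (b::int). True} = lin u v ` int_points" for u v
  proof safe
    fix a b :: int
    have "of_int a *\<^sub>R u + of_int b *\<^sub>R v = lin u v (vector [of_int a, of_int b])"
      by (simp add: lin_def)
    then show "of_int a *\<^sub>R u + of_int b *\<^sub>R v \<in> lin u v ` int_points"
      by (auto simp: int_points_def)
  next
    fix x assume "x \<in> int_points"
    then show "\<exists>a b. lin u v x = real_of_int a *\<^sub>R u + real_of_int b *\<^sub>R v \<and> True"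
      by (auto simp: int_points_def lin_def elim!: Ints_cases) blast
  qed
  ultimately show ?thesis unfolding is_lattice_def by (metis (no_types, lifting))
qed

lemma lattice_Int_cell:
  assumes "cross u v \<noteq> 0" "z \<in> int_points"
  shows "lin u v ` int_points \<inter> cell u v z = {lin u v z}"
proof -
  have fl: "vfloor y = y" if "y \<in> int_points" for y
    using that by (auto simp: vfloor_def int_points_def vec2_eq_iff elim!: Ints_cases)
  then show ?thesis using assms by (auto simp: lin_in_cell_iff)
qed

text \<open>Every cell contains exactly one point of the lattice, so that the upper and lower
  estimates by cells coincide.\<close>

lemma lattice_density:
  assumes K: "convex_disk K" and uv: "cross u v \<noteq> 0"
  shows "density_of_packing (translates K (lin u v ` int_points)) = ennreal (area K / \<bar>cross u v\<bar>)"
    and "density_of_covering (translates K (lin u v ` int_points)) = ennreal (area K / \<bar>cross u v\<bar>)"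
proof -
  have a: "z \<in> int_points \<Longrightarrow> finite (lin u v ` int_points \<inter> cell u v z) \<and>
      card (lin u v ` int_points \<inter> cell u v z) \<le> (1::real)"
    and b: "z \<in> int_points \<Longrightarrow> 1 \<le> real (card (lin u v ` int_points \<inter> cell u v z))" for z
    using lattice_Int_cell[OF uv] by auto
  show "density_of_packing (translates K (lin u v ` int_points)) = ennreal (area K / \<bar>cross u v\<bar>)"
    "density_of_covering (translates K (lin u v ` int_points)) = ennreal (area K / \<bar>cross u v\<bar>)"
    using density_le_of_cells[OF K uv a] density_ge_of_cells[OF K uv _ b] by (auto intro: antisym)
qed

section \<open>Affine invariance and monotonicity of the densities\<close>

text \<open>Packing expressed by vectors and points, without translated sets; in this form it
  transfers along linear maps and to periodic sets.\<close>

definition pk :: "(real^2) set \<Rightarrow> (real^2) set \<Rightarrow> bool" where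
  "pk K V \<longleftrightarrow> (\<forall>v\<in>V. \<forall>w\<in>V. \<forall>x. x - v \<in> interior K \<longrightarrow> x - w \<in> interior K \<longrightarrow> v = w)"

definition cv :: "(real^2) set \<Rightarrow> (real^2) set \<Rightarrow> bool" where
  "cv K V \<longleftrightarrow> (\<forall>x. \<exists>v\<in>V. x - v \<in> K)"

lemma mem_translate_iff: "x \<in> (+) v ` K \<longleftrightarrow> x - v \<in> K" for x v :: "real^2"
  by (force simp: image_iff)

lemma packing_translates_iff:
  assumes "convex_disk K"
  shows "packing (translates K V) \<longleftrightarrow> pk K V"
proof -
  have inj: "(+) v ` K = (+) w ` K \<longleftrightarrow> v = w" for v w
    using inj_on_translates[OF convex_disk_compact[OF assms] convex_disk_nonempty[OF assms], of UNIV]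
    by (auto simp: inj_on_def)
  have "packing (translates K V) \<longleftrightarrow>
      (\<forall>v\<in>V. \<forall>w\<in>V. v \<noteq> w \<longrightarrow> interior ((+) v ` K) \<inter> interior ((+) w ` K) = {})"
    unfolding packing_def translates_def pairwise_def using inj by auto
  also have "\<dots> \<longleftrightarrow> pk K V"
    unfolding pk_def interior_translation
    by (auto simp: mem_translate_iff disjoint_iff)
  finally show ?thesis .
qed

lemma covering_translates_iff: "covering (translates K V) \<longleftrightarrow> cv K V"
  unfolding covering_def translates_def cv_def set_eq_iff
  by (auto simp: mem_translate_iff)

text \<open>The predicate \<open>P\<close> restricts the vector sets: all sets give the translative,
  \<open>is_lattice\<close> the lattice densities. Values stay in \<open>ennreal\<close>, where
  suprema and infima always exist.\<close>

definition pack_density :: "((real^2) set \<Rightarrow> bool) \<Rightarrow> (real^2) set \<Rightarrow> ennreal" where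
  "pack_density P K = (SUP V\<in>{V. P V \<and> pk K V}. density_of_packing (translates K V))"

definition cov_density :: "((real^2) set \<Rightarrow> bool) \<Rightarrow> (real^2) set \<Rightarrow> ennreal" where
  "cov_density P K = (INF V\<in>{V. P V \<and> cv K V}. density_of_covering (translates K V))"

lemma densities_eq:
  assumes "convex_disk K"
  shows "delta_T K = enn2real (pack_density (\<lambda>_. True) K)"
    and "delta_L K = enn2real (pack_density is_lattice K)"
    and "theta_T K = enn2real (cov_density (\<lambda>_. True) K)"
    and "theta_L K = enn2real (cov_density is_lattice K)"
proof -
  have im: "{translates K V | V. Q V} = translates K ` {V. Q V}" for Q by auto
  show "delta_T K = enn2real (pack_density (\<lambda>_. True) K)"
    "delta_L K = enn2real (pack_density is_lattice K)"
    "theta_T K = enn2real (cov_density (\<lambda>_. True) K)"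
    "theta_L K = enn2real (cov_density is_lattice K)"
    unfolding delta_T_def delta_L_def theta_T_def theta_L_def pack_density_def cov_density_def
    by (simp_all add: im image_image packing_translates_iff[OF assms] covering_translates_iff)
qed

text \<open>The open translates are disjoint, have the full area of \<open>K\<close> because the
  frontier of a convex set is negligible, and fit into the disk of radius
  \<open>r + R\<close>.\<close>

lemma pk_count:
  assumes K: "convex_disk K" "K \<subseteq> cball 0 R" and "pk K V"
  shows "finite (V \<inter> cball 0 r) \<and> card (V \<inter> cball 0 r) * area K \<le> disk_area (r + R)"
proof -
  have pos: "area K > 0" using K convex_disk_area_pos by auto
  have K': "convex K" "compact K" using K by (auto simp: convex_disk_def)
  have int: "area (interior K) = area K" "interior K \<in> lmeasurable"
    by (rule measure_interior[OF compact_imp_bounded[OF K'(2)] negligible_convex_frontier[OF K'(1)]])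
      (rule lmeasurable_interior[OF compact_imp_bounded[OF K'(2)]])
  have le: "card J * area K \<le> disk_area (r + R)" if J: "J \<subseteq> V \<inter> cball 0 r" "finite J" for J
  proof -
    have m: "(+) v ` interior K \<in> lmeasurable" for v
      using int(2) measurable_translation by blast
    have "card J * area K = (\<Sum>v\<in>J. area ((+) v ` interior K))"
      by (simp add: area_translation int)
    also have "\<dots> = area (\<Union>v\<in>J. (+) v ` interior K)"
    proof (rule measure_UNION'[symmetric])
      show "pairwise (\<lambda>v w. disjnt ((+) v ` interior K) ((+) w ` interior K)) J"
        using J(1) \<open>pk K V\<close> unfolding pairwise_def disjnt_iff mem_translate_iff pk_def by blast
    qed (use J(2) m in auto)
    also have "\<dots> \<le> area (cball 0 (r + R))"
    proof (rule measure_mono_fmeasurable)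
      show "(\<Union>v\<in>J. (+) v ` interior K) \<subseteq> cball 0 (r + R)"
      proof clarsimp
        fix v x assume "v \<in> J" "x \<in> interior K"
        then have "norm v \<le> r" "norm x \<le> R" using J K interior_subset[of K] by auto
        then show "norm (v + x) \<le> r + R" using norm_triangle_ineq[of v x] by simp
      qed
      show "(\<Union>v\<in>J. (+) v ` interior K) \<in> sets lebesgue"
        using J(2) m by (intro sets.finite_UN) auto
    qed simp
    finally show ?thesis by (simp add: disk_area_def)
  qed
  have "finite (V \<inter> cball 0 r)"
  proof (rule ccontr)
    assume inf: "infinite (V \<inter> cball 0 r)"
    obtain n :: nat where n: "disk_area (r + R) < n * area K"
      using pos reals_Archimedean3[of "area K"] by auto
    obtain J where "J \<subseteq> V \<inter> cball 0 r" "finite J" "card J = n"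
      using infinite_arbitrarily_large[OF inf] by metis
    then show False using le[of J] n by simp
  qed
  then show ?thesis using le by blast
qed

lemma pack_density_le_1:
  assumes K: "convex_disk K"
  shows "pack_density P K \<le> 1"
proof -
  obtain R where R: "R > 0" "K \<subseteq> cball 0 R" using convex_disk_bounded[OF K] .
  have pos: "area K > 0" using K convex_disk_area_pos by auto
  have "density_of_packing (translates K V) \<le> ennreal (area K * 1 / area K)" if "pk K V" for V
    using pk_count[OF K R(2) that] R pos
    by (intro density_le_count(1)[OF K, where d = R]) auto
  then show ?thesis unfolding pack_density_def using pos by (auto intro!: SUP_least)
qed

lemma lattice_covering_exists:
  assumes K: "convex_disk K"
  obtains L where "is_lattice L" "cv K L"
proof -
  obtain a \<rho> where a: "\<rho> > 0" "cball a \<rho> \<subseteq> K"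
    using K unfolding convex_disk_def by (metis all_not_in_conv mem_interior_cball)
  \<comment> \<open>Every point of a square cell of side \<open>\<rho> / 2\<close> is within
    \<open>\<rho>\<close> of its corner, so the disks of radius \<open>\<rho>\<close> inscribed in
    the translates already cover.\<close>
  define s where "s = \<rho> / 2"
  define u :: "real^2" where "u = s *\<^sub>R axis 1 1"
  define v :: "real^2" where "v = s *\<^sub>R axis 2 1"
  have uv: "cross u v \<noteq> 0" using a by (simp add: u_def v_def cross_def axis_def s_def)
  have "cv K (lin u v ` int_points)"
    unfolding cv_def
  proof
    fix x
    obtain y where y: "x - a = lin u v y" using lin_surj[OF uv] by blast
    have "norm (lin u v (y - vfloor y)) \<le> \<bar>(y - vfloor y) $ 1\<bar> * norm u + \<bar>(y - vfloor y) $ 2\<bar> * norm v"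
      by (rule norm_lin_le)
    also have "\<dots> \<le> 1 * norm u + 1 * norm v"
      using vfloor_in_cell[of y] by (intro add_mono mult_right_mono) (auto simp: unit_cell_def)
    also have "\<dots> \<le> \<rho>" using a by (simp add: u_def v_def s_def)
    finally have "a + lin u v (y - vfloor y) \<in> K" using a(2) by (auto simp: dist_norm subset_iff)
    also have "a + lin u v (y - vfloor y) = x - lin u v (vfloor y)"
      using y by (simp add: lin_simps algebra_simps)
    finally show "\<exists>v\<in>lin u v ` int_points. x - v \<in> K" using int_points_simps by blast
  qed
  then show ?thesis using that uv is_lattice_iff by blast
qed

lemma lattice_density_finite:
  assumes "convex_disk K" "is_lattice L"
  shows "density_of_covering (translates K L) < top"
  using assms lattice_density by (auto simp: is_lattice_iff)

lemma cov_density_finite: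
  assumes K: "convex_disk K" and P: "\<And>L. is_lattice L \<Longrightarrow> P L"
  shows "cov_density P K < top"
proof -
  obtain L where L: "is_lattice L" "cv K L" using lattice_covering_exists[OF K] .
  have "cov_density P K \<le> density_of_covering (translates K L)"
    unfolding cov_density_def using L P by (intro INF_lower) auto
  then show ?thesis using lattice_density_finite[OF K L(1)] by simp
qed

lemma pk_mono: "K \<subseteq> K' \<Longrightarrow> pk K' V \<Longrightarrow> pk K V"
  unfolding pk_def using interior_mono by blast

lemma cv_mono: "K \<subseteq> K' \<Longrightarrow> cv K V \<Longrightarrow> cv K' V"
  unfolding cv_def by blast

text \<open>A packing by \<open>K'\<close> is reused for \<open>K\<close>, which changes its density
  by at most the ratio of the areas. The hypothesis \<open>sub\<close> speaks of \<open>pk\<close>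
  and not of inclusion, so that translated bodies are included.\<close>

lemma pack_density_mono:
  assumes K: "convex_disk K" "convex_disk K'" and sub: "\<And>V. pk K' V \<Longrightarrow> pk K V"
    and q: "area K' \<le> q * area K"
  shows "enn2real (pack_density P K') \<le> q * enn2real (pack_density P K)"
proof -
  have a: "area K > 0" "area K' > 0" using K convex_disk_area_pos by auto
  have fin: "pack_density P K < top" using pack_density_le_1[OF K(1), of P] by (rule order.strict_trans1) simp
  have q0: "q \<ge> 0"
  proof (rule ccontr)
    assume "\<not> q \<ge> 0" then have "q * area K \<le> 0" using a by (simp add: mult_nonpos_nonneg)
    then show False using q a by linarith
  qed
  have "pack_density P K' \<le> ennreal q * pack_density P K"
    unfolding pack_density_def[of P K']
  proof (rule SUP_least)
    fix V assume V: "V \<in> {V. P V \<and> pk K' V}"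
    have "density_of_packing (translates K' V) \<le>
        ennreal (area K' / area K) * density_of_packing (translates K V)"
      by (rule density_compare[OF K])
    also have "\<dots> \<le> ennreal q * pack_density P K"
    proof (rule mult_mono)
      show "ennreal (area K' / area K) \<le> ennreal q"
        using q a by (intro ennreal_leI) (simp add: field_simps)
      show "density_of_packing (translates K V) \<le> pack_density P K"
        unfolding pack_density_def using V sub by (intro SUP_upper) auto
    qed auto
    finally show "density_of_packing (translates K' V) \<le> ennreal q * pack_density P K" .
  qed
  then have "enn2real (pack_density P K') \<le> enn2real (ennreal q * pack_density P K)"
    using fin by (intro enn2real_mono) (auto simp: ennreal_mult_less_top)
  then show ?thesis using q0 by (simp add: enn2real_mult)
qed

text \<open>The same exchange in the other direction: a covering by \<open>K\<close> is reused for
  \<open>K'\<close>. The premise on lattices makes the infimum finite; at infinity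
  \<open>enn2real\<close> would return 0.\<close>

lemma cov_density_mono:
  assumes K: "convex_disk K" "convex_disk K'" and sub: "\<And>V. cv K V \<Longrightarrow> cv K' V"
    and q: "area K' \<le> q * area K" and P: "\<And>L. is_lattice L \<Longrightarrow> P L"
  shows "enn2real (cov_density P K') \<le> q * enn2real (cov_density P K)"
proof -
  have a: "area K > 0" "area K' > 0" using K convex_disk_area_pos by auto
  have fin: "cov_density P K < top" using cov_density_finite[OF K(1) P] .
  have q0: "q > 0"
  proof (rule ccontr)
    assume "\<not> q > 0" then have "q * area K \<le> 0" using a by (simp add: mult_nonpos_nonneg)
    then show False using q a by linarith
  qed
  \<comment> \<open>With the factor moved to the left, the infimum over coverings by
    \<open>K\<close> stands alone on the right.\<close>
  have "ennreal (1 / q) * cov_density P K' \<le> cov_density P K"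
    unfolding cov_density_def[of P K]
  proof (rule INF_greatest)
    fix V assume V: "V \<in> {V. P V \<and> cv K V}"
    have "cov_density P K' \<le> density_of_covering (translates K' V)"
      unfolding cov_density_def using V sub by (intro INF_lower) auto
    also have "\<dots> \<le> ennreal (area K' / area K) * density_of_covering (translates K V)"
      by (rule density_compare[OF K])
    also have "\<dots> \<le> ennreal q * density_of_covering (translates K V)"
      using q a by (intro mult_right_mono ennreal_leI) (auto simp: field_simps)
    finally have "ennreal (1 / q) * cov_density P K' \<le>
        ennreal (1 / q) * (ennreal q * density_of_covering (translates K V))"
      by (rule mult_left_mono) simp
    also have "\<dots> = density_of_covering (translates K V)"
      using q0 by (simp add: mult.assoc[symmetric] flip: ennreal_mult)
    finally show "ennreal (1 / q) * cov_density P K' \<le> density_of_covering (translates K V)" .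
  qed
  then have "enn2real (ennreal (1 / q) * cov_density P K') \<le> enn2real (cov_density P K)"
    using fin by (intro enn2real_mono) auto
  then have "1 / q * enn2real (cov_density P K') \<le> enn2real (cov_density P K)"
    using q0 by (simp add: enn2real_mult)
  then show ?thesis using q0 by (simp add: field_simps)
qed

lemma pk_translation: "pk ((+) a ` K) V \<longleftrightarrow> pk K V"
proof -
  have "pk K V \<Longrightarrow> pk ((+) a ` K) V" for a K
    unfolding pk_def interior_translation mem_translate_iff
  proof (intro ballI allI impI)
    fix v w x assume h: "\<forall>v\<in>V. \<forall>w\<in>V. \<forall>x. x - v \<in> interior K \<longrightarrow> x - w \<in> interior K \<longrightarrow> v = w"
      and vw: "v \<in> V" "w \<in> V" and x: "x - v - a \<in> interior K" "x - w - a \<in> interior K"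
    have "(x - a) - v \<in> interior K" "(x - a) - w \<in> interior K" using x by (simp_all add: algebra_simps)
    then show "v = w" using h vw by blast
  qed
  from this[of K a] this[of "(+) a ` K" "-a"] show ?thesis
    by (auto simp: image_image)
qed

lemma cv_translation: "cv ((+) a ` K) V \<longleftrightarrow> cv K V"
proof -
  have *: "cv ((+) a ` K) V" if K: "cv K V" for a K
    unfolding cv_def mem_translate_iff
  proof
    fix x
    obtain v where "v \<in> V" "(x - a) - v \<in> K" using K unfolding cv_def by blast
    then show "\<exists>v\<in>V. x - v - a \<in> K" by (intro bexI[of _ v]) (auto simp: algebra_simps)
  qed
  from *[of K a] *[of "(+) a ` K" "-a"] show ?thesis
    by (auto simp: image_image)
qed

lemma pack_density_translation:
  assumes K: "convex_disk K"
  shows "enn2real (pack_density P ((+) a ` K)) = enn2real (pack_density P K)"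
proof (rule antisym)
  note K' = convex_disk_translation[OF K, of a]
  have "enn2real (pack_density P ((+) a ` K)) \<le> 1 * enn2real (pack_density P K)"
    by (rule pack_density_mono[OF K K']) (simp_all only: pk_translation area_translation mult_1 order_refl)
  then show "enn2real (pack_density P ((+) a ` K)) \<le> enn2real (pack_density P K)" by simp
  have "enn2real (pack_density P K) \<le> 1 * enn2real (pack_density P ((+) a ` K))"
    by (rule pack_density_mono[OF K' K]) (simp_all only: pk_translation area_translation mult_1 order_refl)
  then show "enn2real (pack_density P K) \<le> enn2real (pack_density P ((+) a ` K))" by simp
qed

lemma cov_density_translation:
  assumes K: "convex_disk K" and P: "\<And>L. is_lattice L \<Longrightarrow> P L"
  shows "enn2real (cov_density P ((+) a ` K)) = enn2real (cov_density P K)"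
proof (rule antisym)
  note K' = convex_disk_translation[OF K, of a]
  have "enn2real (cov_density P ((+) a ` K)) \<le> 1 * enn2real (cov_density P K)"
    by (rule cov_density_mono[OF K K' _ _ P])
      (simp_all only: cv_translation area_translation mult_1 order_refl)
  then show "enn2real (cov_density P ((+) a ` K)) \<le> enn2real (cov_density P K)" by simp
  have "enn2real (cov_density P K) \<le> 1 * enn2real (cov_density P ((+) a ` K))"
    by (rule cov_density_mono[OF K' K _ _ P])
      (simp_all only: cv_translation area_translation mult_1 order_refl)
  then show "enn2real (cov_density P K) \<le> enn2real (cov_density P ((+) a ` K))" by simp
qed

lemma interior_lin: "cross u v \<noteq> 0 \<Longrightarrow> interior (lin u v ` K) = lin u v ` interior K"
  by (rule interior_injective_linear_image[OF linear_lin inj_lin])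

lemma lin_unlin:
  assumes "cross u v \<noteq> 0"
  obtains a b where "cross a b \<noteq> 0" "\<And>S. lin u v ` lin a b ` S = S" "\<And>S. lin a b ` lin u v ` S = S"
proof -
  obtain a b where ab: "cross a b \<noteq> 0" "\<And>x. lin u v (lin a b x) = x" "\<And>x. lin a b (lin u v x) = x"
    using lin_inverse[OF assms] by metis
  show ?thesis by (rule that[of a b]) (use ab in \<open>auto simp: image_image\<close>)
qed

lemma pk_lin_imp:
  assumes "cross u v \<noteq> 0" "pk K V"
  shows "pk (lin u v ` K) (lin u v ` V)"
  unfolding pk_def interior_lin[OF assms(1)]
proof (intro ballI allI impI)
  fix p q x
  assume pq: "p \<in> lin u v ` V" "q \<in> lin u v ` V"
    and x: "x - p \<in> lin u v ` interior K" "x - q \<in> lin u v ` interior K"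
  obtain a b where ab: "p = lin u v a" "a \<in> V" "q = lin u v b" "b \<in> V" using pq by blast
  obtain y where y: "x = lin u v y" using lin_surj[OF assms(1)] by blast
  have "lin u v (y - a) \<in> lin u v ` interior K" "lin u v (y - b) \<in> lin u v ` interior K"
    using x by (simp_all add: ab y lin_simps)
  then have "y - a \<in> interior K" "y - b \<in> interior K"
    using inj_lin[OF assms(1)] by (simp_all add: inj_image_mem_iff)
  then show "p = q" using assms(2) ab unfolding pk_def by blast
qed

lemma cv_lin_imp:
  assumes "cross u v \<noteq> 0" "cv K V"
  shows "cv (lin u v ` K) (lin u v ` V)"
  unfolding cv_def
proof
  fix x
  obtain y where y: "x = lin u v y" using lin_surj[OF assms(1)] by blast
  obtain w where "w \<in> V" "y - w \<in> K" using assms(2) unfolding cv_def by blast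
  then show "\<exists>w\<in>lin u v ` V. x - w \<in> lin u v ` K"
    by (auto simp: y lin_simps(2)[symmetric])
qed

text \<open>The area of the body and the determinant of the lattice are both multiplied by
  \<open>\<bar>cross u v\<bar>\<close>. For general vector sets there is no such formula.\<close>

lemma lattice_lin:
  assumes "cross u v \<noteq> 0" "is_lattice L" "convex_disk K"
  shows "is_lattice (lin u v ` L)"
    and "density_of_packing (translates (lin u v ` K) (lin u v ` L)) = density_of_packing (translates K L)"
    and "density_of_covering (translates (lin u v ` K) (lin u v ` L)) = density_of_covering (translates K L)"
proof -
  obtain a b where ab: "cross a b \<noteq> 0" "L = lin a b ` int_points"
    using assms(2) is_lattice_iff by blast
  have im: "lin u v ` L = lin (lin u v a) (lin u v b) ` int_points"
    by (simp add: ab image_image lin_lin)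
  have ne: "cross (lin u v a) (lin u v b) \<noteq> 0" using assms ab by (simp add: cross_lin)
  show "is_lattice (lin u v ` L)" using im ne is_lattice_iff by blast
  have "area (lin u v ` K) / \<bar>cross (lin u v a) (lin u v b)\<bar> = area K / \<bar>cross a b\<bar>"
    using assms ab convex_disk_compact[OF assms(3)]
    by (simp add: cross_lin area_lin lmeasurable_compact abs_mult)
  then show "density_of_packing (translates (lin u v ` K) (lin u v ` L)) = density_of_packing (translates K L)"
    "density_of_covering (translates (lin u v ` K) (lin u v ` L)) = density_of_covering (translates K L)"
    using lattice_density[OF convex_disk_lin[OF assms(3,1)] ne] lattice_density[OF assms(3) ab(1)]
    by (simp_all only: im) (simp_all only: ab(2))
qed

lemma pack_density_lattice_lin:
  assumes "convex_disk K" "cross u v \<noteq> 0"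
  shows "pack_density is_lattice (lin u v ` K) = pack_density is_lattice K"
proof -
  have le: "pack_density is_lattice K \<le> pack_density is_lattice (lin u v ` K)"
    if "convex_disk K" "cross u v \<noteq> 0" for u v K
    unfolding pack_density_def
  proof (rule SUP_least)
    fix V assume "V \<in> {V. is_lattice V \<and> pk K V}"
    then show "density_of_packing (translates K V) \<le>
        (SUP V\<in>{V. is_lattice V \<and> pk (lin u v ` K) V}. density_of_packing (translates (lin u v ` K) V))"
      by (intro SUP_upper2[of "lin u v ` V"]) (auto simp: that lattice_lin(1)[OF that(2) _ that(1)] lattice_lin(2) pk_lin_imp)
  qed
  obtain a b where ab: "cross a b \<noteq> 0" "lin a b ` lin u v ` K = K" using lin_unlin[OF assms(2)] by metis
  show ?thesis
    using le[OF assms] le[OF convex_disk_lin[OF assms] ab(1)] ab(2) by simp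
qed

lemma cov_density_lattice_lin:
  assumes "convex_disk K" "cross u v \<noteq> 0"
  shows "cov_density is_lattice (lin u v ` K) = cov_density is_lattice K"
proof -
  have le: "cov_density is_lattice (lin u v ` K) \<le> cov_density is_lattice K"
    if "convex_disk K" "cross u v \<noteq> 0" for u v K
    unfolding cov_density_def
  proof (rule INF_greatest)
    fix V assume "V \<in> {V. is_lattice V \<and> cv K V}"
    then show "(INF V\<in>{V. is_lattice V \<and> cv (lin u v ` K) V}.
        density_of_covering (translates (lin u v ` K) V)) \<le> density_of_covering (translates K V)"
      by (intro INF_lower2[of "lin u v ` V"]) (auto simp: that lattice_lin(1)[OF that(2) _ that(1)] lattice_lin(3) cv_lin_imp)
  qed
  obtain a b where ab: "cross a b \<noteq> 0" "lin a b ` lin u v ` K = K" using lin_unlin[OF assms(2)] by metis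
  show ?thesis
    using le[OF assms] le[OF convex_disk_lin[OF assms] ab(1)] ab(2) by simp
qed

section \<open>Periodic arrangements and affine invariance of the translative densities\<close>

definition periodic :: "(real^2) set \<Rightarrow> real \<Rightarrow> (real^2) set" where
  "periodic S t = {x + t *\<^sub>R z | x z. x \<in> S \<and> z \<in> int_points}"

abbreviation scaled_cell :: "real \<Rightarrow> real^2 \<Rightarrow> (real^2) set" where
  "scaled_cell s \<equiv> cell (s *\<^sub>R axis 1 1) (s *\<^sub>R axis 2 1)"

lemma lin_scaled_axes: "lin (s *\<^sub>R axis 1 1) (s *\<^sub>R axis 2 1) x = s *\<^sub>R x"
  by (simp add: lin_def vec2_eq_iff axis_def)

lemma cross_scaled_axes: "cross (s *\<^sub>R axis 1 1) (s *\<^sub>R axis 2 1) = s\<^sup>2"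
  by (simp add: cross_def axis_def power2_eq_square)

lemma mem_scaled_cell_iff:
  assumes "s > 0" "z \<in> int_points"
  shows "x \<in> scaled_cell s z \<longleftrightarrow> z = vfloor ((1 / s) *\<^sub>R x)"
  using lin_in_cell_iff[of "s *\<^sub>R axis 1 1" "s *\<^sub>R axis 2 1" z "(1 / s) *\<^sub>R x"] assms
  by (simp add: lin_scaled_axes cross_scaled_axes)

lemma mem_scaled_cell_bounds:
  assumes "s > 0"
  shows "x \<in> scaled_cell s z \<longleftrightarrow> (\<forall>i. s * z $ i \<le> x $ i \<and> x $ i < s * (z $ i + 1))"
proof -
  have "x \<in> scaled_cell s z \<longleftrightarrow> (\<exists>p\<in>unit_cell. x = s *\<^sub>R (z + p))"
    by (auto simp: cell_def lin_scaled_axes)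
  also have "\<dots> \<longleftrightarrow> (1 / s) *\<^sub>R x - z \<in> unit_cell"
  proof
    assume "\<exists>p\<in>unit_cell. x = s *\<^sub>R (z + p)"
    then show "(1 / s) *\<^sub>R x - z \<in> unit_cell" using assms by auto
  next
    assume "(1 / s) *\<^sub>R x - z \<in> unit_cell"
    then show "\<exists>p\<in>unit_cell. x = s *\<^sub>R (z + p)"
      using assms by (intro bexI[of _ "(1 / s) *\<^sub>R x - z"]) auto
  qed
  also have "\<dots> \<longleftrightarrow> (\<forall>i. s * z $ i \<le> x $ i \<and> x $ i < s * (z $ i + 1))"
    using assms by (auto simp: unit_cell_def forall_2 field_simps)
  finally show ?thesis .
qed

lemma int_points_small:
  assumes "z \<in> int_points" "\<And>i. \<bar>z $ i\<bar> < 1"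
  shows "z = 0"
proof -
  have "z $ i = 0" for i
  proof -
    have "z $ i \<in> \<int>" using assms(1) exhaust_2[of i] by (auto simp: int_points_def)
    then show ?thesis using assms(2)[of i] Ints_nonzero_abs_less1 by blast
  qed
  then show ?thesis by (simp add: vec_eq_iff)
qed

lemma scaled_cell_diff:
  assumes "s > 0" "x \<in> scaled_cell s z" "y \<in> scaled_cell s z"
  shows "\<bar>(x - y) $ i\<bar> < s"
  using assms(2,3) unfolding mem_scaled_cell_bounds[OF assms(1)]
  by (auto simp: abs_if algebra_simps dest!: spec[of _ i]) 

lemma periodic_cell_shift:
  assumes "t > 0" "z \<in> int_points"
  shows "x + t *\<^sub>R (z - vfloor ((1 / t) *\<^sub>R x)) \<in> scaled_cell t z"
proof -
  define q where "q = (1 / t) *\<^sub>R x - vfloor ((1 / t) *\<^sub>R x)"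
  have "q \<in> unit_cell" unfolding q_def by (rule vfloor_in_cell)
  moreover have "x + t *\<^sub>R (z - vfloor ((1 / t) *\<^sub>R x)) = t *\<^sub>R (z + q)"
    using assms by (simp add: q_def algebra_simps)
  ultimately show ?thesis by (auto simp: cell_def lin_scaled_axes)
qed

text \<open>Two points of a cell of side \<open>s \<le> t\<close> differ by less than
  \<open>t\<close> in each coordinate, so distinct ones are incongruent modulo the period and remain
  distinct when moved into the cell \<open>z\<close>.\<close>

lemma card_periodic_ge:
  assumes "0 < s" "s \<le> t" "S \<subseteq> scaled_cell s z0" "z \<in> int_points" "finite (periodic S t \<inter> scaled_cell t z)"
  shows "card S \<le> card (periodic S t \<inter> scaled_cell t z)"
proof (rule card_inj_on_le[OF _ _ assms(5)])
  let ?f = "\<lambda>x. x + t *\<^sub>R (z - vfloor ((1 / t) *\<^sub>R x))"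
  show "?f ` S \<subseteq> periodic S t \<inter> scaled_cell t z"
  proof safe
    fix x assume "x \<in> S"
    then show "?f x \<in> periodic S t"
      unfolding periodic_def using int_points_simps assms(4) by blast
    show "?f x \<in> scaled_cell t z" using periodic_cell_shift assms by auto
  qed
  show "inj_on ?f S"
  proof (rule inj_onI)
    fix x y assume xy: "x \<in> S" "y \<in> S" "?f x = ?f y"
    define w where "w = vfloor ((1 / t) *\<^sub>R x) - vfloor ((1 / t) *\<^sub>R y)"
    have d: "x - y = t *\<^sub>R w" using xy(3) by (simp add: w_def algebra_simps)
    have "\<bar>w $ i\<bar> < 1" for i
    proof -
      have "\<bar>(x - y) $ i\<bar> < s" using scaled_cell_diff[OF assms(1)] xy assms(3) by blast
      moreover have "\<bar>(x - y) $ i\<bar> = t * \<bar>w $ i\<bar>" using d assms(1,2) by (simp add: abs_mult)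
      ultimately have "t * \<bar>w $ i\<bar> < t * 1" using assms(2) by linarith
      moreover have "t > 0" using assms(1,2) by linarith
      ultimately show ?thesis by (simp only: mult_less_cancel_left_pos)
    qed
    moreover have "w \<in> int_points" by (simp add: w_def int_points_simps)
    ultimately have "w = 0" using int_points_small by blast
    then show "x = y" using d by simp
  qed
qed

text \<open>A residue class modulo the period has exactly one point in the cell.\<close>

lemma card_periodic_le:
  assumes "0 < t" "finite S" "z \<in> int_points"
  shows "finite (periodic S t \<inter> scaled_cell t z) \<and> card (periodic S t \<inter> scaled_cell t z) \<le> card S"
proof -
  let ?f = "\<lambda>x. x + t *\<^sub>R (z - vfloor ((1 / t) *\<^sub>R x))"
  have sub: "periodic S t \<inter> scaled_cell t z \<subseteq> ?f ` S"
  proof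
    fix y assume y: "y \<in> periodic S t \<inter> scaled_cell t z"
    then obtain x w where x: "x \<in> S" "w \<in> int_points" "y = x + t *\<^sub>R w"
      by (auto simp: periodic_def)
    have "z = vfloor ((1 / t) *\<^sub>R y)" using y mem_scaled_cell_iff[OF assms(1,3)] by simp
    also have "(1 / t) *\<^sub>R y = (1 / t) *\<^sub>R x + w" using x assms by (simp add: algebra_simps)
    also have "vfloor ((1 / t) *\<^sub>R x + w) = vfloor ((1 / t) *\<^sub>R x) + w"
      using x(2) by (auto simp: vfloor_def int_points_def vec2_eq_iff elim!: Ints_cases)
    finally have "y = ?f x" using x(3) by simp
    then show "y \<in> ?f ` S" using x(1) by blast
  qed
  then show ?thesis
    using finite_subset[OF sub] assms(2) surj_card_le[OF assms(2) sub] by auto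
qed

text \<open>The period exceeds the side of the cell by \<open>2 * R\<close>, which leaves room for
  the bodies that stick out: bodies from different copies of the cell cannot overlap.\<close>

lemma pk_periodic:
  assumes "pk K S" "K \<subseteq> cball 0 R" "s > 0" "R \<ge> 0" "S \<subseteq> scaled_cell s z0"
  shows "pk K (periodic S (s + 2 * R))"
  unfolding pk_def
proof (intro ballI allI impI)
  let ?t = "s + 2 * R"
  fix p q x assume "p \<in> periodic S ?t" "q \<in> periodic S ?t"
  then obtain a z b w where ab: "a \<in> S" "b \<in> S" "z \<in> int_points" "w \<in> int_points"
    "p = a + ?t *\<^sub>R z" "q = b + ?t *\<^sub>R w" by (auto simp: periodic_def)
  assume x: "x - p \<in> interior K" "x - q \<in> interior K"
  then have n: "norm (x - p) \<le> R" "norm (x - q) \<le> R" using assms(2) interior_subset[of K] by auto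
  have "\<bar>(z - w) $ i\<bar> < 1" for i
  proof -
    have "\<bar>(a - b) $ i\<bar> < s" using scaled_cell_diff[OF assms(3)] ab assms(5) by blast
    moreover have "\<bar>(x - p) $ i\<bar> \<le> R" "\<bar>(x - q) $ i\<bar> \<le> R"
      using n component_le_norm_cart order_trans by blast+
    moreover have "?t * (z - w) $ i = (x - q) $ i - (x - p) $ i - (a - b) $ i"
      by (simp add: ab algebra_simps)
    ultimately have "\<bar>?t * (z - w) $ i\<bar> < ?t" by linarith
    moreover have "?t > 0" using assms by linarith
    moreover have "\<bar>?t * (z - w) $ i\<bar> = ?t * \<bar>(z - w) $ i\<bar>"
      using \<open>?t > 0\<close> by (simp only: abs_mult abs_of_pos)
    ultimately have "?t * \<bar>(z - w) $ i\<bar> < ?t * 1" by (simp only: mult_1_right)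
    then show ?thesis using \<open>?t > 0\<close> by (simp only: mult_less_cancel_left_pos)
  qed
  then have "z - w = 0" using ab int_points_simps int_points_small by blast
  then have zw: "z = w" by simp
  have "(x - ?t *\<^sub>R z) - a \<in> interior K" "(x - ?t *\<^sub>R z) - b \<in> interior K"
    using x by (simp_all add: ab zw algebra_simps)
  then have "a = b" using assms(1) ab unfolding pk_def by blast
  then show "p = q" by (simp add: ab zw)
qed

text \<open>A cell of side \<open>s + 2 * R\<close> contains a centered square of side
  \<open>s\<close>, and a point of this square can only be covered by vectors of the cell. Hence
  these vectors cover the square, and repeating them with period \<open>s\<close> covers the
  plane.\<close>

lemma cv_periodic:
  assumes "cv K V" "K \<subseteq> cball 0 R" "s > 0" "R \<ge> 0" "z0 \<in> int_points"
  shows "cv K (periodic (V \<inter> scaled_cell (s + 2 * R) z0) s)"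
  unfolding cv_def
proof
  fix x
  let ?t = "s + 2 * R"
  \<comment> \<open>The lower left corner of the inner square; subtracting
    \<open>s *\<^sub>R z\<close> moves \<open>x\<close> into that square.\<close>
  define c :: "real^2" where "c = ?t *\<^sub>R z0 + (\<chi> i. R)"
  define z where "z = vfloor ((1 / s) *\<^sub>R (x - c))"
  define q where "q = (1 / s) *\<^sub>R (x - c) - z"
  have z: "z \<in> int_points" "q \<in> unit_cell" by (simp_all add: z_def q_def int_points_simps vfloor_in_cell)
  have x: "x = s *\<^sub>R z + c + s *\<^sub>R q" using assms(3) by (simp add: q_def algebra_simps)
  obtain v where v: "v \<in> V" "x - s *\<^sub>R z - v \<in> K" using assms(1) unfolding cv_def by blast
  have "?t * z0 $ i \<le> v $ i \<and> v $ i < ?t * (z0 $ i + 1)" for i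
  proof -
    have "norm (x - s *\<^sub>R z - v) \<le> R" using v(2) assms(2) by auto
    then have "\<bar>(x - s *\<^sub>R z - v) $ i\<bar> \<le> R" using component_le_norm_cart order_trans by blast
    moreover have "(x - s *\<^sub>R z - v) $ i = ?t * z0 $ i + R + s * q $ i - v $ i"
      by (simp add: x c_def algebra_simps)
    moreover have "0 \<le> q $ i \<and> q $ i < 1" using z(2) exhaust_2[of i] by (auto simp: unit_cell_def)
    then have "0 \<le> s * q $ i" "s * q $ i < s * 1"
      using assms(3) by (auto simp del: mult_1_right)
    ultimately show ?thesis by (simp add: algebra_simps abs_le_iff)
  qed
  then have "v \<in> scaled_cell ?t z0" using assms by (simp add: mem_scaled_cell_bounds)
  then have "v + s *\<^sub>R z \<in> periodic (V \<inter> scaled_cell ?t z0) s"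
    using v z unfolding periodic_def by blast
  moreover have "x - (v + s *\<^sub>R z) \<in> K" using v(2) by (simp add: algebra_simps)
  ultimately show "\<exists>v\<in>periodic (V \<inter> scaled_cell ?t z0) s. x - v \<in> K" by blast
qed

lemma large_scale:
  assumes "R \<ge> 0" "\<eta> > 0"
  obtains s :: real where "s > 0" "(s + 2 * R)\<^sup>2 \<le> (1 + \<eta>) * s\<^sup>2"
proof -
  obtain s where s: "s > 0" "disk_area (s + 2 * R) \<le> (1 + \<eta>) * disk_area s"
    using disk_area_ratio[of "2 * R" \<eta>] assms by (auto dest: eventually_happens'[rotated])
  then have "pi * (s + 2 * R)\<^sup>2 \<le> pi * ((1 + \<eta>) * s\<^sup>2)"
    using assms by (simp add: disk_area algebra_simps)
  then show ?thesis using that s(1) by (simp only: mult_le_cancel_left_pos[OF pi_gt_zero])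
qed

lemma lin_cell: "lin a b ` cell u v z = cell (lin a b u) (lin a b v) z"
  by (simp add: cell_def image_image lin_lin)

lemma preimage_lin_Int_cell:
  assumes ab: "\<And>x. lin u v (lin a b x) = x" "\<And>x. lin a b (lin u v x) = x" "s > 0"
  shows "lin a b ` (V \<inter> cell (s *\<^sub>R u) (s *\<^sub>R v) z) = (lin a b ` V) \<inter> scaled_cell s z"
    and "card (V \<inter> cell (s *\<^sub>R u) (s *\<^sub>R v) z) = card ((lin a b ` V) \<inter> scaled_cell s z)"
    and "finite (V \<inter> cell (s *\<^sub>R u) (s *\<^sub>R v) z) \<longleftrightarrow> finite ((lin a b ` V) \<inter> scaled_cell s z)"
proof -
  have inj: "inj (lin a b)" using ab(1) by (metis injI)
  have uv: "lin a b u = axis 1 1" "lin a b v = axis 2 1"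
    using ab(2)[of "axis 1 1"] ab(2)[of "axis 2 1"] by (auto simp: lin_def axis_def)
  have "lin a b ` cell (s *\<^sub>R u) (s *\<^sub>R v) z = scaled_cell s z"
    unfolding lin_cell lin_simps uv ..
  then show *: "lin a b ` (V \<inter> cell (s *\<^sub>R u) (s *\<^sub>R v) z) = (lin a b ` V) \<inter> scaled_cell s z"
    by (simp add: image_Int[OF inj])
  show "card (V \<inter> cell (s *\<^sub>R u) (s *\<^sub>R v) z) = card ((lin a b ` V) \<inter> scaled_cell s z)"
    "finite (V \<inter> cell (s *\<^sub>R u) (s *\<^sub>R v) z) \<longleftrightarrow> finite ((lin a b ` V) \<inter> scaled_cell s z)"
    using card_image[of "lin a b"] finite_image_iff[of "lin a b"] inj inj_on_subset
    by (metis * subset_UNIV)+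
qed

text \<open>The density of a single packing may change under \<open>lin u v\<close>, since round
  disks become ellipses. Therefore the points of \<open>V\<close> in each image of a square cell are
  pulled back and repeated periodically; the resulting packing by \<open>K\<close> has density at
  most the supremum \<open>\<beta>\<close>, which bounds the number of points in every cell. Bounds
  for all cells yield a bound for the density in round disks.\<close>

lemma pack_density_lin:
  assumes K: "convex_disk K" and uv: "cross u v \<noteq> 0"
  shows "pack_density (\<lambda>_. True) (lin u v ` K) = pack_density (\<lambda>_. True) K"
proof -
  have le: "pack_density (\<lambda>_. True) (lin u v ` K) \<le> pack_density (\<lambda>_. True) K"
    if K: "convex_disk K" and uv: "cross u v \<noteq> 0" for u v K
    unfolding pack_density_def[of _ "lin u v ` K"]
  proof (rule SUP_least)
    fix V assume "V \<in> {V. True \<and> pk (lin u v ` K) V}"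
    then have V: "pk (lin u v ` K) V" by simp
    obtain R where R: "R > 0" "K \<subseteq> cball 0 R" using convex_disk_bounded[OF K] .
    have pos: "area K > 0" using K convex_disk_area_pos by auto
    obtain a b where ab: "cross a b \<noteq> 0" "\<And>x. lin u v (lin a b x) = x" "\<And>x. lin a b (lin u v x) = x"
      using lin_inverse[OF uv] by metis
    have W: "pk K (lin a b ` V)" using pk_lin_imp[OF ab(1) V] ab by (simp add: image_image)
    define \<beta> where "\<beta> = enn2real (pack_density (\<lambda>_. True) K)"
    have \<beta>: "ennreal \<beta> = pack_density (\<lambda>_. True) K" "\<beta> \<ge> 0"
      using pack_density_le_1[OF K, of "\<lambda>_. True"]
      by (auto simp: \<beta>_def ennreal_enn2real_if top_unique)
    show "density_of_packing (translates (lin u v ` K) V) \<le> pack_density (\<lambda>_. True) K"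
    proof (rule ennreal_le_mult_eps)
      fix \<eta> :: real assume "\<eta> > 0"
      then obtain s where s: "s > 0" "(s + 2 * R)\<^sup>2 \<le> (1 + \<eta>) * s\<^sup>2"
        using large_scale[of R \<eta>] R by auto
      define t where "t = s + 2 * R"
      have t: "t > 0" "s \<le> t" using s R by (auto simp: t_def)
      \<comment> \<open>The number of points per square of side \<open>t\<close> at which a periodic
        packing by \<open>K\<close> has density \<open>\<beta>\<close>.\<close>
      define m where "m = \<beta> * t\<^sup>2 / area K"
      have m: "finite (V \<inter> cell (s *\<^sub>R u) (s *\<^sub>R v) z) \<and> card (V \<inter> cell (s *\<^sub>R u) (s *\<^sub>R v) z) \<le> m"
        if z: "z \<in> int_points" for z
      proof -
        define S where "S = lin a b ` V \<inter> scaled_cell s z"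
        have S: "pk K S" "S \<subseteq> scaled_cell s z" using W by (auto simp: S_def pk_def)
        have "S \<subseteq> cball 0 (norm (s *\<^sub>R z) + 2 * s)"
        proof
          fix x assume "x \<in> S"
          then obtain p where p: "p \<in> unit_cell" "x = s *\<^sub>R z + s *\<^sub>R p"
            using S(2) by (auto simp: cell_def lin_scaled_axes algebra_simps)
          have "norm p \<le> \<bar>p $ 1\<bar> + \<bar>p $ 2\<bar>" using norm_le_l1_cart[of p] by (simp add: sum_2)
          also have "\<dots> \<le> 2" using p(1) by (auto simp: unit_cell_def)
          finally have "norm (s *\<^sub>R p) \<le> 2 * s" using s by simp
          then show "x \<in> cball 0 (norm (s *\<^sub>R z) + 2 * s)"
            unfolding p(2) using norm_triangle_ineq[of "s *\<^sub>R z" "s *\<^sub>R p"] by simp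
        qed
        then have fin: "finite S" using pk_count[OF K R(2) S(1), of "norm (s *\<^sub>R z) + 2 * s"]
          by (simp add: Int_absorb2)
        have "pk K (periodic S t)" unfolding t_def by (rule pk_periodic[OF S(1) R(2) s(1) _ S(2)]) (use R in simp)
        have "ennreal (area K * card S / \<bar>cross (t *\<^sub>R axis 1 1) (t *\<^sub>R axis 2 1)\<bar>) \<le>
            density_of_packing (translates K (periodic S t))"
          using card_periodic_ge[OF s(1) t(2) S(2)] t
          by (intro density_ge_of_cells(2)[OF K]) (auto simp: cross_scaled_axes)
        also have "\<dots> \<le> ennreal \<beta>"
          unfolding \<beta>(1) pack_density_def using \<open>pk K (periodic S t)\<close> by (intro SUP_upper) auto
        finally have "area K * card S / t\<^sup>2 \<le> \<beta>"
          using \<beta>(2) by (simp add: cross_scaled_axes)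
        then have "card S \<le> m" using pos t by (simp add: m_def field_simps)
        then show ?thesis
          using fin preimage_lin_Int_cell[OF ab(2,3) s(1), of V z] by (simp add: S_def)
      qed
      have "cross (s *\<^sub>R u) (s *\<^sub>R v) \<noteq> 0" using uv s by (simp add: cross_simps)
      from density_le_of_cells(1)[OF convex_disk_lin[OF K uv] this m]
      have "density_of_packing (translates (lin u v ` K) V) \<le>
          ennreal (area (lin u v ` K) * m / \<bar>cross (s *\<^sub>R u) (s *\<^sub>R v)\<bar>)" .
      also have "area (lin u v ` K) * m / \<bar>cross (s *\<^sub>R u) (s *\<^sub>R v)\<bar> = \<beta> * (t\<^sup>2 / s\<^sup>2)"
        using pos uv s convex_disk_compact[OF K]
        by (simp add: area_lin lmeasurable_compact m_def cross_simps abs_mult power2_eq_square)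
      also have "ennreal (\<beta> * (t\<^sup>2 / s\<^sup>2)) \<le> ennreal (\<beta> * (1 + \<eta>))"
        using s \<beta>(2) by (intro ennreal_leI mult_left_mono) (auto simp: t_def field_simps)
      also have "\<dots> = ennreal (1 + \<eta>) * pack_density (\<lambda>_. True) K"
        using \<beta> \<open>\<eta> > 0\<close> by (simp only: \<beta>(1)[symmetric] ennreal_mult'[symmetric]) (simp add: mult.commute ennreal_mult')
      finally show "density_of_packing (translates (lin u v ` K) V) \<le>
          ennreal (1 + \<eta>) * pack_density (\<lambda>_. True) K" .
    qed
  qed
  obtain a b where ab: "cross a b \<noteq> 0" "lin a b ` lin u v ` K = K" using lin_unlin[OF uv] by metis
  show ?thesis
    using le[OF K uv] le[OF convex_disk_lin[OF K uv] ab(1)] ab(2) by simp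
qed

text \<open>Dual to the packing case, with the two scales exchanged: vectors are taken from cells of
  side \<open>t\<close> and repeated with the smaller period \<open>s\<close>, which yields a lower
  bound for the number of vectors in every cell.\<close>

lemma cov_density_lin:
  assumes K: "convex_disk K" and uv: "cross u v \<noteq> 0"
  shows "cov_density (\<lambda>_. True) (lin u v ` K) = cov_density (\<lambda>_. True) K"
proof -
  have le: "cov_density (\<lambda>_. True) K \<le> cov_density (\<lambda>_. True) (lin u v ` K)"
    if K: "convex_disk K" and uv: "cross u v \<noteq> 0" for u v K
    unfolding cov_density_def[of _ "lin u v ` K"]
  proof (rule INF_greatest)
    fix V assume "V \<in> {V. True \<and> cv (lin u v ` K) V}"
    then have V: "cv (lin u v ` K) V" by simp
    obtain R where R: "R > 0" "K \<subseteq> cball 0 R" using convex_disk_bounded[OF K] .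
    have pos: "area K > 0" using K convex_disk_area_pos by auto
    obtain a b where ab: "cross a b \<noteq> 0" "\<And>x. lin u v (lin a b x) = x" "\<And>x. lin a b (lin u v x) = x"
      using lin_inverse[OF uv] by metis
    have W: "cv K (lin a b ` V)" using cv_lin_imp[OF ab(1) V] ab by (simp add: image_image)
    define \<beta> where "\<beta> = enn2real (cov_density (\<lambda>_. True) K)"
    have \<beta>: "ennreal \<beta> = cov_density (\<lambda>_. True) K" "\<beta> \<ge> 0"
      using cov_density_finite[OF K, of "\<lambda>_. True"]
      by (auto simp: \<beta>_def ennreal_enn2real_if top_unique)
    show "cov_density (\<lambda>_. True) K \<le> density_of_covering (translates (lin u v ` K) V)"
    proof (rule ennreal_le_mult_eps)
      fix \<eta> :: real assume "\<eta> > 0"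
      then obtain s where s: "s > 0" "(s + 2 * R)\<^sup>2 \<le> (1 + \<eta>) * s\<^sup>2"
        using large_scale[of R \<eta>] R by auto
      define t where "t = s + 2 * R"
      have t: "t > 0" "s \<le> t" using s R by (auto simp: t_def)
      define m where "m = \<beta> * s\<^sup>2 / area K"
      have m: "m \<le> card (V \<inter> cell (t *\<^sub>R u) (t *\<^sub>R v) z)"
        if z: "z \<in> int_points" and fin: "finite (V \<inter> cell (t *\<^sub>R u) (t *\<^sub>R v) z)" for z
      proof -
        define S where "S = lin a b ` V \<inter> scaled_cell t z"
        note pre = preimage_lin_Int_cell[OF ab(2,3) t(1), of V z]
        have finS: "finite S" using fin pre by (simp add: S_def)
        have "cv K (periodic S s)"
          unfolding S_def t_def by (rule cv_periodic[OF W R(2) s(1) _ z]) (use R in simp)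
        then have "ennreal \<beta> \<le> density_of_covering (translates K (periodic S s))"
          unfolding \<beta>(1) cov_density_def by (intro INF_lower) auto
        also have "\<dots> \<le> ennreal (area K * card S / \<bar>cross (s *\<^sub>R axis 1 1) (s *\<^sub>R axis 2 1)\<bar>)"
          using card_periodic_le[OF s(1) finS] s
          by (intro density_le_of_cells(2)[OF K]) (auto simp: cross_scaled_axes)
        finally have "\<beta> \<le> area K * card S / s\<^sup>2"
          using pos by (simp add: cross_scaled_axes)
        then have "m \<le> card S" using pos s by (simp add: m_def field_simps)
        then show ?thesis using pre by (simp add: S_def)
      qed
      have c: "cross (t *\<^sub>R u) (t *\<^sub>R v) \<noteq> 0" using uv t by (simp add: cross_simps)
      have m0: "m \<ge> 0" using \<beta>(2) pos by (simp add: m_def)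
      have "t\<^sup>2 / s\<^sup>2 \<le> 1 + \<eta>" using s by (simp add: t_def field_simps)
      then have "\<beta> * 1 \<le> \<beta> * ((1 + \<eta>) * (s\<^sup>2 / t\<^sup>2))"
        using s t \<beta>(2) by (intro mult_left_mono) (auto simp: field_simps)
      then have "ennreal \<beta> \<le> ennreal ((1 + \<eta>) * (\<beta> * (s\<^sup>2 / t\<^sup>2)))"
        by (intro ennreal_leI) (simp add: mult_ac)
      also have "\<dots> = ennreal (1 + \<eta>) * ennreal (\<beta> * (s\<^sup>2 / t\<^sup>2))"
        using \<open>\<eta> > 0\<close> \<beta>(2) by (intro ennreal_mult) auto
      also have "\<beta> * (s\<^sup>2 / t\<^sup>2) = area (lin u v ` K) * m / \<bar>cross (t *\<^sub>R u) (t *\<^sub>R v)\<bar>"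
        using pos uv t convex_disk_compact[OF K]
        by (simp add: area_lin lmeasurable_compact m_def cross_simps abs_mult power2_eq_square)
      also have "ennreal (1 + \<eta>) * ennreal (area (lin u v ` K) * m / \<bar>cross (t *\<^sub>R u) (t *\<^sub>R v)\<bar>) \<le>
          ennreal (1 + \<eta>) * density_of_covering (translates (lin u v ` K) V)"
        by (intro mult_left_mono density_ge_of_cells(1)[OF convex_disk_lin[OF K uv] c m0 m]) auto
      finally show "cov_density (\<lambda>_. True) K \<le>
          ennreal (1 + \<eta>) * density_of_covering (translates (lin u v ` K) V)"
        by (simp only: \<beta>(1))
    qed
  qed
  obtain a b where ab: "cross a b \<noteq> 0" "lin a b ` lin u v ` K = K" using lin_unlin[OF uv] by metis
  show ?thesis
    using le[OF K uv] le[OF convex_disk_lin[OF K uv] ab(1)] ab(2) by simp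
qed

section \<open>Continuity and compactness\<close>

text \<open>What compactness uses of the four densities. One monotonicity clause fits both kinds:
  enlarging the body preserves coverings and shrinking it preserves packings, and either way
  \<open>F K'\<close> is bounded by \<open>F K\<close> times the ratio of the areas.\<close>

definition affine_density :: "((real^2) set \<Rightarrow> real) \<Rightarrow> bool" where
  "affine_density F \<longleftrightarrow>
     (\<forall>K. F K \<ge> 0) \<and>
     (\<forall>K K' q. convex_disk K \<longrightarrow> convex_disk K' \<longrightarrow> K \<subseteq> K' \<longrightarrow> area K' \<le> q * area K \<longrightarrow> F K' \<le> q * F K) \<and>
     (\<forall>K u v. convex_disk K \<longrightarrow> cross u v \<noteq> 0 \<longrightarrow> F (lin u v ` K) = F K) \<and>
     (\<forall>K a. convex_disk K \<longrightarrow> F ((+) a ` K) = F K)"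

lemma affine_density_densities:
  "affine_density delta_T" "affine_density delta_L" "affine_density theta_T" "affine_density theta_L"
proof -
  show "affine_density delta_T"
    unfolding affine_density_def
    by (simp add: densities_eq convex_disk_lin convex_disk_translation pack_density_lin
        pack_density_translation pack_density_mono pk_mono) (simp add: delta_T_def)
  show "affine_density delta_L"
    unfolding affine_density_def
    by (simp add: densities_eq convex_disk_lin convex_disk_translation pack_density_lattice_lin
        pack_density_translation pack_density_mono pk_mono) (simp add: delta_L_def)
  show "affine_density theta_T"
    unfolding affine_density_def
    by (simp add: densities_eq convex_disk_lin convex_disk_translation cov_density_lin
        cov_density_translation cov_density_mono cv_mono) (simp add: theta_T_def)
  show "affine_density theta_L"
    unfolding affine_density_def
    by (simp add: densities_eq convex_disk_lin convex_disk_translation cov_density_lattice_lin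
        cov_density_translation cov_density_mono cv_mono) (simp add: theta_L_def)
qed

lemma convex_disk_scaleR:
  assumes "convex_disk K" "a > 0"
  shows "convex_disk ((*\<^sub>R) a ` K)"
proof -
  have "lin (a *\<^sub>R axis 1 1) (a *\<^sub>R axis 2 1) ` K = (*\<^sub>R) a ` K"
    by (simp add: lin_scaled_axes)
  then show ?thesis
    using convex_disk_lin[OF assms(1), of "a *\<^sub>R axis 1 1" "a *\<^sub>R axis 2 1"] assms(2)
    by (simp add: cross_scaled_axes)
qed

lemma affine_density_scaleR:
  assumes "affine_density F" "convex_disk K" "a > 0"
  shows "F ((*\<^sub>R) a ` K) = F K"
proof -
  have "lin (a *\<^sub>R axis 1 1) (a *\<^sub>R axis 2 1) ` K = (*\<^sub>R) a ` K"
    by (simp add: lin_scaled_axes)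
  moreover have "cross (a *\<^sub>R axis 1 1) (a *\<^sub>R axis 2 1) \<noteq> 0"
    using assms by (simp add: cross_scaled_axes)
  ultimately show ?thesis using assms(1,2) unfolding affine_density_def by metis
qed

text \<open>Two factors \<open>c\<^sup>2\<close>: one for dilating \<open>K\<close> so that it
  contains \<open>K'\<close>, the other because \<open>area K \<le> c\<^sup>2 * area K'\<close>. The
  dilate itself has the same density as \<open>K\<close>.\<close>

lemma affine_density_sandwich:
  assumes F: "affine_density F" and K: "convex_disk K" "convex_disk K'" and c: "c > 0"
    and sub: "K' \<subseteq> (*\<^sub>R) c ` K" "K \<subseteq> (*\<^sub>R) c ` K'"
  shows "F K \<le> c ^ 4 * F K'"
proof -
  have cK: "convex_disk ((*\<^sub>R) c ` K)" using convex_disk_scaleR K c by blast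
  have "area K \<le> area ((*\<^sub>R) c ` K')"
    using sub K c convex_disk_scaleR[OF K(2) c]
    by (intro measure_mono_fmeasurable) (auto simp: convex_disk_def lmeasurable_compact fmeasurableD)
  then have "area K \<le> c\<^sup>2 * area K'"
    using K by (simp add: area_scaleR convex_disk_def)
  then have "c\<^sup>2 * area K \<le> c\<^sup>2 * (c\<^sup>2 * area K')" by (rule mult_left_mono) simp
  then have "area ((*\<^sub>R) c ` K) \<le> c ^ 4 * area K'"
    using K by (simp add: area_scaleR convex_disk_def power4_eq_xxxx power2_eq_square mult.assoc)
  then have "F ((*\<^sub>R) c ` K) \<le> c ^ 4 * F K'"
    using F K(2) cK sub(1) unfolding affine_density_def by blast
  then show ?thesis using affine_density_scaleR[OF F K(1) c] by simp
qed

lemma affine_density_tendsto: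
  assumes F: "affine_density F" and K: "convex_disk K" "\<And>n::nat. convex_disk (X n)"
    and lim: "\<And>e. e > 0 \<Longrightarrow> \<exists>N. \<forall>n\<ge>N. X n \<subseteq> (*\<^sub>R) (1 + e) ` K \<and> K \<subseteq> (*\<^sub>R) (1 + e) ` X n"
  shows "(\<lambda>n. F (X n)) \<longlonglongrightarrow> F K"
proof (rule LIMSEQ_I)
  fix r :: real assume r: "r > 0"
  have F0: "F K \<ge> 0" using F by (simp add: affine_density_def)
  have "(\<lambda>e. (1 + e) ^ 4) \<midarrow>0\<rightarrow> (1 + 0 :: real) ^ 4" by (intro tendsto_intros)
  \<comment> \<open>The denominator exceeds \<open>F K\<close>, and also \<open>F (X n)\<close> once
    \<open>F (X n) < F K + r\<close> is known, so it serves both halves of the estimate.\<close>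
  then have "\<forall>\<^sub>F e in at 0. dist ((1 + e) ^ 4 :: real) 1 < r / (F K + r + 1)"
    using r F0 by (intro tendstoD) auto
  then obtain d where d: "d > 0" "\<And>e. e \<noteq> 0 \<Longrightarrow> dist e 0 < d \<Longrightarrow> dist ((1 + e) ^ 4 :: real) 1 < r / (F K + r + 1)"
    unfolding eventually_at by blast
  define e where "e = d / 2"
  define c where "c = (1 + e) ^ 4"
  have e: "e > 0" "c > 1" using d(1) by (auto simp: e_def c_def intro!: one_less_power)
  have c: "c - 1 < r / (F K + r + 1)" using d(2)[of e] d(1) e by (simp add: c_def dist_real_def e_def)
  obtain N where N: "\<forall>n\<ge>N. X n \<subseteq> (*\<^sub>R) (1 + e) ` K \<and> K \<subseteq> (*\<^sub>R) (1 + e) ` X n" using lim e by blast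
  have "\<bar>F (X n) - F K\<bar> < r" if n: "n \<ge> N" for n
  proof -
    have 1: "F K \<le> c * F (X n)" "F (X n) \<le> c * F K"
      using N n e affine_density_sandwich[OF F K(1) K(2)[of n], of "1 + e"]
        affine_density_sandwich[OF F K(2)[of n] K(1), of "1 + e"] by (auto simp: c_def)
    have b: "(c - 1) * (F K + r + 1) < r" using c F0 r by (simp add: field_simps)
    have "F (X n) - F K \<le> (c - 1) * F K" using 1 by (simp add: algebra_simps)
    also have "\<dots> \<le> (c - 1) * (F K + r + 1)" using e r by (intro mult_left_mono) auto
    finally have u: "F (X n) - F K < r" using b by linarith
    have "F K - F (X n) \<le> (c - 1) * F (X n)" using 1 by (simp add: algebra_simps)
    also have "\<dots> \<le> (c - 1) * (F K + r + 1)" using e r u by (intro mult_left_mono) auto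
    finally show ?thesis using b u by linarith
  qed
  then show "\<exists>no. \<forall>n\<ge>no. norm (F (X n) - F K) < r" by auto
qed

text \<open>Every disk has an affine image of this kind. The inner radius belongs to a disk inside
  the triangle with vertices \<open>0\<close>, \<open>axis 1 1\<close>, \<open>axis 2 1\<close>; the
  outer one leaves room for a square of side 2 whose center is moved off the origin.\<close>

definition normal_position :: "(real^2) set \<Rightarrow> bool" where
  "normal_position K \<longleftrightarrow> compact K \<and> convex K \<and> cball 0 (1/8) \<subseteq> K \<and> K \<subseteq> cball 0 3"

lemma normal_position_convex_disk: "normal_position K \<Longrightarrow> convex_disk K"
  unfolding normal_position_def convex_disk_def
  by (metis interior_mono interior_cball ball_eq_empty subset_empty not_le
      zero_less_divide_1_iff zero_less_numeral)

lemma support_point: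
  assumes "compact K" "K \<noteq> {}"
  shows "\<exists>y\<in>K. (SUP z\<in>K. u \<bullet> z) = u \<bullet> y \<and> (\<forall>z\<in>K. u \<bullet> z \<le> u \<bullet> y)"
proof -
  have "continuous_on K (\<lambda>z. u \<bullet> z)" by (intro continuous_intros)
  then obtain y where y: "y \<in> K" "\<forall>z\<in>K. u \<bullet> z \<le> u \<bullet> y"
    using continuous_attains_sup[OF assms] by blast
  then have "(SUP z\<in>K. u \<bullet> z) = u \<bullet> y" by (intro cSup_eq_maximum) auto
  then show ?thesis using y by blast
qed

lemma mem_by_support:
  fixes K :: "(real^2) set"
  assumes "compact K" "convex K" "K \<noteq> {}" and le: "\<And>u. norm u = 1 \<Longrightarrow> u \<bullet> x \<le> (SUP z\<in>K. u \<bullet> z)"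
  shows "x \<in> K"
proof (rule ccontr)
  assume "x \<notin> K"
  then obtain a b where ab: "a \<bullet> x < b" "\<forall>z\<in>K. b < a \<bullet> z"
    using separating_hyperplane_closed_point[of K x] assms compact_imp_closed by blast
  have a: "a \<noteq> 0" using ab assms(3) by auto
  define u where "u = - (1 / norm a) *\<^sub>R a"
  have "norm u = 1" using a by (simp add: u_def)
  obtain y where y: "y \<in> K" "(SUP z\<in>K. u \<bullet> z) = u \<bullet> y" using support_point[OF assms(1,3)] by blast
  have "u \<bullet> x \<le> u \<bullet> y" using le[OF \<open>norm u = 1\<close>] y by simp
  then have "a \<bullet> y \<le> a \<bullet> x" using a by (simp add: u_def field_simps)
  then show False using ab y by fastforce
qed

text \<open>Blaschke selection, obtained by applying Arzela--Ascoli to the support functions.\<close>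

lemma blaschke_selection:
  assumes X: "\<And>n::nat. normal_position (X n)"
  obtains K k where "normal_position K" "strict_mono (k :: nat \<Rightarrow> nat)"
    "\<And>e. e > 0 \<Longrightarrow> \<exists>N. \<forall>n\<ge>N. X (k n) \<subseteq> (*\<^sub>R) (1 + e) ` K \<and> K \<subseteq> (*\<^sub>R) (1 + e) ` X (k n)"
    "(\<And>n. uminus ` X n = X n) \<Longrightarrow> uminus ` K = K"
proof -
  \<comment> \<open>Support functions; the inclusions between the balls of radius 1/8 and 3 make
    them uniformly Lipschitz, and bounded away from 0 on the unit sphere.\<close>
  define h where "h n u = (SUP z\<in>X n. u \<bullet> z)" for n and u :: "real^2"
  have Xn: "compact (X n)" "convex (X n)" "X n \<noteq> {}" "cball 0 (1/8) \<subseteq> X n" "X n \<subseteq> cball 0 3" for n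
    using X[of n] normal_position_convex_disk[OF X[of n]] convex_disk_nonempty
    by (auto simp: normal_position_def)
  have h_ge: "u \<bullet> z \<le> h n u" if "z \<in> X n" for u z n
    using support_point[OF Xn(1)[of n] Xn(3)[of n], of u] that unfolding h_def by auto
  have h_at: "\<exists>y\<in>X n. h n u = u \<bullet> y" for u n
    using support_point[OF Xn(1)[of n] Xn(3)[of n], of u] unfolding h_def by auto
  have lip: "h n u - h n v \<le> 3 * norm (u - v)" for n u v
  proof -
    obtain y where y: "y \<in> X n" "h n u = u \<bullet> y" using h_at by blast
    have "h n u - h n v \<le> u \<bullet> y - v \<bullet> y" using h_ge[OF y(1), of v] y by simp
    also have "\<dots> = (u - v) \<bullet> y" by (simp add: inner_diff_left)
    also have "\<dots> \<le> norm (u - v) * norm y" by (rule norm_cauchy_schwarz)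
    also have "\<dots> \<le> norm (u - v) * 3" using y(1) Xn(5)[of n] by (intro mult_left_mono) auto
    finally show ?thesis by simp
  qed
  have bnd: "1/8 \<le> h n u \<and> h n u \<le> 3" if "norm u = 1" for n u
  proof
    have "(1/8) *\<^sub>R u \<in> X n" using Xn(4)[of n] that by (auto simp: subset_iff)
    then show "1/8 \<le> h n u" using h_ge[of "(1/8) *\<^sub>R u" n u] that by (simp add: dot_square_norm)
    show "h n u \<le> 3" using lip[of n u 0] that by (auto simp: h_def Xn(3))
  qed
  obtain g k where gk: "continuous_on (sphere (0::real^2) 1) g" "strict_mono (k :: nat \<Rightarrow> nat)"
    "\<And>e. 0 < e \<Longrightarrow> \<exists>N. \<forall>n x. n \<ge> N \<and> x \<in> sphere 0 1 \<longrightarrow> norm (h (k n) x - g x) < e"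
  proof (rule Arzela_Ascoli[of "sphere (0::real^2) 1" h 3])
    show "norm (h n x) \<le> 3" if "x \<in> sphere 0 1" for n x
      using bnd[of x n] that by auto
    show "\<exists>d>0. \<forall>n y. y \<in> sphere 0 1 \<and> norm (x - y) < d \<longrightarrow> norm (h n x - h n y) < e"
      if "x \<in> sphere 0 1" "0 < e" for x e
    proof (intro exI[of _ "e / 3"] conjI allI impI)
      fix n y assume "y \<in> sphere 0 1 \<and> norm (x - y) < e / 3"
      then show "norm (h n x - h n y) < e"
        using lip[of n x y] lip[of n y x] by (auto simp: norm_minus_commute)
    qed (use that in simp)
  qed (use that in auto)
  \<comment> \<open>Both inclusions below compare only the functions \<open>g\<close> and
    \<open>h\<close>, so the limit body can be defined directly by its half-planes.\<close>
  define K where "K = {x. \<forall>u\<in>sphere 0 1. u \<bullet> x \<le> g u}"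
  have lim: "(\<lambda>n. h (k n) u) \<longlonglongrightarrow> g u" if "norm u = 1" for u
    using gk(3) that by (intro LIMSEQ_I) fastforce
  have gb: "1/8 \<le> g u \<and> g u \<le> 3" if "norm u = 1" for u
    using LIMSEQ_le_const[OF lim[OF that], of "1/8"] LIMSEQ_le_const2[OF lim[OF that], of 3] bnd[OF that]
    by auto
  have "closed K" "convex K"
  proof -
    have "K = (\<Inter>u\<in>sphere 0 1. {x. u \<bullet> x \<le> g u})" by (auto simp: K_def)
    then show "closed K" "convex K"
      by (auto intro!: closed_INT convex_INT closed_halfspace_le convex_halfspace_le)
  qed
  have ball: "cball 0 (1/8) \<subseteq> K"
  proof
    fix x :: "real^2" assume "x \<in> cball 0 (1/8)"
    then have "u \<bullet> x \<le> g u" if "norm u = 1" for u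
      using norm_cauchy_schwarz[of u x] gb[OF that] that by simp
    then show "x \<in> K" by (simp add: K_def)
  qed
  have ball2: "K \<subseteq> cball 0 3"
  proof
    fix x assume x: "x \<in> K"
    show "x \<in> cball 0 3"
    proof (cases "x = 0")
      case False
      define u where "u = (1 / norm x) *\<^sub>R x"
      have "norm u = 1" using False by (simp add: u_def)
      then have "u \<bullet> x \<le> 3" using x gb[of u] by (force simp: K_def)
      then show ?thesis using False by (simp add: u_def dot_square_norm power2_eq_square)
    qed simp
  qed
  have "compact K"
    using \<open>closed K\<close> ball2 bounded_subset[OF bounded_cball] compact_eq_bounded_closed by blast
  then have K: "normal_position K" using \<open>convex K\<close> ball ball2 by (simp add: normal_position_def)
  have approx: "\<exists>N. \<forall>n\<ge>N. X (k n) \<subseteq> (*\<^sub>R) (1 + e) ` K \<and> K \<subseteq> (*\<^sub>R) (1 + e) ` X (k n)" if e: "e > 0" for e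
  proof -
    \<comment> \<open>Since both functions are at least 1/8, an additive error below
      \<open>e / 8\<close> is a relative error below \<open>e\<close>, which a dilation can
      absorb.\<close>
    obtain N where N: "\<And>n u. n \<ge> N \<Longrightarrow> norm u = 1 \<Longrightarrow> \<bar>h (k n) u - g u\<bar> < e / 8"
      using gk(3)[of "e / 8"] e by auto
    have le: "h (k n) u \<le> (1 + e) * g u \<and> g u \<le> (1 + e) * h (k n) u" if "n \<ge> N" "norm u = 1" for n u
    proof -
      have "e * (1/8) \<le> e * g u" "e * (1/8) \<le> e * h (k n) u"
        using gb[OF that(2)] bnd[OF that(2), of "k n"] e by (intro mult_left_mono; simp)+
      moreover have "h (k n) u - g u < e / 8" "g u - h (k n) u < e / 8"
        using N[OF that] by linarith+
      moreover have "(1 + e) * g u = g u + e * g u" "(1 + e) * h (k n) u = h (k n) u + e * h (k n) u"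
        by (simp_all add: distrib_right)
      ultimately show ?thesis by linarith
    qed
    have inv: "x \<in> (*\<^sub>R) (1 + e) ` A" if "(1 / (1 + e)) *\<^sub>R x \<in> A" for A and x :: "real^2"
      using that e by (intro image_eqI[of _ _ "(1 / (1 + e)) *\<^sub>R x"]) auto
    have "X (k n) \<subseteq> (*\<^sub>R) (1 + e) ` K" if n: "n \<ge> N" for n
    proof
      fix x assume x: "x \<in> X (k n)"
      have "u \<bullet> ((1 / (1 + e)) *\<^sub>R x) \<le> g u" if "norm u = 1" for u
        using h_ge[OF x, of u] le[OF n that] e by (simp add: field_simps)
      then show "x \<in> (*\<^sub>R) (1 + e) ` K" by (intro inv) (simp add: K_def)
    qed
    moreover have "K \<subseteq> (*\<^sub>R) (1 + e) ` X (k n)" if n: "n \<ge> N" for n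
    proof
      fix x assume x: "x \<in> K"
      have "u \<bullet> ((1 / (1 + e)) *\<^sub>R x) \<le> h (k n) u" if u: "norm u = 1" for u
      proof -
        have "u \<bullet> x \<le> g u" using x u by (simp add: K_def)
        then show ?thesis using le[OF n u] e by (simp add: field_simps)
      qed
      then show "x \<in> (*\<^sub>R) (1 + e) ` X (k n)"
        by (intro inv mem_by_support Xn) (simp add: h_def)
    qed
    ultimately show ?thesis by blast
  qed
  have sym: "uminus ` K = K" if s: "\<And>n. uminus ` X n = X n"
  proof -
    have heq: "h n (- u) = h n u" for n u
    proof -
      have "h n (- u) = (SUP z\<in>uminus ` X n. u \<bullet> z)" by (simp add: h_def image_image)
      then show ?thesis by (simp add: h_def s)
    qed
    have g: "g (- u) = g u" if u: "norm u = 1" for u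
    proof -
      have "(\<lambda>n. h (k n) u) \<longlonglongrightarrow> g (- u)" using lim[of "- u"] u by (simp add: heq)
      then show ?thesis using lim[OF u] by (rule LIMSEQ_unique)
    qed
    have m: "- x \<in> K" if x: "x \<in> K" for x
      unfolding K_def
    proof clarsimp
      fix u :: "real^2" assume u: "norm u = 1"
      then have "(- u) \<bullet> x \<le> g (- u)" using x unfolding K_def by (metis (no_types, lifting) mem_Collect_eq mem_sphere_0 norm_minus_cancel)
      then show "- (u \<bullet> x) \<le> g u" using g[OF u] by simp
    qed
    show ?thesis
    proof
      show "uminus ` K \<subseteq> K" using m by blast
      show "K \<subseteq> uminus ` K"
      proof
        fix x assume "x \<in> K"
        then show "x \<in> uminus ` K" using m by (intro image_eqI[of _ _ "- x"]) simp_all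
      qed
    qed
  qed
  show ?thesis by (rule that[OF K gk(2) approx sym])
qed

text \<open>A sequence of pairs is represented by bodies in normal position, Blaschke selection
  gives a limit body, and continuity identifies the limit of the pairs. The flag \<open>sy\<close>
  adds symmetry about the origin, so that one proof serves all bodies and the symmetric
  ones.\<close>

lemma compact_density_set:
  fixes sy :: bool
  assumes F: "affine_density F" "affine_density G"
    and P: "\<And>K. P K \<Longrightarrow> \<exists>K'. P K' \<and> normal_position K' \<and> (sy \<longrightarrow> uminus ` K' = K') \<and> F K' = F K \<and> G K' = G K"
    and Q: "\<And>K. normal_position K \<Longrightarrow> (sy \<longrightarrow> uminus ` K = K) \<Longrightarrow> P K"
  shows "compact {(F K, G K) | K. P K}"
  unfolding compact_def
proof (intro allI impI)
  fix f :: "nat \<Rightarrow> real \<times> real"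
  assume "\<forall>n. f n \<in> {(F K, G K) | K. P K}"
  note f = this
  have "\<forall>n. \<exists>K. normal_position K \<and> (sy \<longrightarrow> uminus ` K = K) \<and> f n = (F K, G K)"
  proof
    fix n
    obtain K where K: "P K" "f n = (F K, G K)" using f by blast
    then show "\<exists>K. normal_position K \<and> (sy \<longrightarrow> uminus ` K = K) \<and> f n = (F K, G K)"
      using P[OF K(1)] by auto
  qed
  then obtain X where X: "\<And>n. normal_position (X n)" "\<And>n. sy \<longrightarrow> uminus ` X n = X n"
    "\<And>n. f n = (F (X n), G (X n))" by metis
  obtain K k where K: "normal_position K" "strict_mono (k :: nat \<Rightarrow> nat)"
    "\<And>e. e > 0 \<Longrightarrow> \<exists>N. \<forall>n\<ge>N. X (k n) \<subseteq> (*\<^sub>R) (1 + e) ` K \<and> K \<subseteq> (*\<^sub>R) (1 + e) ` X (k n)"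
    "(\<And>n. uminus ` X n = X n) \<Longrightarrow> uminus ` K = K"
    using blaschke_selection[of X, OF X(1)] by metis
  have "P K" using Q[OF K(1)] K(4) X(2) by blast
  note cd = normal_position_convex_disk[OF K(1)] normal_position_convex_disk[OF X(1)]
  have "(\<lambda>n. F (X (k n))) \<longlonglongrightarrow> F K" "(\<lambda>n. G (X (k n))) \<longlonglongrightarrow> G K"
    using affine_density_tendsto[OF F(1) cd K(3)] affine_density_tendsto[OF F(2) cd K(3)] by auto
  then have "(f \<circ> k) \<longlonglongrightarrow> (F K, G K)"
    by (simp add: o_def X(3) tendsto_Pair)
  then show "\<exists>l\<in>{(F K, G K) | K. P K}. \<exists>r. strict_mono r \<and> (f \<circ> r) \<longlonglongrightarrow> l"
    using \<open>P K\<close> K(2) by blast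
qed

section \<open>Affine normalisation by inscribed figures of maximal area\<close>

lemma continuous_on_cross [continuous_intros]:
  assumes "continuous_on S f" "continuous_on S g"
  shows "continuous_on S (\<lambda>x. cross (f x) (g x))"
  unfolding cross_def using assms by (intro continuous_intros) auto

lemma nonzero_cross_in_disk:
  assumes "convex_disk K"
  obtains p q r where "p \<in> K" "q \<in> K" "r \<in> K" "cross (q - p) (r - p) \<noteq> 0"
proof -
  obtain a e where a: "e > 0" "cball a e \<subseteq> K"
    using assms unfolding convex_disk_def by (metis all_not_in_conv mem_interior_cball)
  have "a \<in> K" "a + e *\<^sub>R axis 1 1 \<in> K" "a + e *\<^sub>R axis 2 1 \<in> K"
    using a by (auto simp: subset_iff dist_norm)
  then show ?thesis
    by (rule that) (use a in \<open>simp add: cross_def axis_def\<close>)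
qed

lemma max_triangle:
  assumes "compact K" "K \<noteq> {}"
  obtains p q r where "p \<in> K" "q \<in> K" "r \<in> K"
    "\<And>x y z. x \<in> K \<Longrightarrow> y \<in> K \<Longrightarrow> z \<in> K \<Longrightarrow> \<bar>cross (y - x) (z - x)\<bar> \<le> \<bar>cross (q - p) (r - p)\<bar>"
proof -
  let ?f = "\<lambda>t::(real^2) \<times> (real^2) \<times> (real^2).
    \<bar>cross (fst (snd t) - fst t) (snd (snd t) - fst t)\<bar>"
  have c: "compact (K \<times> K \<times> K)" "K \<times> K \<times> K \<noteq> {}" using assms by (auto intro!: compact_Times)
  have "continuous_on (K \<times> K \<times> K) ?f" by (intro continuous_intros)
  then obtain t where t: "t \<in> K \<times> K \<times> K" "\<forall>s\<in>K \<times> K \<times> K. ?f s \<le> ?f t"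
    using continuous_attains_sup[OF c] by blast
  show ?thesis
  proof (rule that[of "fst t" "fst (snd t)" "snd (snd t)"])
    fix x y z assume "x \<in> K" "y \<in> K" "z \<in> K"
    then show "\<bar>cross (y - x) (z - x)\<bar> \<le> \<bar>cross (fst (snd t) - fst t) (snd (snd t) - fst t)\<bar>"
      using t(2)[rule_format, of "(x, y, z)"] by simp
  qed (use t(1) in auto)
qed

lemma max_parallelogram:
  assumes "compact K" "K \<noteq> {}"
  obtains p q where "p \<in> K" "q \<in> K"
    "\<And>x y. x \<in> K \<Longrightarrow> y \<in> K \<Longrightarrow> \<bar>cross x y\<bar> \<le> \<bar>cross p q\<bar>"
proof -
  let ?f = "\<lambda>t::(real^2) \<times> (real^2). \<bar>cross (fst t) (snd t)\<bar>"
  have c: "compact (K \<times> K)" "K \<times> K \<noteq> {}" using assms by (auto intro!: compact_Times)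
  have "continuous_on (K \<times> K) ?f" by (intro continuous_intros)
  then obtain t where t: "t \<in> K \<times> K" "\<forall>s\<in>K \<times> K. ?f s \<le> ?f t"
    using continuous_attains_sup[OF c] by blast
  show ?thesis
  proof (rule that[of "fst t" "snd t"])
    fix x y assume "x \<in> K" "y \<in> K"
    then show "\<bar>cross x y\<bar> \<le> \<bar>cross (fst t) (snd t)\<bar>"
      using t(2)[rule_format, of "(x, y)"] by simp
  qed (use t(1) in auto)
qed

lemma convex_comb3:
  fixes x y z :: "'a::real_vector"
  assumes "convex S" "x \<in> S" "y \<in> S" "z \<in> S" "0 \<le> a" "0 \<le> b" "0 \<le> c" "a + b + c = 1"
  shows "a *\<^sub>R x + b *\<^sub>R y + c *\<^sub>R z \<in> S"
proof -
  have "a *\<^sub>R x + b *\<^sub>R y + c *\<^sub>R z \<in> convex hull {x, y, z}"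
    using assms(5-8) unfolding convex_hull_3 by blast
  moreover have "convex hull {x, y, z} \<subseteq> S" using assms(1-4) by (intro hull_minimal) auto
  ultimately show ?thesis by blast
qed

lemma lin_coords:
  assumes "cross u v \<noteq> 0" "\<And>x. lin a b (lin u v x) = x"
  shows "lin a b x $ 1 = cross x v / cross u v" "lin a b x $ 2 = cross u x / cross u v"
proof -
  have "x = lin u v (vector [cross x v / cross u v, cross u x / cross u v])"
    using cross_expand[OF assms(1), of x] by (simp add: lin_def)
  then have "lin a b x = vector [cross x v / cross u v, cross u x / cross u v]"
    using assms(2) by metis
  then show "lin a b x $ 1 = cross x v / cross u v" "lin a b x $ 2 = cross u x / cross u v"
    by simp_all
qed

lemma affine_density_lin:
  "affine_density F \<Longrightarrow> convex_disk K \<Longrightarrow> cross u v \<noteq> 0 \<Longrightarrow> F (lin u v ` K) = F K"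
  by (simp add: affine_density_def)

lemma affine_density_translation:
  "affine_density F \<Longrightarrow> convex_disk K \<Longrightarrow> F ((+) a ` K) = F K"
  by (simp add: affine_density_def)

text \<open>A triangle of maximal area in \<open>K\<close> is mapped to \<open>0\<close>,
  \<open>axis 1 1\<close>, \<open>axis 2 1\<close>. Coordinates are then ratios of areas of
  triangles that share two vertices with it, so maximality bounds them by 1 in absolute
  value.\<close>

lemma normalize_disk:
  assumes K: "convex_disk K"
  shows "\<exists>K'. normal_position K' \<and> (\<forall>F. affine_density F \<longrightarrow> F K' = F K)"
proof -
  have cK: "compact K" "K \<noteq> {}" "convex K" using K convex_disk_nonempty by (auto simp: convex_disk_def)
  obtain p q r where pqr: "p \<in> K" "q \<in> K" "r \<in> K"
    and mx: "\<And>x y z. x \<in> K \<Longrightarrow> y \<in> K \<Longrightarrow> z \<in> K \<Longrightarrow> \<bar>cross (y - x) (z - x)\<bar> \<le> \<bar>cross (q - p) (r - p)\<bar>"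
    using max_triangle[OF cK(1,2)] by metis
  define u where "u = q - p"
  define v where "v = r - p"
  have uv: "cross u v \<noteq> 0"
  proof -
    obtain x y z where "x \<in> K" "y \<in> K" "z \<in> K" "cross (y - x) (z - x) \<noteq> 0"
      using nonzero_cross_in_disk[OF K] by metis
    then show ?thesis using mx[of x y z] by (auto simp: u_def v_def)
  qed
  obtain a b where ab: "cross a b \<noteq> 0" "\<And>x. lin a b (lin u v x) = x" using lin_inverse[OF uv] by metis
  \<comment> \<open>The square of half-side 1/8 around \<open>c\<close> lies in the standard
    triangle: its coordinates are at least 1/8 and their sum is at most 3/4.\<close>
  define c :: "real^2" where "c = (\<chi> i. 1/4)"
  define K1 where "K1 = lin a b ` (+) (- p) ` K"
  define K' where "K' = (+) (- c) ` K1"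
  have cd: "convex_disk ((+) (- p) ` K)" "convex_disk K1" "convex_disk K'"
    unfolding K1_def K'_def by (intro convex_disk_translation convex_disk_lin[OF _ ab(1)] K)+
  have inv: "F K' = F K" if "affine_density F" for F
    unfolding K'_def K1_def affine_density_translation[OF that cd(2)[unfolded K1_def]]
      affine_density_lin[OF that cd(1) ab(1)] affine_density_translation[OF that K] ..
  have box: "\<bar>y $ 1\<bar> \<le> 1 \<and> \<bar>y $ 2\<bar> \<le> 1" if "y \<in> K1" for y
  proof -
    obtain x where x: "x \<in> K" "y = lin a b (x - p)" using \<open>y \<in> K1\<close> by (auto simp: K1_def)
    have "\<bar>cross (x - p) v\<bar> \<le> \<bar>cross u v\<bar>" "\<bar>cross u (x - p)\<bar> \<le> \<bar>cross u v\<bar>"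
      using mx[of p x r] mx[of p q x] pqr x by (auto simp: u_def v_def)
    then show ?thesis using uv by (simp add: x lin_coords[OF uv ab(2)])
  qed
  have pts: "0 \<in> K1" "axis 1 1 \<in> K1" "axis 2 1 \<in> K1"
  proof -
    have "lin a b 0 = 0" "lin a b u = axis 1 1" "lin a b v = axis 2 1"
      using ab(2)[of 0] ab(2)[of "axis 1 1"] ab(2)[of "axis 2 1"] by (auto simp: lin_def axis_def)
    moreover have "0 \<in> (+) (- p) ` K" "u \<in> (+) (- p) ` K" "v \<in> (+) (- p) ` K"
      using pqr by (auto simp: u_def v_def image_iff intro!: bexI)
    ultimately show "0 \<in> K1" "axis 1 1 \<in> K1" "axis 2 1 \<in> K1" unfolding K1_def by (metis image_eqI)+
  qed
  have "cball 0 (1/8) \<subseteq> K'"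
  proof
    fix x :: "real^2" assume "x \<in> cball 0 (1/8)"
    then have x: "\<bar>x $ 1\<bar> \<le> 1/8" "\<bar>x $ 2\<bar> \<le> 1/8"
      using component_le_norm_cart[of x 1] component_le_norm_cart[of x 2] by simp_all
    define y where "y = c + x"
    have y: "y $ 1 \<ge> 0" "y $ 2 \<ge> 0" "y $ 1 + y $ 2 \<le> 1" using x by (auto simp: y_def c_def)
    have "convex K1" using cd(2) by (simp add: convex_disk_def)
    then have "(1 - y $ 1 - y $ 2) *\<^sub>R 0 + y $ 1 *\<^sub>R axis 1 1 + y $ 2 *\<^sub>R axis 2 1 \<in> K1"
      using y pts by (intro convex_comb3) auto
    also have "(1 - y $ 1 - y $ 2) *\<^sub>R 0 + y $ 1 *\<^sub>R axis 1 1 + y $ 2 *\<^sub>R axis 2 1 = y"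
      by (simp add: vec2_eq_iff axis_def)
    finally show "x \<in> K'" by (auto simp: K'_def y_def image_iff intro!: bexI[of _ "c + x"])
  qed
  moreover have "K' \<subseteq> cball 0 3"
  proof
    fix x assume "x \<in> K'"
    then obtain y where y: "y \<in> K1" "x = y - c" by (auto simp: K'_def)
    have "norm x \<le> \<bar>x $ 1\<bar> + \<bar>x $ 2\<bar>" using norm_le_l1_cart[of x] by (simp add: sum_2)
    also have "\<dots> \<le> 3" using box[OF y(1)] by (auto simp: y(2) c_def)
    finally show "x \<in> cball 0 3" by simp
  qed
  ultimately have "normal_position K'" using cd(3) by (simp add: normal_position_def convex_disk_def)
  then show ?thesis using inv by blast
qed

text \<open>The center has to go to the origin, so a pair \<open>u\<close>, \<open>v\<close> that
  maximises \<open>\<bar>cross u v\<bar>\<close> replaces the triangle. By symmetry the image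
  contains the hull of both axis vectors and their negatives.\<close>

lemma normalize_symmetric_disk:
  assumes K: "convex_disk K" "centrally_symmetric K"
  shows "\<exists>K'. normal_position K' \<and> uminus ` K' = K' \<and> (\<forall>F. affine_density F \<longrightarrow> F K' = F K)"
proof -
  obtain c where c: "(\<lambda>x. 2 *\<^sub>R c - x) ` K = K" using K(2) by (auto simp: centrally_symmetric_def)
  define K0 where "K0 = (+) (- c) ` K"
  have sym0: "- x \<in> K0" if "x \<in> K0" for x
  proof -
    obtain y where "y \<in> K" "x = - c + y" using \<open>x \<in> K0\<close> unfolding K0_def by blast
    then have y: "y \<in> K" "x = y - c" by simp_all
    then have "2 *\<^sub>R c - y \<in> K" using c by blast
    moreover have "- x = - c + (2 *\<^sub>R c - y)" by (simp add: y scaleR_2)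
    ultimately show ?thesis unfolding K0_def by blast
  qed
  have cd0: "convex_disk K0" unfolding K0_def by (rule convex_disk_translation[OF K(1)])
  then have cK: "compact K0" "K0 \<noteq> {}" "convex K0" using convex_disk_nonempty by (auto simp: convex_disk_def)
  obtain u v where uv: "u \<in> K0" "v \<in> K0" and mx: "\<And>x y. x \<in> K0 \<Longrightarrow> y \<in> K0 \<Longrightarrow> \<bar>cross x y\<bar> \<le> \<bar>cross u v\<bar>"
    using max_parallelogram[OF cK(1,2)] by metis
  have uv0: "cross u v \<noteq> 0"
  proof
    \<comment> \<open>All cross products of points of \<open>K0\<close> would vanish, and with them
      the areas of all inscribed triangles.\<close>
    assume 0: "cross u v = 0"
    obtain x y z where "x \<in> K0" "y \<in> K0" "z \<in> K0" "cross (y - x) (z - x) \<noteq> 0"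
      using nonzero_cross_in_disk[OF cd0] by metis
    then show False using mx[of y z] mx[of y x] mx[of x z] 0 by (simp add: cross_simps)
  qed
  obtain a b where ab: "cross a b \<noteq> 0" "\<And>x. lin a b (lin u v x) = x" using lin_inverse[OF uv0] by metis
  define K1 where "K1 = lin a b ` K0"
  have cd: "convex_disk K1" unfolding K1_def by (rule convex_disk_lin[OF cd0 ab(1)])
  have inv: "F K1 = F K" if "affine_density F" for F
    unfolding K1_def affine_density_lin[OF that cd0 ab(1)]
    unfolding K0_def affine_density_translation[OF that K(1)] ..
  have sym1: "- x \<in> K1" if x: "x \<in> K1" for x
  proof -
    obtain y where "y \<in> K0" "x = lin a b y" using x by (auto simp: K1_def)
    then show ?thesis unfolding K1_def using sym0 by (intro image_eqI[of _ _ "- y"]) (auto simp: lin_def)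
  qed
  have "axis 1 1 \<in> K1" "axis 2 1 \<in> K1"
  proof -
    have "lin a b u = axis 1 1" "lin a b v = axis 2 1"
      using ab(2)[of "axis 1 1"] ab(2)[of "axis 2 1"] by (auto simp: lin_def axis_def)
    then show "axis 1 1 \<in> K1" "axis 2 1 \<in> K1" unfolding K1_def using uv by (metis image_eqI)+
  qed
  then have pts: "sgn t *\<^sub>R axis i 1 \<in> K1" "0 \<in> K1" for t :: real and i
  proof -
    have ax: "axis i 1 \<in> K1" for i using \<open>axis 1 1 \<in> K1\<close> \<open>axis 2 1 \<in> K1\<close> exhaust_2[of i] by auto
    have "convex K1" using cd by (simp add: convex_disk_def)
    then have "(1/2) *\<^sub>R axis 1 1 + (1/2) *\<^sub>R (- axis 1 1) \<in> K1"
      by (rule convexD) (use ax sym1 in auto)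
    then show "0 \<in> K1" by simp
    then show "sgn t *\<^sub>R axis i 1 \<in> K1" using ax sym1 by (simp add: sgn_real_def)
  qed
  have box: "\<bar>y $ 1\<bar> \<le> 1 \<and> \<bar>y $ 2\<bar> \<le> 1" if "y \<in> K1" for y
  proof -
    obtain x where x: "x \<in> K0" "y = lin a b x" using \<open>y \<in> K1\<close> by (auto simp: K1_def)
    have "\<bar>cross x v\<bar> \<le> \<bar>cross u v\<bar>" "\<bar>cross u x\<bar> \<le> \<bar>cross u v\<bar>"
      using mx[of x v] mx[of u x] uv x by auto
    then show ?thesis using uv0 by (simp add: x lin_coords[OF uv0 ab(2)])
  qed
  have "cball 0 (1/8) \<subseteq> K1"
  proof
    fix x :: "real^2" assume "x \<in> cball 0 (1/8)"
    then have x: "\<bar>x $ 1\<bar> \<le> 1/8" "\<bar>x $ 2\<bar> \<le> 1/8"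
      using component_le_norm_cart[of x 1] component_le_norm_cart[of x 2] by simp_all
    have "convex K1" using cd by (simp add: convex_disk_def)
    then have "(1 - \<bar>x $ 1\<bar> - \<bar>x $ 2\<bar>) *\<^sub>R 0 + \<bar>x $ 1\<bar> *\<^sub>R (sgn (x $ 1) *\<^sub>R axis 1 1) +
        \<bar>x $ 2\<bar> *\<^sub>R (sgn (x $ 2) *\<^sub>R axis 2 1) \<in> K1"
      using x pts by (intro convex_comb3) auto
    also have "(1 - \<bar>x $ 1\<bar> - \<bar>x $ 2\<bar>) *\<^sub>R 0 + \<bar>x $ 1\<bar> *\<^sub>R (sgn (x $ 1) *\<^sub>R axis 1 1) +
        \<bar>x $ 2\<bar> *\<^sub>R (sgn (x $ 2) *\<^sub>R axis 2 1) = x"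
      by (auto simp: vec2_eq_iff axis_def abs_mult_sgn mult.commute)
    finally show "x \<in> K1" .
  qed
  moreover have "K1 \<subseteq> cball 0 3"
  proof
    fix x assume y: "x \<in> K1"
    have "norm x \<le> \<bar>x $ 1\<bar> + \<bar>x $ 2\<bar>" using norm_le_l1_cart[of x] by (simp add: sum_2)
    also have "\<dots> \<le> 3" using box[OF y] by auto
    finally show "x \<in> cball 0 3" by simp
  qed
  ultimately have "normal_position K1" using cd by (simp add: normal_position_def convex_disk_def)
  moreover have "uminus ` K1 = K1"
  proof
    show "uminus ` K1 \<subseteq> K1" using sym1 by blast
    show "K1 \<subseteq> uminus ` K1"
    proof
      fix x assume "x \<in> K1"
      then show "x \<in> uminus ` K1" using sym1 by (intro image_eqI[of _ _ "- x"]) simp_all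
    qed
  qed
  ultimately show ?thesis using inv by blast
qed

lemma compact_Omegas: "compact Omega_T" "compact Omega_L" "compact Omega_T_sym"
proof -
  have gen: "compact {(F K, G K) | K. convex_disk K}" if FG: "affine_density F" "affine_density G" for F G
  proof (rule compact_density_set[OF FG, where sy = False])
    fix K assume "convex_disk K"
    then obtain K' where K': "normal_position K'" "\<forall>F. affine_density F \<longrightarrow> F K' = F K"
      using normalize_disk by blast
    show "\<exists>K'. convex_disk K' \<and> normal_position K' \<and> (False \<longrightarrow> uminus ` K' = K') \<and> F K' = F K \<and> G K' = G K"
      by (rule exI[of _ K']) (simp add: K' FG normal_position_convex_disk)
  qed (rule normal_position_convex_disk)
  show "compact Omega_T" "compact Omega_L"
    unfolding Omega_T_def Omega_L_def by (intro gen affine_density_densities)+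
  have s: "centrally_symmetric K" if "uminus ` K = K" for K
    unfolding centrally_symmetric_def using that by (intro exI[of _ 0]) simp
  show "compact Omega_T_sym"
    unfolding Omega_T_sym_def
  proof (rule compact_density_set[where sy = True])
    show "affine_density delta_T" "affine_density theta_T" by (rule affine_density_densities)+
    fix K assume "convex_disk K \<and> centrally_symmetric K"
    then obtain K' where K': "normal_position K'" "uminus ` K' = K'" "\<forall>F. affine_density F \<longrightarrow> F K' = F K"
      using normalize_symmetric_disk by blast
    show "\<exists>K'. (convex_disk K' \<and> centrally_symmetric K') \<and> normal_position K' \<and>
        (True \<longrightarrow> uminus ` K' = K') \<and> delta_T K' = delta_T K \<and> theta_T K' = theta_T K"
      by (rule exI[of _ K']) (simp add: K' s affine_density_densities normal_position_convex_disk)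
  next
    fix K :: "(real^2) set" assume "normal_position K" "True \<longrightarrow> uminus ` K = K"
    then show "convex_disk K \<and> centrally_symmetric K" using s normal_position_convex_disk by simp
  qed
qed

section \<open>Delaunay polygons of strictly convex norms\<close>

definition rot :: "real^2 \<Rightarrow> real^2" where
  "rot w = vector [- w $ 2, w $ 1]"

lemma inner_vec2: "x \<bullet> y = x $ 1 * y $ 1 + x $ 2 * y $ 2" for x y :: "real^2"
  by (simp add: inner_vec_def sum_2)

lemma cross_rot: "cross w x = rot w \<bullet> x"
  by (simp add: rot_def cross_def inner_vec2)

lemma rot_expand: "(w \<bullet> w) *\<^sub>R x = (w \<bullet> x) *\<^sub>R w + cross w x *\<^sub>R rot w"
  by (simp add: vec2_eq_iff rot_def cross_def inner_vec2 algebra_simps)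

text \<open>A small step from \<open>p\<close> in direction \<open>d\<close> stays in the hull,
  hence some generator lies strictly ahead of \<open>p\<close>.\<close>

lemma interior_hull_separation:
  assumes "p \<in> interior (convex hull A)" "d \<noteq> 0"
  shows "\<exists>a\<in>A. d \<bullet> (a - p) > 0"
proof (rule ccontr)
  assume "\<not> ?thesis"
  then have "A \<subseteq> {x. d \<bullet> x \<le> d \<bullet> p}" by (auto simp: inner_diff_right not_less)
  then have sub: "convex hull A \<subseteq> {x. d \<bullet> x \<le> d \<bullet> p}"
    by (intro hull_minimal convex_halfspace_le)
  obtain e where e: "e > 0" "cball p e \<subseteq> convex hull A"
    using assms(1) by (auto simp: mem_interior_cball)
  have "p + (e / norm d) *\<^sub>R d \<in> cball p e" using e assms(2) by (simp add: dist_norm)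
  then have "d \<bullet> (p + (e / norm d) *\<^sub>R d) \<le> d \<bullet> p" using e sub by blast
  moreover have "d \<bullet> ((e / norm d) *\<^sub>R d) > 0" using e assms(2) by simp
  ultimately show False by (simp add: inner_add_right)
qed

lemma finite_attains_max:
  fixes f :: "'a \<Rightarrow> real"
  assumes "finite S" "S \<noteq> {}"
  shows "\<exists>x\<in>S. \<forall>z\<in>S. f z \<le> f x"
proof -
  have "Max (f ` S) \<in> f ` S" using assms by (intro Max_in) auto
  then obtain x where "x \<in> S" "Max (f ` S) = f x" by blast
  then show ?thesis using Max_ge[of "f ` S"] assms(1) by (metis finite_imageI imageI)
qed

text \<open>In the orthogonal frame \<open>w\<close>, \<open>rot w\<close> at \<open>p\<close>, the
  quotients measure how far ahead of \<open>p\<close> the points on the left and on the right lie.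
  If no point is on the ray and the largest left quotient \<open>s\<close> and the largest right one
  have sum at most 0, then no generator is strictly ahead in direction
  \<open>w - s *\<^sub>R rot w\<close>, although \<open>p\<close> is interior.\<close>

lemma cone_generators:
  fixes A :: "(real^2) set"
  assumes "p \<in> interior (convex hull A)" "finite A" "w \<noteq> 0"
  shows "(\<exists>a\<in>A. cross w (a - p) = 0 \<and> w \<bullet> (a - p) > 0) \<or>
    (\<exists>x\<in>A. \<exists>y\<in>A. cross w (x - p) > 0 \<and> cross w (y - p) < 0 \<and>
      w \<bullet> (x - p) / cross w (x - p) + w \<bullet> (y - p) / (- cross w (y - p)) > 0)"
proof (rule ccontr)
  assume neg: "\<not> ?thesis"
  have rw: "rot w \<noteq> 0" using assms(3) by (auto simp: rot_def vec2_eq_iff)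
  define L where "L = {x\<in>A. cross w (x - p) > 0}"
  define R where "R = {x\<in>A. cross w (x - p) < 0}"
  have "L \<noteq> {}" "R \<noteq> {}"
    using interior_hull_separation[OF assms(1) rw] interior_hull_separation[OF assms(1), of "- rot w"] rw
    by (auto simp: L_def R_def cross_rot)
  moreover have "finite L" "finite R" using assms(2) by (auto simp: L_def R_def)
  ultimately obtain x y where x: "x \<in> L" "\<And>z. z \<in> L \<Longrightarrow> w \<bullet> (z - p) / cross w (z - p) \<le> w \<bullet> (x - p) / cross w (x - p)"
    and y: "y \<in> R" "\<And>z. z \<in> R \<Longrightarrow> w \<bullet> (z - p) / (- cross w (z - p)) \<le> w \<bullet> (y - p) / (- cross w (y - p))"
    using finite_attains_max[of L "\<lambda>z. w \<bullet> (z - p) / cross w (z - p)"]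
      finite_attains_max[of R "\<lambda>z. w \<bullet> (z - p) / (- cross w (z - p))"]
    by blast
  define s where "s = w \<bullet> (x - p) / cross w (x - p)"
  define s' where "s' = w \<bullet> (y - p) / (- cross w (y - p))"
  have ss: "s + s' \<le> 0" using neg x(1) y(1) unfolding s_def s'_def L_def R_def by force
  define d where "d = w - s *\<^sub>R rot w"
  have "d \<bullet> w = w \<bullet> w"
    by (simp add: d_def inner_diff_left rot_def inner_vec2 algebra_simps)
  then have "d \<noteq> 0" using assms(3) by auto
  then obtain a where a: "a \<in> A" "d \<bullet> (a - p) > 0" using interior_hull_separation[OF assms(1)] by blast
  have da: "d \<bullet> (a - p) = w \<bullet> (a - p) - s * cross w (a - p)"
    by (simp add: d_def inner_diff_left cross_rot)
  consider "cross w (a - p) > 0" | "cross w (a - p) < 0" | "cross w (a - p) = 0" by linarith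
  then show False
  proof cases
    case 1
    then have "w \<bullet> (a - p) / cross w (a - p) \<le> s" unfolding s_def using x(2) a by (simp add: L_def)
    then show False using 1 a da by (simp add: field_simps)
  next
    case 2
    then have "w \<bullet> (a - p) / (- cross w (a - p)) \<le> s'" unfolding s'_def using y(2) a by (simp add: R_def)
    also have "\<dots> \<le> - s" using ss by simp
    finally have "w \<bullet> (a - p) \<le> - s * (- cross w (a - p))"
      using 2 by (simp only: pos_divide_le_eq neg_0_less_iff_less)
    then show False using a da by simp
  next
    case 3
    then show False using neg a da by auto
  qed
qed

text \<open>Supplies the vertices for \<open>disks_cross\<close>. Unless a single point suffices,
  \<open>w\<close> is in a cone of two points of \<open>A\<close>, one on either side, and
  \<open>- w\<close> in such a cone for \<open>B\<close>. Reflecting the points of \<open>B\<close>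
  in \<open>p\<close> gives two candidates on each side; the four quotients have positive sum, so
  one of the two mixed pairs also spans a cone containing \<open>w\<close>.\<close>

lemma cone_choice:
  fixes A B :: "(real^2) set"
  assumes A: "p \<in> interior (convex hull A)" "finite A" and B: "p \<in> interior (convex hull B)" "finite B"
  obtains b c w1 w2 where "b \<in> A" "c \<in> B" "b \<noteq> c" "w1 \<ge> 0" "w2 \<ge> 0"
    "w = w1 *\<^sub>R (b - p) - w2 *\<^sub>R (c - p)"
proof -
  \<comment> \<open>The hull of a single point has no interior; this secures
    \<open>b \<noteq> c\<close> even when a weight is 0.\<close>
  have two: "\<exists>a\<in>C. a \<noteq> q" if C: "p \<in> interior (convex hull C)" for C and q :: "real^2"
  proof (rule ccontr)
    assume "\<not> ?thesis"
    then have q: "a = q" if "a \<in> C" for a using that by blast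
    have "axis 1 1 \<noteq> (0::real^2)" by (simp add: axis_eq_0_iff)
    then obtain a b where "a \<in> C" "b \<in> C" "axis 1 1 \<bullet> (a - p) > 0" "(- axis 1 1) \<bullet> (b - p) > 0"
      using interior_hull_separation[OF C, of "axis 1 1"] interior_hull_separation[OF C, of "- axis 1 1"]
      by auto
    then show False using q[of a] q[of b] by simp
  qed
  have par: "w = (w \<bullet> w / (w \<bullet> x)) *\<^sub>R x" if "cross w x = 0" "w \<bullet> x > 0" for x
  proof -
    have "(w \<bullet> w) *\<^sub>R x = (w \<bullet> x) *\<^sub>R w" using rot_expand[of w x] that by simp
    then have "(w \<bullet> w / (w \<bullet> x)) *\<^sub>R x = (1 / (w \<bullet> x)) *\<^sub>R (w \<bullet> x) *\<^sub>R w"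
      by (metis mult.commute mult_1 scaleR_scaleR times_divide_eq_left)
    then show ?thesis using that by simp
  qed
  show ?thesis
  proof (cases "w = 0")
    case True
    obtain a where "a \<in> A" using two[OF A(1)] by blast
    moreover obtain c where "c \<in> B" "c \<noteq> a" using two[OF B(1)] by blast
    ultimately show ?thesis using that[of a c 0 0] True by auto
  next
    case False
    have "- w \<noteq> 0" using False by simp
    note gA = cone_generators[OF A False] and gB = cone_generators[OF B this]
    consider (onA) a where "a \<in> A" "cross w (a - p) = 0" "w \<bullet> (a - p) > 0"
      | (onB) c where "c \<in> B" "cross (- w) (c - p) = 0" "(- w) \<bullet> (c - p) > 0"
      | (AB) x y x' y' where "x \<in> A" "y \<in> A" "x' \<in> B" "y' \<in> B"
        "cross w (x - p) > 0" "cross w (y - p) < 0" "cross (- w) (x' - p) > 0" "cross (- w) (y' - p) < 0"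
        "w \<bullet> (x - p) / cross w (x - p) + w \<bullet> (y - p) / (- cross w (y - p)) > 0"
        "(- w) \<bullet> (x' - p) / cross (- w) (x' - p) + (- w) \<bullet> (y' - p) / (- cross (- w) (y' - p)) > 0"
      using gA gB by blast
    then show ?thesis
    proof cases
      case onA
      obtain c where "c \<in> B" "c \<noteq> a" using two[OF B(1)] by blast
      then show ?thesis
        using that[of a c "w \<bullet> w / (w \<bullet> (a - p))" 0] onA par[OF onA(2,3)] by auto
    next
      case onB
      obtain a where a: "a \<in> A" "a \<noteq> c" using two[OF A(1)] by blast
      have "cross w (p - c) = 0" "w \<bullet> (p - c) > 0"
        using onB(2,3) by (auto simp: cross_simps inner_diff_right)
      from par[OF this] have "w = - (w \<bullet> w / (w \<bullet> (p - c))) *\<^sub>R (c - p)"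
        by (metis minus_diff_eq scaleR_minus_left scaleR_minus_right)
      then show ?thesis
        using that[of a c 0 "w \<bullet> w / (w \<bullet> (p - c))"] onB(1) a \<open>w \<bullet> (p - c) > 0\<close> by auto
    next
      case AB
      note result = that
      have key: ?thesis
        if xy: "x \<in> A" "y \<in> B" and c: "cross w (x - p) * cross w (y - p) > 0"
          and s: "w \<bullet> (x - p) / \<bar>cross w (x - p)\<bar> + w \<bullet> (p - y) / \<bar>cross w (p - y)\<bar> > 0" for x y
      proof -
        define z where "z = (1 / \<bar>cross w (x - p)\<bar>) *\<^sub>R (x - p) + (1 / \<bar>cross w (p - y)\<bar>) *\<^sub>R (p - y)"
        have n: "cross w (x - p) \<noteq> 0" "cross w (p - y) \<noteq> 0" "sgn (cross w (p - y)) = - sgn (cross w (x - p))"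
          using c by (auto simp: cross_simps sgn_if zero_less_mult_iff)
        have "cross w z = cross w (x - p) / \<bar>cross w (x - p)\<bar> + cross w (p - y) / \<bar>cross w (p - y)\<bar>"
          unfolding z_def cross_simps(2) cross_simps(6) by simp
        also have "\<dots> = sgn (cross w (x - p)) + sgn (cross w (p - y))"
          using n(1,2) by (simp add: sgn_if)
        finally have z: "cross w z = 0" using n(3) by simp
        have z2: "w \<bullet> z > 0" using s by (simp add: z_def inner_add_right)
        define k where "k = w \<bullet> w / (w \<bullet> z)"
        have k: "k \<ge> 0" using z2 by (simp add: k_def)
        have "w = k *\<^sub>R z" unfolding k_def by (rule par[OF z z2])
        also have "\<dots> = (k / \<bar>cross w (x - p)\<bar>) *\<^sub>R (x - p) - (k / \<bar>cross w (p - y)\<bar>) *\<^sub>R (y - p)"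
          by (simp add: z_def scaleR_add_right scaleR_diff_right)
        finally have w: "w = (k / \<bar>cross w (x - p)\<bar>) *\<^sub>R (x - p) - (k / \<bar>cross w (p - y)\<bar>) *\<^sub>R (y - p)" .
        \<comment> \<open>Otherwise \<open>z\<close> would be a sum of two opposite vectors with
          equal weights and vanish.\<close>
        have "x \<noteq> y"
        proof
          assume "x = y"
          then have "\<bar>cross w (x - p)\<bar> = \<bar>cross w (p - y)\<bar>" by (simp add: cross_simps abs_minus_commute)
          then have "z = 0" using \<open>x = y\<close> by (simp add: z_def flip: scaleR_add_right)
          then show False using z2 by simp
        qed
        then show ?thesis using result[OF xy _ _ _ w] k by simp
      qed
      have e: "cross (- w) (x' - p) = cross w (p - x')" "cross (- w) (y' - p) = cross w (p - y')"
        "(- w) \<bullet> (x' - p) = w \<bullet> (p - x')" "(- w) \<bullet> (y' - p) = w \<bullet> (p - y')"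
        by (simp_all add: cross_simps inner_diff_right)
      have sg: "cross w (x' - p) < 0" "cross w (y' - p) > 0" "cross w (p - x') > 0" "cross w (p - y') < 0"
        using AB(7,8) by (simp_all add: cross_simps)
      have sum: "(w \<bullet> (x - p) / \<bar>cross w (x - p)\<bar> + w \<bullet> (p - y') / \<bar>cross w (p - y')\<bar>) +
          (w \<bullet> (y - p) / \<bar>cross w (y - p)\<bar> + w \<bullet> (p - x') / \<bar>cross w (p - x')\<bar>) > 0"
        using AB(5,6,9,10) sg(3,4) unfolding e by simp
      show ?thesis
      proof (cases "w \<bullet> (x - p) / \<bar>cross w (x - p)\<bar> + w \<bullet> (p - y') / \<bar>cross w (p - y')\<bar> > 0")
        case True
        then show ?thesis using key[OF AB(1,4)] AB(5) sg(2) by simp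
      next
        case False
        then have "w \<bullet> (y - p) / \<bar>cross w (y - p)\<bar> + w \<bullet> (p - x') / \<bar>cross w (p - x')\<bar> > 0"
          using sum by linarith
        then show ?thesis using key[OF AB(2,3)] AB(6) sg(1) by (simp add: mult_neg_neg)
      qed
    qed
  qed
qed

section \<open>Strictly convex norms and pairs of their disks\<close>

locale strict_norm =
  fixes N :: "real^2 \<Rightarrow> real"
  assumes tri: "N (x + y) \<le> N x + N y"
    and hom: "N (a *\<^sub>R x) = \<bar>a\<bar> * N x"
    and pos: "x \<noteq> 0 \<Longrightarrow> N x > 0"
    and strict: "N x \<le> r \<Longrightarrow> N y \<le> r \<Longrightarrow> x \<noteq> y \<Longrightarrow> 0 < t \<Longrightarrow> t < 1 \<Longrightarrow>
      N ((1 - t) *\<^sub>R x + t *\<^sub>R y) < r"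
begin

lemma zero [simp]: "N 0 = 0"
  using hom[of 0 0] by simp

lemma nonneg [simp]: "N x \<ge> 0"
  using pos[of x] by (cases "x = 0") auto

lemma minus [simp]: "N (- x) = N x"
  using hom[of "-1" x] by simp

lemma commute: "N (x - y) = N (y - x)"
  using minus[of "x - y"] by simp

lemma tri3: "N (x - z) \<le> N (x - y) + N (y - z)"
  using tri[of "x - y" "y - z"] by simp

lemma comb3:
  assumes "a \<ge> 0" "b \<ge> 0" "c \<ge> 0"
  shows "N (a *\<^sub>R x + b *\<^sub>R y + c *\<^sub>R z) \<le> a * N x + b * N y + c * N z"
  using tri[of "a *\<^sub>R x + b *\<^sub>R y" "c *\<^sub>R z"] tri[of "a *\<^sub>R x" "b *\<^sub>R y"] assms
  by (simp add: hom)

lemma comb2: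
  assumes "a \<ge> 0" "b \<ge> 0"
  shows "N (a *\<^sub>R x + b *\<^sub>R y) \<le> a * N x + b * N y"
  using tri[of "a *\<^sub>R x" "b *\<^sub>R y"] assms by (simp add: hom)

text \<open>Let \<open>T\<close> be the homothety that maps the second disk onto the first.  Either \<open>c\<close> lies in
  the triangle \<open>T c, b, p\<close> or \<open>T b\<close> lies in the triangle \<open>T c, b, T p\<close>; both triangles are
  contained in the first disk.\<close>

lemma disks_cross:
  assumes r: "r1 \<ge> r2" "r2 > 0"
    and b: "N (b - c1) \<le> r1" "N (b - c2) \<ge> r2"
    and c: "N (c - c2) \<le> r2" "N (c - c1) \<ge> r1"
    and p: "N (p - c1) < r1" "N (p - c2) < r2"
    and w: "p - (c1 + (r1 / r2) *\<^sub>R (p - c2)) = w1 *\<^sub>R (b - p) - w2 *\<^sub>R (c - p)" "w1 \<ge> 0" "w2 \<ge> 0"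
    and ne: "b \<noteq> c" "(c1, r1) \<noteq> (c2, r2)"
  shows False
proof -
  \<comment> \<open>The homothety \<open>T\<close> has ratio \<open>1 + k\<close>; below,
    \<open>q\<close>, \<open>tb\<close>, \<open>tp\<close> are the images of \<open>c\<close>,
    \<open>b\<close>, \<open>p\<close>.\<close>
  define k where "k = r1 / r2 - 1"
  have k: "k \<ge> 0" "r1 / r2 = 1 + k" using r by (auto simp: k_def)
  obtain q where q: "q = c1 + (1 + k) *\<^sub>R (c - c2)" by blast
  obtain tb where tb: "tb = c1 + (1 + k) *\<^sub>R (b - c2)" by blast
  obtain tp where tp: "tp = c1 + (1 + k) *\<^sub>R (p - c2)" by blast
  have Nq: "N (q - c1) = (1 + k) * N (c - c2)" and Ntb: "N (tb - c1) = (1 + k) * N (b - c2)"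
    and Ntp: "N (tp - c1) = (1 + k) * N (p - c2)"
    using k by (simp_all add: q tb tp hom)
  have r12: "1 + k > 0" "(1 + k) * r2 = r1" using k r by (auto simp: field_simps)
  have "p - tp = w1 *\<^sub>R (b - p) - w2 *\<^sub>R (c - p)" using w(1) unfolding tp k(2) .
  then have tp': "tp = p - w1 *\<^sub>R (b - p) + w2 *\<^sub>R (c - p)"
    by (simp add: algebra_simps)
  have "q = tp + (1 + k) *\<^sub>R (c - p)" "tb = tp + (1 + k) *\<^sub>R (b - p)"
    by (simp_all add: q tb tp algebra_simps)
  then have q': "q = p - w1 *\<^sub>R (b - p) + (1 + k + w2) *\<^sub>R (c - p)"
    and tb': "tb = p - w1 *\<^sub>R (b - p) + w2 *\<^sub>R (c - p) + (1 + k) *\<^sub>R (b - p)"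
    unfolding tp' by (simp_all add: algebra_simps)
  have Nq1: "N (q - c1) \<le> r1"
    using mult_left_mono[OF c(1), of "1 + k"] r12 by (simp add: Nq)
  show False
  proof (cases "w1 \<le> k + w2")
    case True
    \<comment> \<open>Solving the formula for \<open>q\<close> for \<open>c - p\<close> gives the
      weights \<open>s\<close>, \<open>t\<close>, \<open>1 - s - t\<close> of \<open>q\<close>,
      \<open>b\<close>, \<open>p\<close> in a combination equal to \<open>c\<close>; any weight on
      \<open>p\<close> puts \<open>c\<close> strictly inside.\<close>
    define s where "s = 1 / (1 + k + w2)"
    define t where "t = s * w1"
    have s: "s > 0" "s * (1 + k + w2) = 1" using k w by (auto simp: s_def)
    have t: "t \<ge> 0" using s w by (simp add: t_def)
    have st: "s + t \<le> 1"
    proof -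
      have "s * (1 + w1) \<le> s * (1 + k + w2)" using True s by (intro mult_left_mono) auto
      then show ?thesis using s(2) by (simp add: t_def algebra_simps)
    qed
    have "s *\<^sub>R q = s *\<^sub>R p - (s * w1) *\<^sub>R (b - p) + (s * (1 + k + w2)) *\<^sub>R (c - p)"
      by (simp only: q' scaleR_add_right scaleR_diff_right[of _ p] scaleR_scaleR)
    then have "s *\<^sub>R q = s *\<^sub>R p - t *\<^sub>R (b - p) + (c - p)"
      unfolding s(2) by (simp add: t_def)
    then have cc: "c - c1 = s *\<^sub>R (q - c1) + t *\<^sub>R (b - c1) + (1 - s - t) *\<^sub>R (p - c1)"
      by (simp add: algebra_simps)
    show False
    proof (cases "s + t = 1")
      case False
      have "N (c - c1) \<le> s * N (q - c1) + t * N (b - c1) + (1 - s - t) * N (p - c1)"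
        unfolding cc using s t st by (intro comb3) auto
      also have "\<dots> \<le> s * r1 + t * r1 + (1 - s - t) * N (p - c1)"
        using Nq1 b(1) s t st by (intro add_mono mult_left_mono) auto
      also have "\<dots> < s * r1 + t * r1 + (1 - s - t) * r1"
        using p(1) st False by (intro add_strict_left_mono mult_strict_left_mono) auto
      also have "\<dots> = r1" by (simp add: algebra_simps)
      finally show False using c(2) by simp
    next
      case st1: True
      \<comment> \<open>Now \<open>c\<close> lies on the segment from \<open>q\<close> to
        \<open>b\<close> and strictness decides, unless \<open>c = q\<close>; in that case
        \<open>w1\<close>, \<open>w2\<close> and \<open>k\<close> vanish and the disks
        coincide.\<close>
      show False
      proof (cases "t = 0")
        case True
        then have "s = 1" "w1 = 0" using st1 s by (auto simp: t_def)
        then have "k = 0" "w2 = 0" using s(2) k w by auto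
        then have "r1 = r2" using k r by simp
        moreover have "c1 = c2" using w(1) \<open>w1 = 0\<close> \<open>w2 = 0\<close> \<open>r1 = r2\<close> r by simp
        ultimately show False using ne(2) by simp
      next
        case False
        have s1: "s = 1 - t" "1 - s - t = 0" using st1 by simp_all
        have ceq': "c - c1 = (1 - t) *\<^sub>R (q - c1) + t *\<^sub>R (b - c1)"
          using cc unfolding s1(2) unfolding s1(1) by simp
        have "q - c1 \<noteq> b - c1"
        proof
          assume "q - c1 = b - c1"
          then have "c - c1 = (1 - t) *\<^sub>R (b - c1) + t *\<^sub>R (b - c1)" using ceq' by simp
          also have "\<dots> = b - c1" by (simp flip: scaleR_add_left)
          finally show False using ne(1) by simp
        qed
        then have "N (c - c1) < r1"
          unfolding ceq' using Nq1 b(1) False t s st1 by (intro strict) auto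
        then show False using c(2) by simp
      qed
    qed
  next
    case False
    \<comment> \<open>\<open>tb\<close> is the combination of \<open>q\<close>, \<open>b\<close>,
      \<open>tp\<close> with weights \<open>s\<close>, \<open>t\<close>, \<open>1 - s - t\<close>.
      The last weight is positive and \<open>tp\<close> is strictly inside the first disk, whereas
      \<open>b\<close> not being strictly inside the second disk means that \<open>tb\<close> is not
      strictly inside the first.\<close>
    define t where "t = (1 + k) / (1 + w1)"
    define s where "s = w2 / (1 + w1)"
    have w1: "1 + w1 > 0" using w by simp
    have "s + t = (1 + k + w2) / (1 + w1)" by (simp add: s_def t_def add_divide_distrib)
    also have "\<dots> < 1" using w1 False by simp
    finally have st: "t \<ge> 0" "s \<ge> 0" "1 - s - t > 0" "s + t < 1"
      using k w by (simp_all add: s_def t_def)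
    have sw12: "(1 + w1) * s = w2" "(1 + w1) * t = 1 + k" using w1 by (simp_all add: s_def t_def)
    have "(1 + w1) * (1 - s - t) = (1 + w1) - (1 + w1) * s - (1 + w1) * t"
      by (simp add: algebra_simps)
    then have sw: "(1 + w1) * s = w2" "(1 + w1) * t = 1 + k" "(1 + w1) * (1 - s - t) = w1 - w2 - k"
      unfolding sw12 by simp_all
    have "(1 + w1) *\<^sub>R (tb - c1) =
        (1 + w1) *\<^sub>R (s *\<^sub>R (q - c1) + t *\<^sub>R (b - c1) + (1 - s - t) *\<^sub>R (tp - c1))"
      unfolding scaleR_add_right scaleR_scaleR sw
      by (simp add: tb' q' tp' algebra_simps)
    then have Tb: "tb - c1 = s *\<^sub>R (q - c1) + t *\<^sub>R (b - c1) + (1 - s - t) *\<^sub>R (tp - c1)"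
      using w1 by (simp only: scaleR_cancel_left) auto
    have Ntp1: "N (tp - c1) < r1"
      using mult_strict_left_mono[OF p(2) r12(1)] r12(2) by (simp add: Ntp)
    have "N (tb - c1) \<le> s * N (q - c1) + t * N (b - c1) + (1 - s - t) * N (tp - c1)"
      unfolding Tb using st by (intro comb3) auto
    also have "\<dots> \<le> s * r1 + t * r1 + (1 - s - t) * N (tp - c1)"
      using Nq1 b(1) st by (intro add_mono mult_left_mono) auto
    also have "\<dots> < s * r1 + t * r1 + (1 - s - t) * r1"
      using Ntp1 st by (intro add_strict_left_mono mult_strict_left_mono) auto
    also have "\<dots> = r1" by (simp add: algebra_simps)
    finally have "N (tb - c1) < r1" .
    moreover have "N (tb - c1) \<ge> r1"
      using mult_left_mono[OF b(2), of "1 + k"] r12 by (simp add: Ntb)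
    ultimately show False by simp
  qed
qed

definition nearest :: "(real^2) set \<Rightarrow> real^2 \<Rightarrow> (real^2) set" where
  "nearest V c = {v\<in>V. \<forall>w\<in>V. N (v - c) \<le> N (w - c)}"

lemma convex_disk_set: "convex {x. N (x - c) \<le> r}"
proof (rule convexI)
  fix x y and u v :: real
  assume h: "x \<in> {x. N (x - c) \<le> r}" "y \<in> {x. N (x - c) \<le> r}" "0 \<le> u" "0 \<le> v" "u + v = 1"
  have v: "v = 1 - u" using h(5) by simp
  have "u *\<^sub>R x + v *\<^sub>R y - c = u *\<^sub>R (x - c) + v *\<^sub>R (y - c)"
    unfolding v by (simp add: algebra_simps)
  then have "N (u *\<^sub>R x + v *\<^sub>R y - c) \<le> u * N (x - c) + v * N (y - c)"
    using comb2[OF h(3,4)] by simp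
  also have "\<dots> \<le> u * r + v * r" using h by (intro add_mono mult_left_mono) auto
  also have "u * r + v * r = r" by (simp add: v algebra_simps)
  finally show "u *\<^sub>R x + v *\<^sub>R y \<in> {x. N (x - c) \<le> r}" by simp
qed

text \<open>From an interior point one can move away from \<open>c\<close> within the hull, and this
  increases the norm strictly.\<close>

lemma interior_hull_in_disk:
  assumes "p \<in> interior (convex hull A)" "\<And>a. a \<in> A \<Longrightarrow> N (a - c) \<le> r"
  shows "N (p - c) < r" "r > 0"
proof -
  have sub: "convex hull A \<subseteq> {x. N (x - c) \<le> r}"
    using assms(2) by (intro hull_minimal convex_disk_set) auto
  obtain e where e: "e > 0" "cball p e \<subseteq> convex hull A"
    using assms(1) by (auto simp: mem_interior_cball)
  define d :: "real^2" where "d = (if p = c then e *\<^sub>R axis 1 1 else (e / norm (p - c)) *\<^sub>R (p - c))"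
  have "p + d \<in> cball p e" using e by (auto simp: d_def dist_norm)
  then have le: "N (p + d - c) \<le> r" using e(2) sub by blast
  have "N (p - c) < N (p + d - c)"
  proof (cases "p = c")
    case True
    then show ?thesis using e pos[of d] by (simp add: d_def axis_eq_0_iff)
  next
    case False
    have "p + d - c = (1 + e / norm (p - c)) *\<^sub>R (p - c)" using False by (simp add: d_def algebra_simps)
    then have "N (p + d - c) = (1 + e / norm (p - c)) * N (p - c)" using e by (simp add: hom)
    moreover have "(e / norm (p - c)) * N (p - c) > 0" using e False pos[of "p - c"] by simp
    ultimately show ?thesis by (simp add: algebra_simps)
  qed
  then show "N (p - c) < r" using le by simp
  then show "r > 0" using nonneg[of "p - c"] by linarith
qed

text \<open>The disk around a center through its nearest points has no point of \<open>V\<close>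
  strictly inside. For a common interior point \<open>p\<close>, \<open>cone_choice\<close> applied
  to \<open>p\<close> minus its image under the homothety of the two disks provides vertices that
  contradict \<open>disks_cross\<close>, unless centers and radii agree.\<close>

lemma nearest_disjoint:
  assumes fin: "finite (nearest V c1)" "finite (nearest V c2)"
    and ne: "interior (convex hull nearest V c1) \<inter> interior (convex hull nearest V c2) \<noteq> {}"
  shows "nearest V c1 = nearest V c2"
proof -
  have aux: False
    if p: "p \<in> interior (convex hull nearest V c1)" "p \<in> interior (convex hull nearest V c2)"
      and fin: "finite (nearest V c1)" "finite (nearest V c2)"
      and r: "\<And>v. v \<in> nearest V c1 \<Longrightarrow> N (v - c1) = r1" "\<And>v. v \<in> nearest V c2 \<Longrightarrow> N (v - c2) = r2" "r1 \<ge> r2"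
      and ne: "(c1, r1) \<noteq> (c2, r2)"
    for p c1 c2 r1 r2
  proof -
    have d1: "N (p - c1) < r1" using interior_hull_in_disk(1)[OF p(1), of c1 r1] r(1) by simp
    have d2: "N (p - c2) < r2" "r2 > 0"
      using interior_hull_in_disk[OF p(2), of c2 r2] r(2) by simp_all
    obtain b c w1 w2 where bc: "b \<in> nearest V c1" "c \<in> nearest V c2" "b \<noteq> c" "w1 \<ge> 0" "w2 \<ge> 0"
      and w: "p - (c1 + (r1 / r2) *\<^sub>R (p - c2)) = w1 *\<^sub>R (b - p) - w2 *\<^sub>R (c - p)"
      by (rule cone_choice[OF p(1) fin(1) p(2) fin(2), where w = "p - (c1 + (r1 / r2) *\<^sub>R (p - c2))"])
    have eq: "N (b - c1) = r1" "N (c - c2) = r2" using bc(1,2) r(1,2) by simp_all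
    have "N (c - c2) \<le> N (b - c2)" "N (b - c1) \<le> N (c - c1)"
      using bc(1,2) by (simp_all add: nearest_def)
    then have "N (b - c2) \<ge> r2" "N (c - c1) \<ge> r1" using eq by simp_all
    then show False
      using disks_cross[OF r(3) d2(2) _ _ _ _ d1 d2(1) w bc(4,5,3) ne] eq by simp
  qed
  obtain p where p: "p \<in> interior (convex hull nearest V c1)" "p \<in> interior (convex hull nearest V c2)"
    using ne by blast
  then have "nearest V c1 \<noteq> {}" "nearest V c2 \<noteq> {}" by auto
  then obtain v1 v2 where v: "v1 \<in> nearest V c1" "v2 \<in> nearest V c2" by blast
  have r1: "N (v - c1) = N (v1 - c1)" if "v \<in> nearest V c1" for v
    using that v by (auto simp: nearest_def intro: antisym)
  have r2: "N (v - c2) = N (v2 - c2)" if "v \<in> nearest V c2" for v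
    using that v by (auto simp: nearest_def intro: antisym)
  have "(c1, N (v1 - c1)) = (c2, N (v2 - c2))"
  proof (rule ccontr)
    assume n: "\<not> ?thesis"
    show False
    proof (cases "N (v1 - c1) \<ge> N (v2 - c2)")
      case True
      then show False using aux[OF p fin r1 r2] n by blast
    next
      case False
      then show False using aux[OF p(2,1) fin(2,1) r2 r1] n by force
    qed
  qed
  then show ?thesis by simp
qed

end

section \<open>Delaunay polygons cover the plane\<close>

definition loc_finite :: "(real^2) set \<Rightarrow> bool" where
  "loc_finite V \<longleftrightarrow> (\<forall>r. finite (V \<inter> cball 0 r))"

context strict_norm
begin

lemma upper_bound: "N x \<le> (N (axis 1 1) + N (axis 2 1)) * norm x"
proof -
  have "x = x $ 1 *\<^sub>R axis 1 1 + x $ 2 *\<^sub>R axis 2 1" by (simp add: vec2_eq_iff axis_def)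
  then have "N x \<le> N (x $ 1 *\<^sub>R axis 1 1) + N (x $ 2 *\<^sub>R axis 2 1)" using tri by metis
  also have "\<dots> = \<bar>x $ 1\<bar> * N (axis 1 1) + \<bar>x $ 2\<bar> * N (axis 2 1)" by (simp add: hom)
  also have "\<dots> \<le> norm x * N (axis 1 1) + norm x * N (axis 2 1)"
    by (intro add_mono mult_right_mono component_le_norm_cart nonneg)
  finally show ?thesis by (simp add: algebra_simps)
qed

lemma lipschitz: "\<bar>N x - N y\<bar> \<le> (N (axis 1 1) + N (axis 2 1)) * norm (x - y)"
  using tri[of "x - y" y] tri[of "y - x" x] upper_bound[of "x - y"] commute[of x y] by auto

lemma continuous_N: "continuous_on S N"
proof (rule continuous_on_subset[of UNIV])
  define M where "M = N (axis 1 1) + N (axis 2 1)"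
  have "N (axis 1 1) > 0" by (rule pos) (simp add: axis_eq_0_iff)
  then have M: "M > 0" unfolding M_def by (intro add_pos_nonneg) auto
  show "continuous_on UNIV N"
    unfolding continuous_on_iff
  proof (intro ballI allI impI)
    fix x and e :: real assume "e > 0"
    have "dist (N y) (N x) < e" if "dist y x < e / M" for y
      using lipschitz[of y x] that M unfolding M_def[symmetric]
      by (simp add: dist_norm field_simps)
    then show "\<exists>d>0. \<forall>x'\<in>UNIV. dist x' x < d \<longrightarrow> dist (N x') (N x) < e"
      using \<open>e > 0\<close> M by (intro exI[of _ "e / M"]) auto
  qed
qed simp

lemma continuous_on_N [continuous_intros]:
  "continuous_on S f \<Longrightarrow> continuous_on S (\<lambda>x. N (f x))"
  using continuous_on_compose2[OF continuous_N[of UNIV]] by auto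

lemma lower_bound:
  obtains m where "m > 0" "\<And>x. m * norm x \<le> N x"
proof -
  have "compact (sphere (0::real^2) 1)" "sphere (0::real^2) 1 \<noteq> {}" by auto
  then obtain z where z: "z \<in> sphere 0 1" "\<forall>y\<in>sphere 0 1. N z \<le> N y"
    using continuous_attains_inf[OF _ _ continuous_N] by blast
  show ?thesis
  proof (rule that[of "N z"])
    show "N z > 0" using z(1) by (intro pos) auto
    show "N z * norm x \<le> N x" for x
    proof (cases "x = 0")
      case False
      have "N z \<le> N ((1 / norm x) *\<^sub>R x)" using z(2) False by simp
      then show ?thesis using False by (simp add: hom field_simps)
    qed simp
  qed
qed

lemma finite_N_disk:
  assumes "loc_finite V"
  shows "finite {v\<in>V. N (v - c) \<le> r}"
proof -
  obtain m where m: "m > 0" "\<And>x. m * norm x \<le> N x" using lower_bound by blast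
  have "{v\<in>V. N (v - c) \<le> r} \<subseteq> V \<inter> cball 0 (norm c + r / m)"
  proof clarsimp
    fix v assume "N (v - c) \<le> r"
    then have "m * norm (v - c) \<le> r" using m(2) order_trans by blast
    then have "norm (v - c) \<le> r / m" using m(1) by (simp add: field_simps)
    then show "norm v \<le> norm c + r / m" using norm_triangle_sub[of v c] by simp
  qed
  then show ?thesis using assms finite_subset unfolding loc_finite_def by blast
qed

lemma nearest_nonempty:
  assumes "loc_finite V" "V \<noteq> {}"
  shows "nearest V c \<noteq> {}"
proof -
  obtain v0 where v0: "v0 \<in> V" using assms(2) by blast
  define A where "A = {v\<in>V. N (v - c) \<le> N (v0 - c)}"
  have "finite A" "A \<noteq> {}" using finite_N_disk[OF assms(1)] v0 by (auto simp: A_def)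
  then obtain v where v: "v \<in> A" "\<forall>w\<in>A. - N (w - c) \<le> - N (v - c)"
    using finite_attains_max[of A "\<lambda>v. - N (v - c)"] by blast
  have "N (v - c) \<le> N (w - c)" if "w \<in> V" for w
  proof (cases "w \<in> A")
    case True then show ?thesis using v(2) by simp
  next
    case False then show ?thesis using v(1) that by (auto simp: A_def)
  qed
  then show ?thesis using v(1) by (auto simp: nearest_def A_def)
qed

lemma finite_nearest:
  assumes "loc_finite V"
  shows "finite (nearest V c)"
proof (cases "nearest V c = {}")
  case False
  then obtain v0 where "v0 \<in> nearest V c" by blast
  then have "nearest V c \<subseteq> {v\<in>V. N (v - c) \<le> N (v0 - c)}" by (auto simp: nearest_def)
  then show ?thesis using finite_N_disk[OF assms] finite_subset by blast
qed simp

definition dist_to :: "(real^2) set \<Rightarrow> real^2 \<Rightarrow> real" where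
  "dist_to V c = (INF v\<in>V. N (v - c))"

lemma dist_to_nearest: "v \<in> nearest V c \<Longrightarrow> dist_to V c = N (v - c)"
  unfolding dist_to_def nearest_def by (intro cInf_eq_minimum) auto

lemma dist_to_le: "v \<in> V \<Longrightarrow> dist_to V c \<le> N (v - c)"
  unfolding dist_to_def by (intro cINF_lower bdd_belowI[of _ 0]) auto

lemma mem_nearest_iff:
  assumes "loc_finite V" "v \<in> V"
  shows "v \<in> nearest V c \<longleftrightarrow> N (v - c) \<le> dist_to V c"
proof
  assume "N (v - c) \<le> dist_to V c"
  then show "v \<in> nearest V c"
    using dist_to_le[of _ V c] assms(2) order_trans unfolding nearest_def by blast
qed (simp add: dist_to_nearest)

lemma dist_to_continuous:
  assumes "loc_finite V" "V \<noteq> {}"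
  shows "continuous_on S (dist_to V)"
proof (rule continuous_on_subset[of UNIV])
  define M where "M = N (axis 1 1) + N (axis 2 1)"
  have "N (axis 1 1) > 0" by (rule pos) (simp add: axis_eq_0_iff)
  then have M: "M > 0" unfolding M_def by (intro add_pos_nonneg) auto
  have le: "dist_to V c - dist_to V d \<le> M * norm (c - d)" for c d
  proof -
    obtain v where v: "v \<in> nearest V d" using nearest_nonempty[OF assms, of d] by blast
    then have "dist_to V c - dist_to V d \<le> N (v - c) - N (v - d)"
      using dist_to_le[of v V c] dist_to_nearest[OF v] by (simp add: nearest_def)
    also have "\<dots> \<le> N (c - d)" using tri3[of v c d] commute[of c d] by simp
    also have "\<dots> \<le> M * norm (c - d)" unfolding M_def by (rule upper_bound)
    finally show ?thesis .
  qed
  show "continuous_on UNIV (dist_to V)"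
    unfolding continuous_on_iff
  proof (intro ballI allI impI)
    fix x and e :: real assume "e > 0"
    have "dist (dist_to V y) (dist_to V x) < e" if "dist y x < e / M" for y
    proof -
      have "\<bar>dist_to V y - dist_to V x\<bar> \<le> M * norm (y - x)"
        using le[of x y] le[of y x] by (simp add: norm_minus_commute)
      also have "\<dots> < e" using that M by (simp add: dist_norm field_simps)
      finally show ?thesis by (simp add: dist_norm)
    qed
    then show "\<exists>d>0. \<forall>x'\<in>UNIV. dist x' x < d \<longrightarrow> dist (dist_to V x') (dist_to V x) < e"
      using \<open>e > 0\<close> M by (intro exI[of _ "e / M"]) auto
  qed
qed simp

text \<open>Brouwer's theorem is applied to \<open>c \<mapsto> c - g c + x\<close>, where \<open>g c\<close> is a continuous
  weighted mean of the points of \<open>V\<close> that are nearly closest to \<open>c\<close>.\<close>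

lemma approximate_hull:
  assumes V: "loc_finite V" and \<rho>: "\<And>c. \<exists>v\<in>V. N (v - c) \<le> \<rho>"
    and m: "m > 0" "\<And>x. m * norm x \<le> N x" and e: "0 < e" "e \<le> 1"
  obtains c where "c \<in> cball x ((\<rho> + 1) / m)"
    "x \<in> convex hull {v\<in>V. N (v - c) \<le> dist_to V c + e}"
proof -
  define R where "R = (\<rho> + 1) / m"
  have "V \<noteq> {}" using \<rho> by auto
  have d\<rho>: "dist_to V c \<le> \<rho>" for c using \<rho>[of c] dist_to_le order_trans by blast
  have "\<rho> \<ge> 0" using \<rho>[of 0] nonneg order_trans by blast
  then have R: "R \<ge> 0" using m by (simp add: R_def)
  have near: "v \<in> cball c R" if "N (v - c) \<le> \<rho> + 1" for v c
  proof -
    have "m * norm (v - c) \<le> \<rho> + 1" using m(2) that order_trans by blast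
    then show ?thesis using m(1) by (simp add: R_def dist_norm norm_minus_commute field_simps)
  qed
  define F where "F = V \<inter> cball 0 (norm x + 2 * R)"
  have F: "finite F" using V by (simp add: F_def loc_finite_def)
  have inF: "v \<in> F" if "v \<in> V" "N (v - c) \<le> \<rho> + 1" "c \<in> cball x R" for v c
  proof -
    have "norm (v - c) \<le> R" "norm (c - x) \<le> R"
      using near[OF that(2)] that(3) by (auto simp: dist_norm norm_minus_commute)
    moreover have "norm v \<le> norm (v - c) + norm (c - x) + norm x"
      using norm_triangle_ineq[of "v - c" c] norm_triangle_ineq[of "c - x" x] by simp
    ultimately show ?thesis using that(1) by (simp add: F_def)
  qed
  \<comment> \<open>Positive exactly where the distance is less than \<open>e\<close> above the
    minimum. The margin \<open>e\<close> makes the total weight at least \<open>e\<close> on the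
    ball, so that the mean \<open>g\<close> is continuous there.\<close>
  define wt where "wt c v = max 0 (dist_to V c + e - N (v - c))" for c v
  define W where "W c = (\<Sum>v\<in>F. wt c v)" for c
  define g where "g c = (1 / W c) *\<^sub>R (\<Sum>v\<in>F. wt c v *\<^sub>R v)" for c
  have wt0: "wt c v \<ge> 0" for c v by (simp add: wt_def)
  have W: "W c > 0" if c: "c \<in> cball x R" for c
  proof -
    obtain v where v: "v \<in> nearest V c" using nearest_nonempty[OF V \<open>V \<noteq> {}\<close>, of c] by blast
    have "N (v - c) = dist_to V c" using dist_to_nearest[OF v] by simp
    then have "v \<in> F" "wt c v = e"
      using inF[of v c] v c d\<rho>[of c] e by (auto simp: nearest_def wt_def)
    then have "e \<le> W c" unfolding W_def using member_le_sum[of v F "wt c"] F wt0 by simp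
    then show ?thesis using e by simp
  qed
  have gh: "g c \<in> convex hull {v\<in>F. wt c v > 0}" if c: "c \<in> cball x R" for c
  proof -
    let ?S = "{v\<in>F. wt c v > 0}"
    have z: "wt c v = 0" if "v \<in> F - ?S" for v using that wt0[of c v] by auto
    have "g c = (\<Sum>v\<in>F. (wt c v / W c) *\<^sub>R v)" by (simp add: g_def scaleR_sum_right)
    also have "\<dots> = (\<Sum>v\<in>?S. (wt c v / W c) *\<^sub>R v)"
      using F z by (intro sum.mono_neutral_right) auto
    also have "\<dots> \<in> convex hull ?S"
    proof (rule convex_sum)
      have "(\<Sum>v\<in>?S. wt c v / W c) = (\<Sum>v\<in>F. wt c v / W c)"
        using F z by (intro sum.mono_neutral_left) auto
      also have "\<dots> = 1" using W[OF c] by (simp add: W_def flip: sum_divide_distrib)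
      finally show "(\<Sum>v\<in>?S. wt c v / W c) = 1" .
    qed (use F W[OF c] wt0 in \<open>auto simp: hull_inc\<close>)
    finally show ?thesis .
  qed
  have gd: "g c \<in> cball c R" if c: "c \<in> cball x R" for c
  proof -
    have "{v\<in>F. wt c v > 0} \<subseteq> cball c R"
      using d\<rho>[of c] e by (auto simp: wt_def simp del: mem_cball intro!: near)
    then have "convex hull {v\<in>F. wt c v > 0} \<subseteq> cball c R" by (intro hull_minimal convex_cball)
    then show ?thesis using gh[OF c] by blast
  qed
  have "continuous_on (cball x R) W"
    unfolding W_def wt_def using dist_to_continuous[OF V \<open>V \<noteq> {}\<close>] by (intro continuous_intros) auto
  then have "continuous_on (cball x R) g"
    unfolding g_def wt_def using dist_to_continuous[OF V \<open>V \<noteq> {}\<close>] W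
    by (intro continuous_intros) (auto simp: less_imp_neq[symmetric])
  then have cont: "continuous_on (cball x R) (\<lambda>c. c - g c + x)" by (intro continuous_intros)
  \<comment> \<open>The value differs from \<open>x\<close> by \<open>c - g c\<close>, and all
    points with positive weight are within \<open>R\<close> of \<open>c\<close>.\<close>
  have maps: "(\<lambda>c. c - g c + x) \<in> cball x R \<rightarrow> cball x R"
    using gd by (auto simp: dist_norm norm_minus_commute)
  obtain c where c: "c \<in> cball x R" "c - g c + x = c"
    using brouwer[OF compact_cball convex_cball _ cont maps] R by auto
  have "g c = x" using c(2) by (simp add: algebra_simps)
  then have "x \<in> convex hull {v\<in>F. wt c v > 0}" using gh[OF c(1)] by simp
  moreover have "{v\<in>F. wt c v > 0} \<subseteq> {v\<in>V. N (v - c) \<le> dist_to V c + e}"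
    by (auto simp: F_def wt_def)
  ultimately show ?thesis using that[of c] c(1) hull_mono unfolding R_def by blast
qed

text \<open>Approximate hulls are taken for errors tending to 0. Their centers accumulate at some
  \<open>l\<close>, and only the finite set \<open>F\<close> can contribute; every point of
  \<open>F\<close> that is not nearest to \<open>l\<close> is dropped eventually, so one of the
  hulls is generated by points of \<open>nearest V l\<close>.\<close>

lemma hull_nearest_cover:
  assumes V: "loc_finite V" and \<rho>: "\<And>c. \<exists>v\<in>V. N (v - c) \<le> \<rho>"
  obtains c where "x \<in> convex hull (nearest V c)"
proof -
  obtain m where m: "m > 0" "\<And>x. m * norm x \<le> N x" using lower_bound by blast
  have "V \<noteq> {}" using \<rho> by auto
  define R where "R = (\<rho> + 1) / m"
  define e where "e n = 1 / real (Suc n)" for n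
  have e: "0 < e n" "e n \<le> 1" for n by (auto simp: e_def)
  have "\<exists>c. c \<in> cball x R \<and> x \<in> convex hull {v\<in>V. N (v - c) \<le> dist_to V c + e n}" for n
  proof (rule approximate_hull[OF V \<rho> m e[of n], of x])
    fix c assume "c \<in> cball x ((\<rho> + 1) / m)" "x \<in> convex hull {v\<in>V. N (v - c) \<le> dist_to V c + e n}"
    then show ?thesis unfolding R_def by blast
  qed
  then have "\<exists>c. \<forall>n. c n \<in> cball x R \<and> x \<in> convex hull {v\<in>V. N (v - c n) \<le> dist_to V (c n) + e n}"
    by (intro choice allI)
  then obtain c where c: "\<And>n. c n \<in> cball x R"
    "\<And>n. x \<in> convex hull {v\<in>V. N (v - c n) \<le> dist_to V (c n) + e n}" by blast
  obtain l k where l: "l \<in> cball x R" "strict_mono (k :: nat \<Rightarrow> nat)" "(c \<circ> k) \<longlonglongrightarrow> l"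
    using compact_cball[of x R] c(1) unfolding compact_def by blast
  have \<rho>0: "dist_to V c \<le> \<rho>" for c using \<rho>[of c] dist_to_le order_trans by blast
  define F where "F = {v\<in>V. N (v - x) \<le> \<rho> + 1 + (N (axis 1 1) + N (axis 2 1)) * R}"
  have F: "finite F" unfolding F_def by (rule finite_N_disk[OF V])
  have sub: "{v\<in>V. N (v - c n) \<le> dist_to V (c n) + e n} \<subseteq> F" for n
  proof clarsimp
    fix v assume v: "v \<in> V" "N (v - c n) \<le> dist_to V (c n) + e n"
    have "N (v - x) \<le> N (v - c n) + N (c n - x)" by (rule tri3)
    also have "\<dots> \<le> (\<rho> + 1) + (N (axis 1 1) + N (axis 2 1)) * norm (c n - x)"
      using v(2) \<rho>0[of "c n"] e(2)[of n] upper_bound[of "c n - x"] by simp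
    also have "\<dots> \<le> (\<rho> + 1) + (N (axis 1 1) + N (axis 2 1)) * R"
      using c(1)[of n] by (intro add_left_mono mult_left_mono) (auto simp: dist_norm norm_minus_commute)
    finally show "v \<in> F" using v(1) by (simp add: F_def)
  qed
  have ev: "eventually (\<lambda>n. N (v - c (k n)) > dist_to V (c (k n)) + e (k n)) sequentially"
    if v: "v \<in> F - nearest V l" for v
  proof -
    have gt: "N (v - l) - dist_to V l - 0 > 0" using v mem_nearest_iff[OF V, of v l] by (auto simp: F_def)
    have "(\<lambda>n. e (k n)) \<longlonglongrightarrow> 0"
      using LIMSEQ_subseq_LIMSEQ[OF LIMSEQ_Suc[OF lim_1_over_n] l(2)] by (simp add: e_def o_def)
    moreover have "(\<lambda>n. dist_to V (c (k n))) \<longlonglongrightarrow> dist_to V l"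
      using continuous_on_tendsto_compose[OF dist_to_continuous[OF V \<open>V \<noteq> {}\<close>, of UNIV] l(3)] by simp
    moreover have "(\<lambda>n. N (v - c (k n))) \<longlonglongrightarrow> N (v - l)"
      using continuous_on_tendsto_compose[OF continuous_N[of UNIV], of "\<lambda>n. v - c (k n)" "v - l"] l(3)
      by (simp add: o_def tendsto_diff)
    ultimately have "(\<lambda>n. N (v - c (k n)) - dist_to V (c (k n)) - e (k n)) \<longlonglongrightarrow> N (v - l) - dist_to V l - 0"
      by (intro tendsto_diff)
    from order_tendstoD(1)[OF this gt] show ?thesis by eventually_elim simp
  qed
  have "eventually (\<lambda>n. \<forall>v\<in>F - nearest V l. N (v - c (k n)) > dist_to V (c (k n)) + e (k n)) sequentially"
    using F ev by (intro eventually_ball_finite) auto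
  then obtain n where n: "\<forall>v\<in>F - nearest V l. N (v - c (k n)) > dist_to V (c (k n)) + e (k n)"
    by (auto dest: eventually_happens)
  have "{v\<in>V. N (v - c (k n)) \<le> dist_to V (c (k n)) + e (k n)} \<subseteq> nearest V l"
  proof
    fix v assume v: "v \<in> {v\<in>V. N (v - c (k n)) \<le> dist_to V (c (k n)) + e (k n)}"
    then have "v \<in> F" "\<not> N (v - c (k n)) > dist_to V (c (k n)) + e (k n)" using sub by auto
    then show "v \<in> nearest V l" using n by blast
  qed
  then have "x \<in> convex hull (nearest V l)" using c(2)[of "k n"] hull_mono by blast
  then show ?thesis by (rule that)
qed

end

section \<open>Triangulations of Delaunay polygons\<close>

text \<open>Only countably many slopes put two points of a countable set on the same level. A
  generic direction gives every polygon a unique first and a unique last vertex.\<close>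

lemma generic_direction:
  assumes "loc_finite V"
  obtains u where "u \<noteq> 0" "inj_on (\<lambda>v. u \<bullet> v) V"
proof -
  have "V \<subseteq> (\<Union>n::nat. V \<inter> cball 0 (real n))"
  proof
    fix v assume "v \<in> V"
    moreover obtain n :: nat where "norm v \<le> real n" using real_arch_simple by blast
    ultimately show "v \<in> (\<Union>n::nat. V \<inter> cball 0 (real n))" by auto
  qed
  moreover have "countable (\<Union>n::nat. V \<inter> cball 0 (real n))"
    using assms by (intro countable_UN) (simp_all add: loc_finite_def countable_finite)
  ultimately have V: "countable V" by (rule countable_subset)
  define B where "B = (\<lambda>(v, w). - (v - w) $ 1 / (v - w) $ 2) ` (V \<times> V)"
  have "countable B" unfolding B_def by (intro countable_image countable_SIGMA V)
  then have "B \<noteq> UNIV" using uncountable_UNIV_real by blast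
  then obtain e where e: "e \<notin> B" by blast
  define u :: "real^2" where "u = vector [1, e]"
  have "inj_on (\<lambda>v. u \<bullet> v) V"
  proof (rule inj_onI)
    fix v w assume vw: "v \<in> V" "w \<in> V" "u \<bullet> v = u \<bullet> w"
    then have 0: "(v - w) $ 1 + e * (v - w) $ 2 = 0" by (simp add: u_def inner_vec2 algebra_simps)
    have "(v - w) $ 2 = 0"
    proof (rule ccontr)
      assume "(v - w) $ 2 \<noteq> 0"
      then have "e = - (v - w) $ 1 / (v - w) $ 2" using 0 by (simp add: field_simps)
      then have "e \<in> B" unfolding B_def using vw by (intro image_eqI[of _ _ "(v, w)"]) simp_all
      then show False using e by simp
    qed
    then show "v = w" using 0 by (simp add: vec2_eq_iff)
  qed
  moreover have "u \<noteq> 0" by (simp add: u_def vec2_eq_iff)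
  ultimately show ?thesis using that by blast
qed

text \<open>The tangent points of \<open>A\<close> as seen from \<open>w\<close>. A separating
  functional \<open>g\<close> is positive on all \<open>x - w\<close>, so \<open>h\<close> measures
  their slopes, and the points of smallest and largest slope span a cone containing all the
  others.\<close>

lemma cone_hull:
  fixes A :: "(real^2) set"
  assumes "finite A" "A \<noteq> {}" "w \<notin> convex hull A"
  obtains s t where "s \<in> A" "t \<in> A"
    "\<forall>x\<in>A. \<exists>a b. a \<ge> 0 \<and> b \<ge> 0 \<and> x - w = a *\<^sub>R (s - w) + b *\<^sub>R (t - w)"
proof -
  have "closed (convex hull A)" using assms(1) by (simp add: finite_imp_compact_convex_hull compact_imp_closed)
  then obtain g d where g: "g \<bullet> w < d" "\<forall>x\<in>convex hull A. d < g \<bullet> x"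
    using separating_hyperplane_closed_point[of "convex hull A" w] assms(3) convex_convex_hull by blast
  have gp: "g \<bullet> (x - w) > 0" if "x \<in> A" for x
    using g that hull_inc[of x A convex] by (fastforce simp: inner_diff_right)
  then have "g \<noteq> 0" using assms(2) by auto
  define h where "h x = cross g (x - w) / (g \<bullet> (x - w))" for x
  obtain s where s: "s \<in> A" "\<forall>z\<in>A. - h z \<le> - h s" using finite_attains_max[OF assms(1,2), of "\<lambda>x. - h x"] by blast
  obtain t where t: "t \<in> A" "\<forall>z\<in>A. h z \<le> h t" using finite_attains_max[OF assms(1,2), of h] by blast
  have eq0: "y = 0" if "g \<bullet> y = 0" "cross g y = 0" for y
    using rot_expand[of g y] that \<open>g \<noteq> 0\<close> by simp
  show ?thesis
  proof (rule that[OF s(1) t(1)], rule ballI)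
    fix x assume x: "x \<in> A"
    have "h s \<le> h x" "h x \<le> h t" using s(2) t(2) x by auto
    then obtain \<theta> where \<theta>: "0 \<le> \<theta>" "\<theta> \<le> 1" "h x = (1 - \<theta>) * h s + \<theta> * h t"
    proof (cases "h s = h t")
      case True
      then show ?thesis using that[of 0] \<open>h s \<le> h x\<close> \<open>h x \<le> h t\<close> by simp
    next
      case False
      then have pos: "h t - h s > 0" using \<open>h s \<le> h x\<close> \<open>h x \<le> h t\<close> by simp
      define q where "q = (h x - h s) / (h t - h s)"
      have "q * (h t - h s) = h x - h s" using pos by (simp add: q_def)
      moreover have "0 \<le> q" "q \<le> 1" using pos \<open>h s \<le> h x\<close> \<open>h x \<le> h t\<close> by (simp_all add: q_def)
      ultimately show ?thesis using that[of q] by (simp add: algebra_simps)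
    qed
    define gx where "gx = g \<bullet> (x - w)"
    define gs where "gs = g \<bullet> (s - w)"
    define gt where "gt = g \<bullet> (t - w)"
    have g0: "gx > 0" "gs > 0" "gt > 0" using gp x s(1) t(1) by (auto simp: gx_def gs_def gt_def)
    have cr: "cross g (x - w) = h x * gx" "cross g (s - w) = h s * gs" "cross g (t - w) = h t * gt"
      using g0 by (simp_all add: h_def gx_def gs_def gt_def)
    let ?a = "(1 - \<theta>) * gx / gs" and ?b = "\<theta> * gx / gt"
    have e: "?a * gs = (1 - \<theta>) * gx" "?b * gt = \<theta> * gx" using g0 by simp_all
    have "x - w - (?a *\<^sub>R (s - w) + ?b *\<^sub>R (t - w)) = 0"
    proof (rule eq0)
      have "g \<bullet> (x - w - (?a *\<^sub>R (s - w) + ?b *\<^sub>R (t - w))) = gx - (?a * gs + ?b * gt)"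
        unfolding gx_def gs_def gt_def by (simp only: inner_diff_right inner_add_right inner_scaleR_right)
      also have "\<dots> = 0" unfolding e by (simp add: algebra_simps)
      finally show "g \<bullet> (x - w - (?a *\<^sub>R (s - w) + ?b *\<^sub>R (t - w))) = 0" .
      have "cross g (x - w - (?a *\<^sub>R (s - w) + ?b *\<^sub>R (t - w))) =
          cross g (x - w) - (?a * cross g (s - w) + ?b * cross g (t - w))"
        by (simp only: cross_simps(4)[of g "x - w"] cross_simps(2) cross_simps(6))
      also have "\<dots> = h x * gx - (h s * (?a * gs) + h t * (?b * gt))"
        unfolding cr by (simp add: mult_ac)
      also have "\<dots> = 0" unfolding e \<theta>(3) by (simp add: algebra_simps)
      finally show "cross g (x - w - (?a *\<^sub>R (s - w) + ?b *\<^sub>R (t - w))) = 0" .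
    qed
    then have "x - w = ?a *\<^sub>R (s - w) + ?b *\<^sub>R (t - w)" by simp
    moreover have "?a \<ge> 0" "?b \<ge> 0" using \<theta> g0 by simp_all
    ultimately show "\<exists>a b. a \<ge> 0 \<and> b \<ge> 0 \<and> x - w = a *\<^sub>R (s - w) + b *\<^sub>R (t - w)" by blast
  qed
qed

text \<open>With \<open>k = 0\<close> this is a full cone with apex \<open>w\<close>, with
  \<open>k = 1\<close> its part beyond the segment between \<open>w + s\<close> and
  \<open>w + t\<close>; both are used.\<close>

lemma convex_cone_shift:
  fixes s t w :: "'a::real_vector"
  shows "convex {x. \<exists>a b. a \<ge> 0 \<and> b \<ge> 0 \<and> a + b \<ge> k \<and> x - w = a *\<^sub>R s + b *\<^sub>R t}"
proof (rule convexI)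
  fix x y and p q :: real
  assume x: "x \<in> {x. \<exists>a b. a \<ge> 0 \<and> b \<ge> 0 \<and> a + b \<ge> k \<and> x - w = a *\<^sub>R s + b *\<^sub>R t}"
    and y: "y \<in> {x. \<exists>a b. a \<ge> 0 \<and> b \<ge> 0 \<and> a + b \<ge> k \<and> x - w = a *\<^sub>R s + b *\<^sub>R t}"
    and pq: "0 \<le> p" "0 \<le> q" "p + q = 1"
  obtain a b where ab: "a \<ge> 0" "b \<ge> 0" "a + b \<ge> k" "x - w = a *\<^sub>R s + b *\<^sub>R t" using x by blast
  obtain a' b' where ab': "a' \<ge> 0" "b' \<ge> 0" "a' + b' \<ge> k" "y - w = a' *\<^sub>R s + b' *\<^sub>R t" using y by blast
  have p: "p = 1 - q" using pq by simp
  have "p *\<^sub>R x + q *\<^sub>R y - w = p *\<^sub>R (x - w) + q *\<^sub>R (y - w)"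
    unfolding p by (simp add: algebra_simps)
  also have "\<dots> = (p * a + q * a') *\<^sub>R s + (p * b + q * b') *\<^sub>R t"
    unfolding ab(4) ab'(4) by (simp add: algebra_simps)
  finally have e: "p *\<^sub>R x + q *\<^sub>R y - w = (p * a + q * a') *\<^sub>R s + (p * b + q * b') *\<^sub>R t" .
  have "p * k + q * k \<le> p * (a + b) + q * (a' + b')"
    using pq ab ab' by (intro add_mono mult_left_mono) auto
  moreover have "p * k + q * k = k" unfolding p by (simp add: algebra_simps)
  ultimately have "k \<le> (p * a + q * a') + (p * b + q * b')" by (simp add: algebra_simps)
  then show "p *\<^sub>R x + q *\<^sub>R y \<in> {x. \<exists>a b. a \<ge> 0 \<and> b \<ge> 0 \<and> a + b \<ge> k \<and> x - w = a *\<^sub>R s + b *\<^sub>R t}"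
    using e pq ab(1,2) ab'(1,2) by (intro CollectI exI[of _ "p * a + q * a'"] exI[of _ "p * b + q * b'"]) auto
qed

lemma mem_triangle:
  fixes w :: "'a::real_vector"
  assumes "a \<ge> 0" "b \<ge> 0" "a + b \<le> 1" "x - w = a *\<^sub>R (s - w) + b *\<^sub>R (t - w)"
  shows "x \<in> convex hull {w, s, t}"
proof -
  have "x = (1 - a - b) *\<^sub>R w + a *\<^sub>R s + b *\<^sub>R t" using assms(4) by (simp add: algebra_simps)
  then show ?thesis
    unfolding convex_hull_3 using assms(1-3)
    by (intro CollectI exI[of _ "1 - a - b"] exI[of _ a] exI[of _ b]) auto
qed

text \<open>The segment from \<open>w\<close> to a point \<open>y\<close> of the old hull first runs
  in the triangle; once past the segment from \<open>s\<close> to \<open>t\<close>, it stays between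
  two points of the hull of \<open>A\<close>.\<close>

lemma hull_insert_ear:
  fixes w :: "real^2"
  assumes "w \<notin> convex hull A" "s \<in> A" "t \<in> A"
    and cone: "\<forall>x\<in>A. \<exists>a b. a \<ge> 0 \<and> b \<ge> 0 \<and> x - w = a *\<^sub>R (s - w) + b *\<^sub>R (t - w)"
  shows "convex hull (insert w A) \<subseteq> convex hull A \<union> convex hull {w, s, t}"
proof
  fix z assume "z \<in> convex hull (insert w A)"
  then obtain l m y where z: "l \<ge> 0" "m \<ge> 0" "l + m = 1" "y \<in> convex hull A" "z = l *\<^sub>R w + m *\<^sub>R y"
    using convex_hull_insert[of A w] assms(2) by auto
  have l: "l = 1 - m" using z by simp
  have zw: "z - w = m *\<^sub>R (y - w)" unfolding z(5) l by (simp add: algebra_simps)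
  have "A \<subseteq> {x. \<exists>a b. a \<ge> 0 \<and> b \<ge> 0 \<and> a + b \<ge> (0::real) \<and> x - w = a *\<^sub>R (s - w) + b *\<^sub>R (t - w)}"
  proof
    fix x assume "x \<in> A"
    from cone[rule_format, OF this] obtain a b where "a \<ge> 0" "b \<ge> 0" "x - w = a *\<^sub>R (s - w) + b *\<^sub>R (t - w)" by blast
    then show "x \<in> {x. \<exists>a b. a \<ge> 0 \<and> b \<ge> 0 \<and> a + b \<ge> (0::real) \<and> x - w = a *\<^sub>R (s - w) + b *\<^sub>R (t - w)}"
      by (intro CollectI exI[of _ a] exI[of _ b]) auto
  qed
  then have "convex hull A \<subseteq> {x. \<exists>a b. a \<ge> 0 \<and> b \<ge> 0 \<and> a + b \<ge> (0::real) \<and> x - w = a *\<^sub>R (s - w) + b *\<^sub>R (t - w)}"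
    by (intro hull_minimal convex_cone_shift)
  then obtain a b where ab: "a \<ge> 0" "b \<ge> 0" "y - w = a *\<^sub>R (s - w) + b *\<^sub>R (t - w)" using z(4) by blast
  have ne: "a + b > 0"
  proof (rule ccontr)
    assume "\<not> a + b > 0"
    then have "a = 0" "b = 0" using ab by auto
    then have "y = w" using ab(3) by simp
    then show False using z(4) assms(1) by simp
  qed
  show "z \<in> convex hull A \<union> convex hull {w, s, t}"
  proof (cases "m * (a + b) \<le> 1")
    case True
    have "z - w = (m * a) *\<^sub>R (s - w) + (m * b) *\<^sub>R (t - w)" unfolding zw ab(3) by (simp add: scaleR_add_right)
    then have "z \<in> convex hull {w, s, t}"
      using True z ab by (intro mem_triangle[of "m * a" "m * b"]) (auto simp: distrib_left)
    then show ?thesis by blast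
  next
    case False
    \<comment> \<open>The parameter at which the ray from \<open>w\<close> through \<open>y\<close>
      meets the segment from \<open>s\<close> to \<open>t\<close>.\<close>
    define k where "k = 1 / (a + b)"
    have "1 < m * (a + b)" using False by simp
    then have k: "k > 0" "k < m" "k * (a + b) = 1"
      using ne by (simp_all add: k_def pos_divide_less_eq)
    then have "k * a + k * b = 1" by (simp add: distrib_left)
    note k = k this
    define p where "p = (k * a) *\<^sub>R s + (k * b) *\<^sub>R t"
    have "p \<in> convex hull A"
      unfolding p_def using k ab assms(2,3)
      by (intro convexD[OF convex_convex_hull]) (auto simp: hull_inc)
    have pw: "p - w = k *\<^sub>R (y - w)"
    proof -
      have "k *\<^sub>R (y - w) = p - (k * a + k * b) *\<^sub>R w"
        unfolding ab(3) p_def by (simp add: algebra_simps)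
      then show ?thesis unfolding k(4) by simp
    qed
    define q where "q = (m - k) / (1 - k)"
    have k1: "1 - k > 0" using k z by linarith
    have q: "0 \<le> q" "q \<le> 1" "q * (1 - k) = m - k" using k1 k z by (simp_all add: q_def)
    have "(1 - q) *\<^sub>R p + q *\<^sub>R y = w + (1 - q) *\<^sub>R (p - w) + q *\<^sub>R (y - w)" by (simp add: algebra_simps)
    also have "\<dots> = w + (k + q * (1 - k)) *\<^sub>R (y - w)" unfolding pw by (simp add: algebra_simps)
    also have "\<dots> = z" unfolding q(3) using zw by (simp add: algebra_simps)
    finally have "z = (1 - q) *\<^sub>R p + q *\<^sub>R y" ..
    then have "z \<in> convex hull A"
      using q \<open>p \<in> convex hull A\<close> z(4) by (auto intro!: convexD[OF convex_convex_hull])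
    then show ?thesis by blast
  qed
qed

lemma lmeasurable_hull: "finite A \<Longrightarrow> convex hull A \<in> lmeasurable" for A :: "(real^2) set"
  by (simp add: finite_imp_compact_convex_hull lmeasurable_compact)

text \<open>Points are removed one at a time, each costing at most one triangle; a point in the hull
  of the others costs nothing.\<close>

lemma area_hull_le:
  fixes W :: "(real^2) set" and T :: real
  assumes "finite W" "card W \<ge> 2" "T \<ge> 0"
    and "\<And>a b c. a \<in> W \<Longrightarrow> b \<in> W \<Longrightarrow> c \<in> W \<Longrightarrow> area (convex hull {a, b, c}) \<le> T"
  shows "area (convex hull W) \<le> (card W - 2) * T"
  using assms
proof (induction "card W" arbitrary: W rule: less_induct)
  case less
  show ?case
  proof (cases "card W = 2")
    case True
    then obtain a b where "W = {a, b}" by (meson card_2_iff)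
    then have "area (convex hull W) = area (convex hull {a, b, b})" by simp
    also have "\<dots> = 0" unfolding area_triangle by (simp add: cross_simps)
    finally show ?thesis using True by simp
  next
    case False
    then have c3: "card W \<ge> 3" using less.prems by simp
    then obtain w where w: "w \<in> W" by fastforce
    define A where "A = W - {w}"
    have A: "finite A" "card A = card W - 1" "A \<subseteq> W" "W = insert w A"
      using less.prems(1) w c3 by (auto simp: A_def)
    then have "A \<noteq> {}" using c3 by auto
    note A = A this
    have IH: "area (convex hull A) \<le> (card A - 2) * T"
      using less.hyps[of A] A c3 less.prems(3,4) by auto
    have "area (convex hull W) \<le> area (convex hull A) + T"
    proof (cases "w \<in> convex hull A")
      case True
      then have "convex hull W = convex hull A" unfolding A(4) by (rule hull_redundant)
      then show ?thesis using less.prems(3) by simp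
    next
      case False
      obtain s t where st: "s \<in> A" "t \<in> A"
        "\<forall>x\<in>A. \<exists>a b. a \<ge> 0 \<and> b \<ge> 0 \<and> x - w = a *\<^sub>R (s - w) + b *\<^sub>R (t - w)"
        by (rule cone_hull[OF A(1,5) False])
      have m: "convex hull A \<in> lmeasurable" "convex hull {w, s, t} \<in> lmeasurable"
        using A(1) by (auto intro: lmeasurable_hull)
      have "area (convex hull W) \<le> area (convex hull A \<union> convex hull {w, s, t})"
        unfolding A(4) using hull_insert_ear[OF False st] m lmeasurable_hull[of "insert w A"] A(1)
        by (intro measure_mono_fmeasurable) (auto intro: fmeasurableD)
      also have "\<dots> \<le> area (convex hull A) + area (convex hull {w, s, t})"
        using m by (intro measure_Un_le) (auto intro: fmeasurableD)
      also have "\<dots> \<le> area (convex hull A) + T"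
        using less.prems(4)[of w s t] w st A(3) by auto
      finally show ?thesis .
    qed
    moreover have "real (card W - 2) = real (card A - 2) + 1" using A(2) c3 by simp
    ultimately show ?thesis using IH by (simp add: distrib_right)
  qed
qed

context strict_norm
begin

text \<open>By strictness, \<open>A\<close> together with the open disk is convex, because the inner
  points of chords are in the open disk. Hence points on a circle are in convex position.\<close>

lemma hull_on_circle:
  assumes "\<And>x. x \<in> A \<Longrightarrow> N (x - c) \<le> r"
  shows "convex hull A \<subseteq> A \<union> {x. N (x - c) < r}"
proof (rule hull_minimal)
  show "convex (A \<union> {x. N (x - c) < r})"
    unfolding convex_alt
  proof (intro ballI allI impI)
    fix x y and u :: real
    assume x: "x \<in> A \<union> {x. N (x - c) < r}" and y: "y \<in> A \<union> {x. N (x - c) < r}" and u: "0 \<le> u \<and> u \<le> 1"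
    have le: "N (x - c) \<le> r" "N (y - c) \<le> r" using x y assms by force+
    consider "x = y" | "u = 0" | "u = 1" | "x \<noteq> y" "0 < u" "u < 1" using u by linarith
    then show "(1 - u) *\<^sub>R x + u *\<^sub>R y \<in> A \<union> {x. N (x - c) < r}"
    proof cases
      case 1
      have "(1 - u) *\<^sub>R x + u *\<^sub>R y = x" unfolding 1 by (simp add: algebra_simps)
      then show ?thesis using x by simp
    next
      case 4
      then have "N ((1 - u) *\<^sub>R (x - c) + u *\<^sub>R (y - c)) < r" using le by (intro strict) auto
      also have "(1 - u) *\<^sub>R (x - c) + u *\<^sub>R (y - c) = (1 - u) *\<^sub>R x + u *\<^sub>R y - c" by (simp add: algebra_simps)
      finally show ?thesis by simp
    qed (use x y in auto)
  qed
qed simp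

text \<open>Points on a circle are in convex position, so the triangle \<open>w, s, t\<close> cut
  off at \<open>w\<close> meets the hull of the rest only in a line, and areas add up.\<close>

lemma area_hull_ge:
  fixes T :: real
  assumes "finite W" "card W \<ge> 2" "T > 0" and circ: "\<And>x. x \<in> W \<Longrightarrow> N (x - c) = r"
    and "\<And>x y z. x \<in> W \<Longrightarrow> y \<in> W \<Longrightarrow> z \<in> W \<Longrightarrow> x \<noteq> y \<Longrightarrow> x \<noteq> z \<Longrightarrow> y \<noteq> z \<Longrightarrow>
      area (convex hull {x, y, z}) \<ge> T"
  shows "(card W - 2) * T \<le> area (convex hull W)"
  using assms
proof (induction "card W" arbitrary: W rule: less_induct)
  case less
  show ?case
  proof (cases "card W = 2")
    case False
    then have c3: "card W \<ge> 3" using less.prems by simp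
    then obtain w where w: "w \<in> W" by fastforce
    define A where "A = W - {w}"
    have A: "finite A" "card A = card W - 1" "A \<subseteq> W" "W = insert w A" "w \<notin> A"
      using less.prems(1) w c3 by (auto simp: A_def)
    then have "A \<noteq> {}" using c3 by auto
    note A = A this
    have IH: "(card A - 2) * T \<le> area (convex hull A)"
    proof (rule less.hyps)
      show "card A < card W" "finite A" "2 \<le> card A" using A(1,2) c3 by simp_all
      show "0 < T" by (rule less.prems(3))
      show "N (x - c) = r" if "x \<in> A" for x using less.prems(4) that A(3) by blast
      show "T \<le> area (convex hull {x, y, z})"
        if "x \<in> A" "y \<in> A" "z \<in> A" "x \<noteq> y" "x \<noteq> z" "y \<noteq> z" for x y z
        using less.prems(5)[of x y z] that A(3) by blast
    qed
    have mem: "x \<in> B" if "x \<in> W" "B \<subseteq> W" "x \<in> convex hull B" for x B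
    proof -
      have "B \<subseteq> W" by (rule that(2))
      then have "convex hull B \<subseteq> B \<union> {x. N (x - c) < r}"
        using less.prems(4) by (intro hull_on_circle) auto
      then show ?thesis using that less.prems(4)[OF that(1)] by auto
    qed
    have False': "w \<notin> convex hull A" using mem[OF w A(3)] A(5) by blast
    obtain s t where st: "s \<in> A" "t \<in> A"
      "\<forall>x\<in>A. \<exists>a b. a \<ge> 0 \<and> b \<ge> 0 \<and> x - w = a *\<^sub>R (s - w) + b *\<^sub>R (t - w)"
      by (rule cone_hull[OF A(1,6) False'])
    \<comment> \<open>By convex position no other point of \<open>A\<close> is in the triangle
      \<open>w, s, t\<close>; so none lies on the near side of the line through \<open>s\<close> and
      \<open>t\<close>.\<close>
    have far: "\<exists>a b. a \<ge> 0 \<and> b \<ge> 0 \<and> a + b \<ge> 1 \<and> x - w = a *\<^sub>R (s - w) + b *\<^sub>R (t - w)" if x: "x \<in> A" for x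
    proof -
      consider "x = s" | "x = t" | "x \<noteq> s" "x \<noteq> t" by blast
      then show ?thesis
      proof cases
        case 1
        then show ?thesis by (intro exI[of _ 1] exI[of _ 0]) simp
      next
        case 2
        then show ?thesis by (intro exI[of _ 0] exI[of _ 1]) simp
      next
        case 3
        obtain a b where ab: "a \<ge> 0" "b \<ge> 0" "x - w = a *\<^sub>R (s - w) + b *\<^sub>R (t - w)" using st(3) x by blast
        have "\<not> a + b < 1"
        proof
          assume "a + b < 1"
          then have "x \<in> convex hull {w, s, t}" using mem_triangle[OF ab(1,2) _ ab(3)] by simp
          moreover have "x \<in> W" "{w, s, t} \<subseteq> W" using x w st(1,2) A(3) by auto
          ultimately have "x \<in> {w, s, t}" using mem by blast
          then show False using 3 x A(5) by auto
        qed
        then show ?thesis using ab by (intro exI[of _ a] exI[of _ b]) simp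
      qed
    qed
    have "s \<noteq> t"
    proof
      assume eq: "s = t"
      have "A \<noteq> {s}" using A(2) c3 by auto
      then obtain x where x: "x \<in> A" "x \<noteq> s" using A(6) by blast
      obtain a b where ab: "a \<ge> 0" "b \<ge> 0" "a + b \<ge> 1" "x - w = a *\<^sub>R (s - w) + b *\<^sub>R (t - w)" using far[OF x(1)] by blast
      have "x - w = (a + b) *\<^sub>R (s - w)" unfolding ab(4) eq by (simp add: scaleR_add_left)
      then have "s - w = (1 / (a + b)) *\<^sub>R (x - w) + 0 *\<^sub>R (x - w)" using ab(3) by simp
      moreover have "0 \<le> 1 / (a + b)" "1 / (a + b) + 0 \<le> 1" using ab(3) by simp_all
      ultimately have "s \<in> convex hull {w, x, x}" by (intro mem_triangle[of "1 / (a + b)" 0]) simp_all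
      moreover have "s \<in> W" "{w, x, x} \<subseteq> W" using x w st(1,2) A(3) by auto
      ultimately have "s \<in> {w, x, x}" using mem by blast
      then show False using x st(1) A(5) by auto
    qed
    then have tri: "area (convex hull {w, s, t}) \<ge> T"
      using less.prems(5)[of w s t] w st(1,2) A(3,5) by blast
    then have cr: "cross (s - w) (t - w) \<noteq> 0" using less.prems(3) by (auto simp: area_triangle)
    \<comment> \<open>Affine, equal to 1 at \<open>w\<close> and to 0 on the line through
      \<open>s\<close> and \<open>t\<close>; its sign separates the ear from the rest.\<close>
    define H where "H x = cross (x - s) (t - s) / cross (w - s) (t - s)" for x
    have D: "cross (w - s) (t - s) = - cross (s - w) (t - w)" by (simp add: cross_def algebra_simps)
    have H: "H x = 1 - a - b" if "x - w = a *\<^sub>R (s - w) + b *\<^sub>R (t - w)" for x a b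
    proof -
      have "x - s = (1 - a - b) *\<^sub>R (w - s) + b *\<^sub>R (t - s)" using that by (simp add: algebra_simps)
      then have "cross (x - s) (t - s) = (1 - a - b) * cross (w - s) (t - s)"
        by (simp only: cross_simps(1,5,7) mult_zero_right add_0_right)
      then show ?thesis using cr D by (simp add: H_def)
    qed
    have sub1: "convex hull A \<subseteq> {x. H x \<le> 0}"
    proof -
      have "A \<subseteq> {x. \<exists>a b. a \<ge> 0 \<and> b \<ge> 0 \<and> a + b \<ge> 1 \<and> x - w = a *\<^sub>R (s - w) + b *\<^sub>R (t - w)}" using far by blast
      then have "convex hull A \<subseteq> {x. \<exists>a b. a \<ge> 0 \<and> b \<ge> 0 \<and> a + b \<ge> 1 \<and> x - w = a *\<^sub>R (s - w) + b *\<^sub>R (t - w)}"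
        by (intro hull_minimal convex_cone_shift)
      moreover have "{x. \<exists>a b. a \<ge> 0 \<and> b \<ge> 0 \<and> a + b \<ge> 1 \<and> x - w = a *\<^sub>R (s - w) + b *\<^sub>R (t - w)} \<subseteq> {x. H x \<le> 0}"
      proof clarify
        fix x and a b :: real
        assume "a + b \<ge> 1" "x - w = a *\<^sub>R (s - w) + b *\<^sub>R (t - w)"
        then show "H x \<le> 0" using H[of x a b] by linarith
      qed
      ultimately show ?thesis by (rule order_trans)
    qed
    have sub2: "convex hull {w, s, t} \<subseteq> {x. H x \<ge> 0}"
    proof
      fix x assume "x \<in> convex hull {w, s, t}"
      then obtain k a b where k: "k \<ge> 0" "a \<ge> 0" "b \<ge> 0" "k + a + b = 1" "x = k *\<^sub>R w + a *\<^sub>R s + b *\<^sub>R t"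
        unfolding convex_hull_3 by blast
      have kab: "k = 1 - a - b" using k(4) by simp
      have "x - w = a *\<^sub>R (s - w) + b *\<^sub>R (t - w)" unfolding k(5) unfolding kab by (simp add: algebra_simps)
      then show "x \<in> {x. H x \<ge> 0}" using H k by simp
    qed
    have line: "{x. H x = 0} = {x. rot (t - s) \<bullet> x = rot (t - s) \<bullet> s}"
    proof -
      have "H x = 0 \<longleftrightarrow> cross (t - s) (x - s) = 0" for x
        using cr D cross_commute[of "x - s" "t - s"] by (simp add: H_def)
      then show ?thesis by (simp add: cross_rot inner_diff_right)
    qed
    have "negligible {x. H x = 0}"
      unfolding line using \<open>s \<noteq> t\<close> by (intro negligible_hyperplane) (auto simp: rot_def vec2_eq_iff)
    moreover have "convex hull A \<inter> convex hull {w, s, t} \<subseteq> {x. H x = 0}" using sub1 sub2 by fastforce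
    ultimately have neg: "negligible (convex hull A \<inter> convex hull {w, s, t})" by (rule negligible_subset)
    let ?f = "\<lambda>b. if b then convex hull A else convex hull {w, s, t}"
    have m: "convex hull A \<in> lmeasurable" "convex hull {w, s, t} \<in> lmeasurable"
      using A(1) by (auto intro: lmeasurable_hull)
    have "area (\<Union>(?f ` {True, False})) = (\<Sum>x\<in>{True, False}. area (?f x))"
      using m neg by (intro measure_negligible_finite_Union_image) (auto simp: pairwise_def Int_commute)
    then have "area (convex hull A) + area (convex hull {w, s, t}) = area (convex hull A \<union> convex hull {w, s, t})"
      by (simp add: Un_commute)
    also have "\<dots> \<le> area (convex hull W)"
      using m lmeasurable_hull[OF less.prems(1)] w st A(3)
      by (intro measure_mono_fmeasurable Un_least hull_mono) (auto intro: fmeasurableD)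
    finally have "area (convex hull A) + T \<le> area (convex hull W)" using tri by simp
    moreover have "real (card W - 2) = real (card A - 2) + 1" using A(2) c3 by simp
    ultimately show ?thesis using IH by (simp add: distrib_right)
  qed (simp add: measure_nonneg)
qed

end

section \<open>Counting triangles by middle vertices\<close>

definition middle :: "real^2 \<Rightarrow> (real^2) set \<Rightarrow> (real^2) set" where
  "middle u W = {v\<in>W. (\<exists>a\<in>W. u \<bullet> a < u \<bullet> v) \<and> (\<exists>b\<in>W. u \<bullet> v < u \<bullet> b)}"

text \<open>For points in convex position this is the number of triangles in a triangulation, so
  counting triangles becomes counting incidences between vertices and polygons.\<close>

lemma card_middle:
  assumes "finite W" "card W \<ge> 2" "inj_on (\<lambda>v. u \<bullet> v) W"
  shows "card (middle u W) = card W - 2"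
proof -
  have "W \<noteq> {}" using assms(2) by auto
  obtain p where p: "p \<in> W" "\<forall>z\<in>W. u \<bullet> z \<le> u \<bullet> p"
    using finite_attains_max[OF assms(1) \<open>W \<noteq> {}\<close>, of "\<lambda>v. u \<bullet> v"] by blast
  obtain q where q: "q \<in> W" "\<forall>z\<in>W. - (u \<bullet> z) \<le> - (u \<bullet> q)"
    using finite_attains_max[OF assms(1) \<open>W \<noteq> {}\<close>, of "\<lambda>v. - (u \<bullet> v)"] by blast
  have eq: "z = w" if "z \<in> W" "w \<in> W" "u \<bullet> z = u \<bullet> w" for z w
    using assms(3) that by (auto simp: inj_on_def)
  have "p \<noteq> q"
  proof
    assume "p = q"
    have "z = p" if "z \<in> W" for z
      using eq[OF that p(1)] p(2) q(2) that \<open>p = q\<close> by (meson antisym neg_le_iff_le)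
    then have "W \<subseteq> {p}" by blast
    then have "card W \<le> 1" using card_mono[of "{p}" W] by simp
    then show False using assms(2) by simp
  qed
  have "middle u W = W - {p, q}"
  proof
    show "middle u W \<subseteq> W - {p, q}"
      using p(2) q(2) unfolding middle_def by force
    show "W - {p, q} \<subseteq> middle u W"
    proof
      fix v assume v: "v \<in> W - {p, q}"
      then have "u \<bullet> v \<noteq> u \<bullet> p" "u \<bullet> v \<noteq> u \<bullet> q" using eq[of v p] eq[of v q] p(1) q(1) by auto
      then have "u \<bullet> v < u \<bullet> p" "u \<bullet> q < u \<bullet> v" using p(2) q(2) v by force+
      then show "v \<in> middle u W" unfolding middle_def using v p(1) q(1) by blast
    qed
  qed
  then show ?thesis using p(1) q(1) \<open>p \<noteq> q\<close> assms(1) by (simp add: card_Diff_subset)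
qed

lemma inner_rot [simp]: "u \<bullet> rot u = 0"
  by (simp add: rot_def inner_vec2)

lemma vertical:
  assumes "u \<noteq> 0" "u \<bullet> x = u \<bullet> v"
  shows "\<exists>t. x = v + t *\<^sub>R rot u"
proof -
  have uu: "u \<bullet> u \<noteq> 0" using assms(1) by simp
  have "(u \<bullet> u) *\<^sub>R (x - v) = cross u (x - v) *\<^sub>R rot u"
    using rot_expand[of u "x - v"] assms(2) by (simp add: inner_diff_right)
  then have "(1 / (u \<bullet> u)) *\<^sub>R ((u \<bullet> u) *\<^sub>R (x - v)) = (cross u (x - v) / (u \<bullet> u)) *\<^sub>R rot u" by simp
  then have "x - v = (cross u (x - v) / (u \<bullet> u)) *\<^sub>R rot u" using uu by simp
  then have "x = v + (cross u (x - v) / (u \<bullet> u)) *\<^sub>R rot u" by (metis add.commute diff_add_cancel)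
  then show ?thesis by blast
qed

context strict_norm
begin

text \<open>An interior point is pulled towards an extreme vertex on the other side of the line
  through \<open>v\<close>; it stays interior on the way and crosses the line.\<close>

lemma vertical_interior:
  assumes u: "u \<noteq> 0" and v: "v \<in> middle u W" and ne: "interior (convex hull W) \<noteq> {}"
  obtains t where "v + t *\<^sub>R rot u \<in> interior (convex hull W)"
proof -
  obtain x0 where x0: "x0 \<in> interior (convex hull W)" using ne by blast
  obtain a b where ab: "a \<in> W" "b \<in> W" "u \<bullet> a < u \<bullet> v" "u \<bullet> v < u \<bullet> b" using v by (auto simp: middle_def)
  note result = that
  have shrink: ?thesis if y: "y \<in> W" and \<theta>: "0 \<le> \<theta>" "\<theta> < 1" and eq: "u \<bullet> x0 + \<theta> * (u \<bullet> y - u \<bullet> x0) = u \<bullet> v" for y \<theta>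
  proof -
    have "y - (1 - \<theta>) *\<^sub>R (y - x0) \<in> interior (convex hull W)"
      using \<theta> x0 hull_inc[OF y] by (intro mem_interior_convex_shrink) auto
    moreover have "u \<bullet> (y - (1 - \<theta>) *\<^sub>R (y - x0)) = u \<bullet> v"
      using eq by (simp add: inner_diff_right algebra_simps)
    then obtain t where "y - (1 - \<theta>) *\<^sub>R (y - x0) = v + t *\<^sub>R rot u" using vertical[OF u] by blast
    ultimately show ?thesis using result[of t] by simp
  qed
  consider "u \<bullet> x0 = u \<bullet> v" | "u \<bullet> x0 < u \<bullet> v" | "u \<bullet> x0 > u \<bullet> v" by linarith
  then show ?thesis
  proof cases
    case 1
    then show ?thesis using shrink[OF ab(1), of 0] by simp
  next
    case 2
    define \<theta> where "\<theta> = (u \<bullet> v - u \<bullet> x0) / (u \<bullet> b - u \<bullet> x0)"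
    have "0 \<le> \<theta>" "\<theta> < 1" "\<theta> * (u \<bullet> b - u \<bullet> x0) = u \<bullet> v - u \<bullet> x0"
      using 2 ab by (simp_all add: \<theta>_def)
    then show ?thesis using shrink[OF ab(2), of \<theta>] by simp
  next
    case 3
    define \<theta> where "\<theta> = (u \<bullet> x0 - u \<bullet> v) / (u \<bullet> x0 - u \<bullet> a)"
    have "0 \<le> \<theta>" "\<theta> < 1" "\<theta> * (u \<bullet> x0 - u \<bullet> a) = u \<bullet> x0 - u \<bullet> v"
      using 3 ab by (simp_all add: \<theta>_def)
    moreover have "\<theta> * (u \<bullet> a - u \<bullet> x0) = - (\<theta> * (u \<bullet> x0 - u \<bullet> a))" by (simp add: algebra_simps)
    ultimately show ?thesis using shrink[OF ab(1), of \<theta>] by simp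
  qed
qed

lemma vertical_interior_ray:
  assumes "v \<in> W" "v + t *\<^sub>R rot u \<in> interior (convex hull W)" "0 < s" "s \<le> 1"
  shows "v + (s * t) *\<^sub>R rot u \<in> interior (convex hull W)"
proof -
  have "v - s *\<^sub>R (v - (v + t *\<^sub>R rot u)) \<in> interior (convex hull W)"
    using assms hull_inc[OF assms(1)] by (intro mem_interior_convex_shrink) auto
  then show ?thesis by simp
qed

lemma nearest_not_interior:
  assumes "v \<in> nearest V c"
  shows "v \<notin> interior (convex hull (nearest V c))"
proof
  assume "v \<in> interior (convex hull (nearest V c))"
  then have "N (v - c) < N (v - c)"
    by (rule interior_hull_in_disk(1)) (use assms in \<open>auto simp: nearest_def\<close>)
  then show False by simp
qed

lemma nearest_hull_in_disk:
  assumes "x \<in> convex hull (nearest V c)"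
  shows "N (x - c) \<le> dist_to V c"
proof -
  have "convex hull (nearest V c) \<subseteq> {x. N (x - c) \<le> dist_to V c}"
    by (intro hull_minimal convex_disk_set) (auto simp: dist_to_nearest)
  then show ?thesis using assms by blast
qed

definition delaunay :: "(real^2) set \<Rightarrow> (real^2) set set" where
  "delaunay V = {W. \<exists>c. W = nearest V c \<and> interior (convex hull W) \<noteq> {}}"

text \<open>A middle vertex \<open>v\<close> of a Delaunay polygon determines the polygon up to the choice of the
  side on which the line through \<open>v\<close> in the direction \<open>rot u\<close> enters it.\<close>

lemma delaunay_count_le:
  assumes V: "loc_finite V" and u: "u \<noteq> 0" and Q: "Q \<subseteq> delaunay V" "finite Q" and A: "finite A" "\<Union>Q \<subseteq> A"
  shows "(\<Sum>W\<in>Q. card (middle u W)) \<le> 2 * card A"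
proof -
  have fin: "finite W" if "W \<in> Q" for W
    using that Q(1) finite_nearest[OF V] by (auto simp: delaunay_def)
  define up where "up W v \<longleftrightarrow> (\<exists>t>0. v + t *\<^sub>R rot u \<in> interior (convex hull W))" for W v
  \<comment> \<open>The vertex \<open>v\<close> itself is not interior, so a polygon that is not
    entered upwards is entered downwards.\<close>
  have down: "\<exists>t<0. v + t *\<^sub>R rot u \<in> interior (convex hull W)" if W: "W \<in> Q" "v \<in> middle u W" "\<not> up W v" for W v
  proof -
    obtain c where c: "W = nearest V c" "interior (convex hull W) \<noteq> {}" using W(1) Q(1) unfolding delaunay_def by blast
    obtain t where t: "v + t *\<^sub>R rot u \<in> interior (convex hull W)" using vertical_interior[OF u W(2) c(2)] .
    have "v \<in> nearest V c" using W(2) by (simp add: middle_def c(1))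
    then have "t \<noteq> 0" using nearest_not_interior t c(1) by auto
    moreover have "\<not> t > 0" using t W(3) unfolding up_def by blast
    ultimately have "t < 0" by simp
    then show ?thesis using t by blast
  qed
  \<comment> \<open>On a common side, the one of the two interior points that is nearer to
    \<open>v\<close> lies in the interior of both polygons, so \<open>nearest_disjoint\<close>
    identifies them.\<close>
  have same: "W = W'" if W: "W \<in> Q" "W' \<in> Q" and v: "v \<in> W" "v \<in> W'"
    and t: "v + t *\<^sub>R rot u \<in> interior (convex hull W)" "v + t' *\<^sub>R rot u \<in> interior (convex hull W')" "t * t' > 0"
    for W W' v t t'
  proof -
    obtain c c' where c: "W = nearest V c" "W' = nearest V c'" using W Q(1) by (fastforce simp: delaunay_def)
    define m where "m = (if \<bar>t\<bar> \<le> \<bar>t'\<bar> then t else t')"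
    have tt: "t \<noteq> 0" "t' \<noteq> 0" using t(3) by auto
    have "m / t * t = m" "m / t' * t' = m" using tt by simp_all
    moreover have "0 < m / t \<and> m / t \<le> 1 \<and> 0 < m / t' \<and> m / t' \<le> 1"
      using t(3) by (auto simp: m_def zero_less_mult_iff field_simps)
    ultimately have "v + m *\<^sub>R rot u \<in> interior (convex hull W)" "v + m *\<^sub>R rot u \<in> interior (convex hull W')"
      using vertical_interior_ray[OF v(1) t(1), of "m / t"] vertical_interior_ray[OF v(2) t(2), of "m / t'"] by auto
    then show ?thesis
      using nearest_disjoint[of V c c'] finite_nearest[OF V] unfolding c by blast
  qed
  let ?S = "SIGMA W:Q. middle u W"
  have "(\<Sum>W\<in>Q. card (middle u W)) = card ?S"
    using Q(2) fin by (subst card_SigmaI) (auto simp: middle_def)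
  also have "\<dots> \<le> card (A \<times> (UNIV :: bool set))"
  proof (rule card_inj_on_le)
    show "(\<lambda>(W, v). (v, up W v)) ` ?S \<subseteq> A \<times> UNIV"
      using A(2) by (auto simp: middle_def)
    show "finite (A \<times> (UNIV :: bool set))" using A(1) by simp
    show "inj_on (\<lambda>(W, v). (v, up W v)) ?S"
    proof (rule inj_onI, clarify)
      fix W W' v assume W: "W \<in> Q" "W' \<in> Q" and v: "v \<in> middle u W" "v \<in> middle u W'" and e: "up W v = up W' v"
      have vW: "v \<in> W" "v \<in> W'" using v by (auto simp: middle_def)
      show "W = W' \<and> v = v"
      proof (cases "up W v")
        case True
        then obtain t t' where "t > 0" "t' > 0" "v + t *\<^sub>R rot u \<in> interior (convex hull W)"
          "v + t' *\<^sub>R rot u \<in> interior (convex hull W')" using e unfolding up_def by blast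
        then show ?thesis using same[OF W vW, of t t'] by simp
      next
        case False
        then obtain t t' where "t < 0" "t' < 0" "v + t *\<^sub>R rot u \<in> interior (convex hull W)"
          "v + t' *\<^sub>R rot u \<in> interior (convex hull W')"
          using down[OF W(1) v(1)] down[OF W(2) v(2)] e by blast
        then show ?thesis using same[OF W vW, of t t'] by (simp add: mult_neg_neg)
      qed
    qed
  qed
  finally show ?thesis using A(1) by (simp add: card_cartesian_product)
qed

text \<open>Points on the ray that tend to \<open>v\<close> are covered by polygons with vertices in
  the finite set \<open>F\<close>, so a single polygon \<open>W\<close> covers infinitely many of
  them and its hull contains \<open>v\<close>; hence \<open>v\<close> is in the closed empty disk
  and is a vertex. Were \<open>v\<close> extreme in direction \<open>u\<close>, then by genericity
  the hull would meet the line only in \<open>v\<close>.\<close>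

lemma vertical_polygon:
  assumes V: "loc_finite V" and \<rho>: "\<And>c. \<exists>v\<in>V. N (v - c) \<le> \<rho>"
    and u: "u \<noteq> 0" "inj_on (\<lambda>v. u \<bullet> v) V" and v: "v \<in> V" and \<sigma>: "\<sigma> \<noteq> 0"
  shows "\<exists>c t. v \<in> middle u (nearest V c) \<and> t > 0 \<and> v + (\<sigma> * t) *\<^sub>R rot u \<in> convex hull (nearest V c)"
proof -
  define y where "y n = v + (\<sigma> * (1 / real (Suc n))) *\<^sub>R rot u" for n
  have "\<exists>c. y n \<in> convex hull (nearest V c)" for n
    by (rule hull_nearest_cover[OF V \<rho>, of "y n"]) blast
  then obtain c where c: "\<And>n. y n \<in> convex hull (nearest V (c n))" by metis
  define F where "F = {w\<in>V. N (w - v) \<le> 2 * \<rho> + N (\<sigma> *\<^sub>R rot u)}"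
  have F: "finite F" unfolding F_def by (rule finite_N_disk[OF V])
  have \<rho>0: "dist_to V c \<le> \<rho>" for c using \<rho>[of c] dist_to_le order_trans by blast
  have "nearest V (c n) \<subseteq> F" for n
  proof
    fix w assume w: "w \<in> nearest V (c n)"
    have "N (w - y n) \<le> N (w - c n) + N (c n - y n)" by (rule tri3)
    also have "\<dots> \<le> \<rho> + \<rho>"
      using dist_to_nearest[OF w] nearest_hull_in_disk[OF c[of n]] \<rho>0[of "c n"] commute[of "c n" "y n"] by linarith
    finally have 1: "N (w - y n) \<le> 2 * \<rho>" by simp
    have "N (y n - v) = \<bar>1 / real (Suc n)\<bar> * N (\<sigma> *\<^sub>R rot u)" by (simp add: y_def hom abs_mult)
    also have "\<dots> \<le> 1 * N (\<sigma> *\<^sub>R rot u)" by (rule mult_right_mono) auto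
    finally have "N (w - v) \<le> 2 * \<rho> + N (\<sigma> *\<^sub>R rot u)" using 1 tri3[of w v "y n"] by linarith
    then show "w \<in> F" using w by (simp add: F_def nearest_def)
  qed
  then have "range (\<lambda>n. nearest V (c n)) \<subseteq> Pow F" by blast
  then have "finite (range (\<lambda>n. nearest V (c n)))" using F finite_subset by blast
  then obtain k where k: "infinite {n \<in> UNIV. nearest V (c n) = nearest V (c k)}"
    using pigeonhole_infinite[of "UNIV :: nat set" "\<lambda>n. nearest V (c n)"] by auto
  define W where "W = nearest V (c k)"
  define I where "I = {n. nearest V (c n) = W}"
  have "infinite I" using k by (simp add: I_def W_def)
  have yI: "y n \<in> convex hull W" if "n \<in> I" for n using c[of n] that by (simp add: I_def)
  have fW: "finite W" unfolding W_def by (rule finite_nearest[OF V])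
  have "v \<in> convex hull W"
  proof -
    have "closed (convex hull W)" using fW by (simp add: finite_imp_compact_convex_hull compact_imp_closed)
    moreover have "\<exists>z\<in>convex hull W. dist z v < e" if e: "e > 0" for e
    proof -
      obtain m :: nat where m: "norm (\<sigma> *\<^sub>R rot u) < real m * e" using reals_Archimedean3[OF e] by blast
      obtain n where n: "n \<in> I" "n > m" using \<open>infinite I\<close> infinite_nat_iff_unbounded by blast
      have "dist (y n) v = (1 / real (Suc n)) * norm (\<sigma> *\<^sub>R rot u)" by (simp add: y_def dist_norm abs_mult)
      moreover have "norm (\<sigma> *\<^sub>R rot u) < real (Suc n) * e"
        using m n(2) e by (smt (verit) mult_right_mono of_nat_Suc of_nat_less_iff)
      ultimately have "dist (y n) v < e"
        by (simp add: pos_divide_less_eq mult.commute del: of_nat_Suc)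
      then show ?thesis using yI[OF n(1)] by blast
    qed
    ultimately show ?thesis by (metis closed_approachable)
  qed
  then have "N (v - c k) \<le> dist_to V (c k)" unfolding W_def by (rule nearest_hull_in_disk)
  then have vW: "v \<in> W" unfolding W_def using mem_nearest_iff[OF V v] by simp
  have "k \<in> I" by (simp add: I_def W_def)
  then have yk: "y k \<in> convex hull W" by (rule yI)
  have ru: "rot u \<noteq> 0" using u(1) by (auto simp: rot_def vec2_eq_iff)
  have yv: "y k \<noteq> v" using \<sigma> ru by (simp add: y_def)
  have uy: "u \<bullet> y k = u \<bullet> v" by (simp add: y_def inner_add_right)
  have side: "\<exists>a\<in>W. d \<bullet> a > d \<bullet> v" if d: "d = u \<or> d = - u" for d
  proof (rule ccontr)
    assume n: "\<not> ?thesis"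
    have less: "d \<bullet> a < d \<bullet> v" if a: "a \<in> W - {v}" for a
    proof -
      have "a \<in> V" using a by (auto simp: W_def nearest_def)
      then have "u \<bullet> a \<noteq> u \<bullet> v" using u(2) v a by (auto simp: inj_on_def)
      then have "d \<bullet> a \<noteq> d \<bullet> v" using d by auto
      then show ?thesis using n a by force
    qed
    have W: "W = insert v (W - {v})" using vW by blast
    show False
    proof (cases "W - {v} = {}")
      case True
      then have "W = {v}" using vW by blast
      then have "convex hull W = {v}" by simp
      then show False using yk yv by simp
    next
      case False
      have "y k \<in> convex hull (insert v (W - {v}))" using yk W by simp
      then obtain l m b where lm: "l \<ge> 0" "m \<ge> 0" "l + m = 1" "b \<in> convex hull (W - {v})" "y k = l *\<^sub>R v + m *\<^sub>R b"
        using convex_hull_insert[OF False, of v] by auto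
      have "convex hull (W - {v}) \<subseteq> {x. d \<bullet> x < d \<bullet> v}"
        using less by (intro hull_minimal convex_halfspace_lt) auto
      then have b: "d \<bullet> b < d \<bullet> v" using lm(4) by blast
      have l: "l = 1 - m" using lm by simp
      have "d \<bullet> y k = d \<bullet> v" using uy d by auto
      then have "m * (d \<bullet> b - d \<bullet> v) = 0" unfolding lm(5) l by (simp add: inner_add_right algebra_simps)
      then have "m = 0" using b by simp
      then show False using yv unfolding lm(5) l by simp
    qed
  qed
  have "v \<in> middle u W"
    using side[of u] side[of "- u"] vW by (auto simp: middle_def)
  then show ?thesis
    using yk unfolding W_def by (intro exI[of _ "c k"] exI[of _ "1 / real (Suc k)"]) (simp add: y_def)
qed

text \<open>Each point of \<open>A\<close> is a middle vertex of a polygon reached along either half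
  of its line. The two polygons differ: otherwise the vertex would lie between two points of the
  closed disk and, by strictness, inside it.\<close>

lemma delaunay_count_ge:
  assumes V: "loc_finite V" and \<rho>: "\<And>c. \<exists>v\<in>V. N (v - c) \<le> \<rho>"
    and u: "u \<noteq> 0" "inj_on (\<lambda>v. u \<bullet> v) V" and A: "finite A" "A \<subseteq> V"
    and Q: "finite Q" "\<And>c. nearest V c \<inter> A \<noteq> {} \<Longrightarrow> card (nearest V c) \<ge> 3 \<Longrightarrow> nearest V c \<in> Q"
      "\<And>W. W \<in> Q \<Longrightarrow> \<exists>c. W = nearest V c"
  shows "2 * card A \<le> (\<Sum>W\<in>Q. card (middle u W))"
proof -
  have fin: "finite W" if "W \<in> Q" for W
    using that Q(3) finite_nearest[OF V] by fastforce
  define s where "s b = (if b then 1 else - 1 :: real)" for b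
  have s0: "s b \<noteq> 0" for b by (simp add: s_def)
  have "\<forall>p\<in>A \<times> (UNIV :: bool set). \<exists>W. W \<in> Q \<and> fst p \<in> middle u W \<and>
      (\<exists>t>0. fst p + (s (snd p) * t) *\<^sub>R rot u \<in> convex hull W)"
  proof
    fix p assume p: "p \<in> A \<times> (UNIV :: bool set)"
    then have pA: "fst p \<in> A" "fst p \<in> V" using A by auto
    obtain c t where ct: "fst p \<in> middle u (nearest V c)" "t > 0"
      "fst p + (s (snd p) * t) *\<^sub>R rot u \<in> convex hull (nearest V c)"
      using vertical_polygon[OF V \<rho> u pA(2) s0[of "snd p"]] by blast
    have sub: "nearest V c \<subseteq> V" by (auto simp: nearest_def)
    have pn: "fst p \<in> nearest V c" using ct(1) by (simp add: middle_def)
    have "card (nearest V c) \<ge> 3"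
    proof -
      obtain a b where ab: "a \<in> nearest V c" "b \<in> nearest V c" "u \<bullet> a < u \<bullet> fst p" "u \<bullet> fst p < u \<bullet> b"
        using ct(1) by (auto simp: middle_def)
      then have "a \<noteq> b" "a \<noteq> fst p" "b \<noteq> fst p" by auto
      then have "card {a, b, fst p} = 3" by simp
      moreover have "{a, b, fst p} \<subseteq> nearest V c" using ab pn by blast
      ultimately show ?thesis using card_mono[OF finite_nearest[OF V], of "{a, b, fst p}" c] by simp
    qed
    then have "nearest V c \<in> Q" using Q(2) pn pA by blast
    then show "\<exists>W. W \<in> Q \<and> fst p \<in> middle u W \<and> (\<exists>t>0. fst p + (s (snd p) * t) *\<^sub>R rot u \<in> convex hull W)"
      using ct by blast
  qed
  then obtain g where g: "\<forall>p\<in>A \<times> (UNIV :: bool set). g p \<in> Q \<and> fst p \<in> middle u (g p) \<and>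
      (\<exists>t>0. fst p + (s (snd p) * t) *\<^sub>R rot u \<in> convex hull (g p))" by (rule bchoice[THEN exE])
  let ?S = "SIGMA W:Q. middle u W"
  have "card (A \<times> (UNIV :: bool set)) \<le> card ?S"
  proof (rule card_inj_on_le)
    show "(\<lambda>p. (g p, fst p)) ` (A \<times> UNIV) \<subseteq> ?S" using g by auto
    show "finite ?S" using Q(1) fin by (intro finite_SigmaI) (auto simp: middle_def)
    show "inj_on (\<lambda>p. (g p, fst p)) (A \<times> (UNIV :: bool set))"
    proof (rule inj_onI)
      fix p q assume p: "p \<in> A \<times> (UNIV :: bool set)" and q: "q \<in> A \<times> (UNIV :: bool set)"
        and e: "(g p, fst p) = (g q, fst q)"
      have "snd p = snd q"
      proof (rule ccontr)
        assume ne: "snd p \<noteq> snd q"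
        obtain t where t: "t > 0" "fst p + (s (snd p) * t) *\<^sub>R rot u \<in> convex hull (g p)" using g p by blast
        obtain t' where t': "t' > 0" "fst p + (s (snd q) * t') *\<^sub>R rot u \<in> convex hull (g p)"
        proof -
          have "g q = g p" "fst q = fst p" using e by simp_all
          then show thesis using g q that by metis
        qed
        have gp: "g p \<in> Q" "fst p \<in> g p" using g p by (auto simp: middle_def)
        obtain c where c: "g p = nearest V c" using Q(3)[OF gp(1)] by blast
        define x where "x = fst p + (s (snd p) * t) *\<^sub>R rot u"
        define y where "y = fst p + (s (snd q) * t') *\<^sub>R rot u"
        have sq: "s (snd q) = - s (snd p)" using ne by (auto simp: s_def)
        have le: "N (x - c) \<le> dist_to V c" "N (y - c) \<le> dist_to V c"
          using t(2) t'(2) nearest_hull_in_disk[of _ V c] unfolding c x_def y_def by auto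
        have ru: "rot u \<noteq> 0" using u(1) by (auto simp: rot_def vec2_eq_iff)
        have "x - y = (s (snd p) * (t + t')) *\<^sub>R rot u" by (simp add: x_def y_def sq algebra_simps)
        then have xy: "x - c \<noteq> y - c" using ru t(1) t'(1) s0[of "snd p"] by auto
        \<comment> \<open>Chosen so that the point dividing the segment from \<open>x\<close> to
          \<open>y\<close> in this ratio is \<open>fst p\<close>.\<close>
        define \<theta> where "\<theta> = t / (t + t')"
        have \<theta>: "0 < \<theta>" "\<theta> < 1" "(1 - \<theta>) * t = \<theta> * t'"
          using t(1) t'(1) by (simp_all add: \<theta>_def field_simps)
        have "(1 - \<theta>) *\<^sub>R (x - c) + \<theta> *\<^sub>R (y - c) =
            fst p - c + (s (snd p) * ((1 - \<theta>) * t - \<theta> * t')) *\<^sub>R rot u"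
          by (simp add: x_def y_def sq algebra_simps)
        also have "\<dots> = fst p - c" unfolding \<theta>(3) by simp
        finally have "N (fst p - c) < dist_to V c" using strict[OF le xy \<theta>(1,2)] by simp
        moreover have "dist_to V c = N (fst p - c)" using gp(2) unfolding c by (rule dist_to_nearest)
        ultimately show False by simp
      qed
      then show "p = q" using e by (simp add: prod_eq_iff)
    qed
  qed
  also have "card ?S = (\<Sum>W\<in>Q. card (middle u W))"
    using Q(1) fin by (subst card_SigmaI) (auto simp: middle_def)
  finally show ?thesis using A(1) by (simp add: card_cartesian_product)
qed

end

section \<open>Coverings by a symmetric disk\<close>

text \<open>For the largest \<open>t\<close> such that \<open>t\<close> times the vector of the
  \<open>S\<close> stays below \<open>X, Y, Z\<close> in each coordinate, some coordinate is
  tight.\<close>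

lemma common_ratio:
  fixes X Y Z S1 S2 S3 :: real
  assumes "X \<ge> 0" "Y \<ge> 0" "Z \<ge> 0" "S1 \<ge> 0" "S2 \<ge> 0" "S3 \<ge> 0" "X + Y + Z = 1" "S1 + S2 + S3 = 1"
  obtains t where "t \<ge> 0" "t * S1 \<le> X" "t * S2 \<le> Y" "t * S3 \<le> Z"
    "X = t * S1 \<or> Y = t * S2 \<or> Z = t * S3"
proof -
  \<comment> \<open>The value 2 for \<open>s = 0\<close> is never the minimum, because the minimum
    turns out to be at most 1.\<close>
  define r where "r x s = (if s > 0 then x / s else 2)" for x s :: real
  define t where "t = min (r X S1) (min (r Y S2) (r Z S3))"
  have r: "t * s \<le> x" if "t \<le> r x s" "x \<ge> 0" "s \<ge> 0" for x s
    using that by (cases "s > 0") (auto simp: r_def field_simps)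
  have le: "t \<le> r X S1" "t \<le> r Y S2" "t \<le> r Z S3" by (auto simp: t_def)
  have r0: "r x s \<ge> 0" if "x \<ge> 0" for x s using that by (simp add: r_def)
  have t0: "t \<ge> 0" using r0 assms(1-3) by (simp add: t_def)
  have b: "t * S1 \<le> X" "t * S2 \<le> Y" "t * S3 \<le> Z" using r le assms by blast+
  have "t * (S1 + S2 + S3) \<le> 1" using b assms(7) by (simp add: distrib_left)
  then have t1: "t \<le> 1" using assms(8) by simp
  have eq: "x = t * s" if "t = r x s" for x s
  proof (cases "s > 0")
    case False
    then show ?thesis using that t1 by (simp add: r_def)
  qed (use that in \<open>simp add: r_def\<close>)
  have "t = r X S1 \<or> t = r Y S2 \<or> t = r Z S3" by (auto simp: t_def min_def)
  then have "X = t * S1 \<or> Y = t * S2 \<or> Z = t * S3" using eq by blast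
  then show ?thesis using that t0 b by blast
qed

text \<open>In the triangle \<open>b, c, b + c - a\<close>, the second half of the lattice
  parallelogram, \<open>p\<close> has barycentric coordinates \<open>Z, Y, X\<close>, and
  \<open>- a\<close> has \<open>1 - 2 * \<gamma>\<close>, \<open>1 - 2 * \<beta>\<close>,
  \<open>1 - 2 * \<alpha>\<close>. So \<open>- a\<close> splits this triangle into
  \<open>- a, b, c\<close>, the translate of \<open>- b, a, c\<close> by \<open>b - a\<close> and
  the translate of \<open>- c, a, b\<close> by \<open>c - a\<close>; all three come from triangles
  with vertices in \<open>K\<close>.\<close>

lemma reflected_triangle_cover:
  fixes a b c :: "real^2"
  assumes K: "convex K" "a \<in> K" "b \<in> K" "c \<in> K" "- a \<in> K" "- b \<in> K" "- c \<in> K"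
    and S: "0 \<le> \<alpha>" "\<alpha> \<le> 1/2" "0 \<le> \<beta>" "\<beta> \<le> 1/2" "0 \<le> \<gamma>" "\<gamma> \<le> 1/2" "\<alpha> + \<beta> + \<gamma> = 1"
    and zero: "\<alpha> *\<^sub>R a + \<beta> *\<^sub>R b + \<gamma> *\<^sub>R c = 0"
    and l: "0 \<le> l" "l \<le> 1" "0 \<le> m" "m \<le> 1" "l + m \<ge> 1"
  defines "p \<equiv> a + l *\<^sub>R (b - a) + m *\<^sub>R (c - a)"
  shows "p \<in> K \<or> p - (b - a) \<in> K \<or> p - (c - a) \<in> K"
proof -
  define X where "X = l + m - 1"
  define Y where "Y = 1 - l"
  define Z where "Z = 1 - m"
  \<comment> \<open>The weight of \<open>- a\<close>; the remaining weights belong to the corners,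
    and one of them vanishes.\<close>
  obtain t where t: "t \<ge> 0" "t * (1 - 2 * \<alpha>) \<le> X" "t * (1 - 2 * \<beta>) \<le> Y" "t * (1 - 2 * \<gamma>) \<le> Z"
    "X = t * (1 - 2 * \<alpha>) \<or> Y = t * (1 - 2 * \<beta>) \<or> Z = t * (1 - 2 * \<gamma>)"
    by (rule common_ratio[of X Y Z "1 - 2 * \<alpha>" "1 - 2 * \<beta>" "1 - 2 * \<gamma>"])
      (use S l in \<open>auto simp: X_def Y_def Z_def\<close>)
  define x where "x = X - t * (1 - 2 * \<alpha>)"
  define y where "y = Y - t * (1 - 2 * \<beta>)"
  define z where "z = Z - t * (1 - 2 * \<gamma>)"
  have xyz: "x \<ge> 0" "y \<ge> 0" "z \<ge> 0" "x = 0 \<or> y = 0 \<or> z = 0" using t by (auto simp: x_def y_def z_def)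
  have al: "\<alpha> = 1 - \<beta> - \<gamma>" using S by simp
  have lm: "l = 1 - y - t * (1 - 2 * \<beta>)" "m = 1 - z - t * (1 - 2 * \<gamma>)"
    by (simp_all add: y_def z_def Y_def Z_def)
  have sum: "x + y + z + t = 1"
    unfolding x_def y_def z_def X_def Y_def Z_def al by (simp add: algebra_simps)
  have q0: "t *\<^sub>R (\<alpha> *\<^sub>R a + \<beta> *\<^sub>R b + \<gamma> *\<^sub>R c) = 0" by (simp add: zero)
  have xt: "x = 1 - y - z - t" using sum by simp
  have p: "p = b + c - x *\<^sub>R a - y *\<^sub>R b - z *\<^sub>R c - t *\<^sub>R (a + b + c) +
      2 *\<^sub>R (t *\<^sub>R (\<alpha> *\<^sub>R a + \<beta> *\<^sub>R b + \<gamma> *\<^sub>R c))"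
    unfolding p_def lm xt al by (simp add: vec2_eq_iff algebra_simps)
  then have p: "p = b + c - x *\<^sub>R a - y *\<^sub>R b - z *\<^sub>R c - t *\<^sub>R (a + b + c)" unfolding q0 by simp
  consider "x = 0" | "y = 0" | "z = 0" using xyz by blast
  then show ?thesis
  proof cases
    case 1
    have "t *\<^sub>R (- a) + y *\<^sub>R c + z *\<^sub>R b \<in> K"
      using 1 sum xyz t K by (intro convex_comb3) auto
    also have "t *\<^sub>R (- a) + y *\<^sub>R c + z *\<^sub>R b = p"
    proof -
      have te: "t = 1 - y - z" using sum 1 by simp
      show ?thesis unfolding p 1 te by (simp add: vec2_eq_iff algebra_simps)
    qed
    finally show ?thesis by blast
  next
    case 2
    have "t *\<^sub>R (- b) + x *\<^sub>R c + z *\<^sub>R a \<in> K"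
      using 2 sum xyz t K by (intro convex_comb3) auto
    also have "t *\<^sub>R (- b) + x *\<^sub>R c + z *\<^sub>R a = p - (b - a)"
    proof -
      have te: "t = 1 - x - z" using sum 2 by simp
      show ?thesis unfolding p 2 te by (simp add: vec2_eq_iff algebra_simps)
    qed
    finally show ?thesis by blast
  next
    case 3
    have "t *\<^sub>R (- c) + x *\<^sub>R b + y *\<^sub>R a \<in> K"
      using 3 sum xyz t K by (intro convex_comb3) auto
    also have "t *\<^sub>R (- c) + x *\<^sub>R b + y *\<^sub>R a = p - (c - a)"
    proof -
      have te: "t = 1 - x - y" using sum 3 by simp
      show ?thesis unfolding p 3 te by (simp add: vec2_eq_iff algebra_simps)
    qed
    finally show ?thesis by blast
  qed
qed

text \<open>For a triangle \<open>a, b, c\<close> of maximal area in \<open>K\<close>, comparison with the triangles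
  \<open>-a, b, c\<close> and \<open>a, -a, b\<close> (and their permutations) shows that the barycentric
  coordinates of the center lie between \<open>0\<close> and \<open>1/2\<close>.\<close>

lemma max_triangle_lattice_covers:
  fixes a b c :: "real^2"
  assumes K: "convex K" "\<And>x. x \<in> K \<Longrightarrow> - x \<in> K" "a \<in> K" "b \<in> K" "c \<in> K"
    and mx: "\<And>x y z. x \<in> K \<Longrightarrow> y \<in> K \<Longrightarrow> z \<in> K \<Longrightarrow> \<bar>cross (y - x) (z - x)\<bar> \<le> cross (b - a) (c - a)"
    and D: "cross (b - a) (c - a) > 0"
  shows "cv K (lin (b - a) (c - a) ` int_points)"
proof -
  \<comment> \<open>Twice the signed areas of the triangles formed by the center with the sides;
    their ratios to \<open>\<Delta>\<close> are the barycentric coordinates of the center.\<close>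
  define X where "X = cross b c"
  define Y where "Y = cross c a"
  define Z where "Z = cross a b"
  define \<Delta> where "\<Delta> = X + Y + Z"
  have Deq: "cross (b - a) (c - a) = \<Delta>" by (simp add: \<Delta>_def X_def Y_def Z_def cross_def algebra_simps)
  have neg: "- a \<in> K" "- b \<in> K" "- c \<in> K" using K by auto
  have 1: "\<bar>cross (b - (- a)) (c - (- a))\<bar> \<le> \<Delta>" "\<bar>cross (c - (- b)) (a - (- b))\<bar> \<le> \<Delta>"
    "\<bar>cross (a - (- c)) (b - (- c))\<bar> \<le> \<Delta>"
    "\<bar>cross (- b - b) (c - b)\<bar> \<le> \<Delta>" "\<bar>cross (- c - c) (a - c)\<bar> \<le> \<Delta>" "\<bar>cross (- a - a) (b - a)\<bar> \<le> \<Delta>"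
    using mx neg K(3-5) unfolding Deq by blast+
  have 2: "cross (b - (- a)) (c - (- a)) = X - Y - Z" "cross (c - (- b)) (a - (- b)) = Y - X - Z"
    "cross (a - (- c)) (b - (- c)) = Z - X - Y"
    "cross (- b - b) (c - b) = - 2 * X" "cross (- c - c) (a - c) = - 2 * Y" "cross (- a - a) (b - a) = - 2 * Z"
    by (simp_all add: X_def Y_def Z_def cross_def algebra_simps)
  have \<Delta>0: "\<Delta> > 0" using D Deq by simp
  have b: "0 \<le> X" "X \<le> \<Delta> / 2" "0 \<le> Y" "Y \<le> \<Delta> / 2" "0 \<le> Z" "Z \<le> \<Delta> / 2"
  proof -
    note 3 = 1[unfolded 2]
    show "0 \<le> X" using 3(1) \<Delta>_def by linarith
    show "0 \<le> Y" using 3(2) \<Delta>_def by linarith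
    show "0 \<le> Z" using 3(3) \<Delta>_def by linarith
    show "X \<le> \<Delta> / 2" using 3(4) by linarith
    show "Y \<le> \<Delta> / 2" using 3(5) by linarith
    show "Z \<le> \<Delta> / 2" using 3(6) by linarith
  qed
  define \<alpha> where "\<alpha> = X / \<Delta>"
  define \<beta> where "\<beta> = Y / \<Delta>"
  define \<gamma> where "\<gamma> = Z / \<Delta>"
  have "\<alpha> + \<beta> + \<gamma> = \<Delta> / \<Delta>"
    by (simp add: \<alpha>_def \<beta>_def \<gamma>_def add_divide_distrib[symmetric] \<Delta>_def[symmetric])
  then have S: "0 \<le> \<alpha>" "\<alpha> \<le> 1/2" "0 \<le> \<beta>" "\<beta> \<le> 1/2" "0 \<le> \<gamma>" "\<gamma> \<le> 1/2" "\<alpha> + \<beta> + \<gamma> = 1"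
    using b \<Delta>0 by (simp_all add: \<alpha>_def \<beta>_def \<gamma>_def pos_divide_le_eq)
  have "X *\<^sub>R a + Y *\<^sub>R b + Z *\<^sub>R c = 0"
    by (simp add: vec2_eq_iff X_def Y_def Z_def cross_def algebra_simps)
  moreover have "\<alpha> *\<^sub>R a + \<beta> *\<^sub>R b + \<gamma> *\<^sub>R c = (1 / \<Delta>) *\<^sub>R (X *\<^sub>R a + Y *\<^sub>R b + Z *\<^sub>R c)"
    by (simp add: \<alpha>_def \<beta>_def \<gamma>_def scaleR_add_right)
  ultimately have zero: "\<alpha> *\<^sub>R a + \<beta> *\<^sub>R b + \<gamma> *\<^sub>R c = 0" by simp
  have L: "lin (b - a) (c - a) (z + axis 1 1) = lin (b - a) (c - a) z + (b - a)"
    "lin (b - a) (c - a) (z + axis 2 1) = lin (b - a) (c - a) z + (c - a)" for z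
    by (simp_all add: lin_def axis_def algebra_simps)
  have ax: "z + axis 1 1 \<in> int_points" "z + axis 2 1 \<in> int_points" if "z \<in> int_points" for z
    using that by (auto simp: int_points_def axis_def)
  show ?thesis
    unfolding cv_def
  proof
    fix x
    obtain w where w: "x - a = lin (b - a) (c - a) w"
      using lin_surj[of "b - a" "c - a" "x - a"] D by auto
    define z where "z = vfloor w"
    define l where "l = (w - z) $ 1"
    define m where "m = (w - z) $ 2"
    have z: "z \<in> int_points" by (simp add: z_def int_points_simps)
    have lm: "0 \<le> l" "l \<le> 1" "0 \<le> m" "m \<le> 1"
      using vfloor_in_cell[of w] by (auto simp: unit_cell_def z_def l_def m_def)
    have p: "x - lin (b - a) (c - a) z = a + l *\<^sub>R (b - a) + m *\<^sub>R (c - a)"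
    proof -
      have "x - lin (b - a) (c - a) z = a + lin (b - a) (c - a) (w - z)"
        using w by (simp add: lin_simps(2)) (metis add_diff_cancel_left' add_diff_eq diff_add_cancel add.commute)
      then show ?thesis by (simp add: lin_def l_def m_def)
    qed
    show "\<exists>v\<in>lin (b - a) (c - a) ` int_points. x - v \<in> K"
    proof (cases "l + m \<le> 1")
      case True
      \<comment> \<open>In this half of the parallelogram the point is in the triangle
        \<open>a, b, c\<close> itself.\<close>
      have "(1 - l - m) *\<^sub>R a + l *\<^sub>R b + m *\<^sub>R c \<in> K"
        using True lm K by (intro convex_comb3) auto
      also have "(1 - l - m) *\<^sub>R a + l *\<^sub>R b + m *\<^sub>R c = x - lin (b - a) (c - a) z"
        unfolding p by (simp add: algebra_simps)
      finally show ?thesis using z by blast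
    next
      case False
      then have "1 \<le> l + m" by simp
      from reflected_triangle_cover[OF K(1,3-5) neg S zero lm this, folded p]
      have "x - lin (b - a) (c - a) z \<in> K \<or> x - lin (b - a) (c - a) (z + axis 1 1) \<in> K \<or>
          x - lin (b - a) (c - a) (z + axis 2 1) \<in> K"
        unfolding L by (simp add: algebra_simps)
      then show ?thesis using z ax[OF z] by blast
    qed
  qed
qed

context strict_norm
begin

lemma convex_disk_unit:
  assumes "r > 0"
  shows "convex_disk {x. N x \<le> r}"
proof -
  obtain m where m: "m > 0" "\<And>x. m * norm x \<le> N x" using lower_bound by blast
  have "closed {x. N x \<le> r}" by (intro closed_Collect_le continuous_N continuous_on_const)
  moreover have "{x. N x \<le> r} \<subseteq> cball 0 (r / m)"
  proof
    fix x assume "x \<in> {x. N x \<le> r}"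
    then have "m * norm x \<le> r" using m(2)[of x] by simp
    then show "x \<in> cball 0 (r / m)" using m(1) by (simp add: field_simps)
  qed
  ultimately have "compact {x. N x \<le> r}"
    using bounded_subset[OF bounded_cball] compact_eq_bounded_closed by blast
  moreover have "convex {x. N x \<le> r}" using convex_disk_set[of 0 r] by simp
  moreover have "open {x. N x < r}" by (intro open_Collect_less continuous_N continuous_on_const)
  then have "{x. N x < r} \<subseteq> interior {x. N x \<le> r}" by (intro interior_maximal) auto
  then have "0 \<in> interior {x. N x \<le> r}" using assms by auto
  ultimately show ?thesis unfolding convex_disk_def by blast
qed

lemma nearest_hull_diameter:
  assumes "x \<in> convex hull (nearest V c)" "y \<in> convex hull (nearest V c)" "dist_to V c \<le> \<rho>"
    and m: "m > 0" "\<And>x. m * norm x \<le> N x"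
  shows "norm (x - y) \<le> 2 * \<rho> / m"
proof -
  have "m * norm (x - y) \<le> N (x - y)" by (rule m(2))
  also have "\<dots> \<le> N (x - c) + N (c - y)" by (rule tri3)
  also have "\<dots> \<le> \<rho> + \<rho>"
    using nearest_hull_in_disk[OF assms(1)] nearest_hull_in_disk[OF assms(2)] assms(3) commute[of c y] by linarith
  finally show ?thesis using m(1) by (simp add: field_simps)
qed

text \<open>The Delaunay disks have radius at most 1 because \<open>V\<close> covers, so each
  triangle of vertices is a translate of one inscribed in the unit ball and has area at most
  \<open>D / 2\<close>. The polygons cover the disk and have at most \<open>2 * card A\<close>
  triangles in total.\<close>

lemma covering_density_ge:
  assumes cv: "cv {x. N x \<le> 1} V" and D: "D > 0"
    and mx: "\<And>x y z. N x \<le> 1 \<Longrightarrow> N y \<le> 1 \<Longrightarrow> N z \<le> 1 \<Longrightarrow> \<bar>cross (y - x) (z - x)\<bar> \<le> D"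
  shows "ennreal (area {x. N x \<le> 1} / D) \<le> density_of_covering (translates {x. N x \<le> 1} V)"
proof -
  let ?K = "{x. N x \<le> 1}"
  have K: "convex_disk ?K" by (rule convex_disk_unit) simp
  show ?thesis
  proof (cases "loc_finite V")
    case False
    then obtain R where R: "infinite (V \<inter> cball 0 R)" unfolding loc_finite_def by blast
    have inf: "infinite (V \<inter> cball 0 (r + \<bar>R\<bar>))" if "r > 0" for r
    proof -
      have "V \<inter> cball 0 R \<subseteq> V \<inter> cball 0 (r + \<bar>R\<bar>)" using that by (intro Int_mono subset_cball) auto
      then show ?thesis using R finite_subset by blast
    qed
    \<comment> \<open>The counting premise speaks of finite counts only and is vacuous here.\<close>
    have "ennreal (area ?K * 1 / D) \<le> density_of_covering (translates ?K V)"
      using inf by (intro density_ge_count(1)[OF K D, where d = "\<bar>R\<bar>"]) auto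
    then show ?thesis by simp
  next
    case V: True
    have \<rho>: "\<exists>v\<in>V. N (v - c) \<le> 1" for c using cv commute unfolding cv_def by fastforce
    have d1: "dist_to V c \<le> 1" for c using \<rho>[of c] dist_to_le order_trans by blast
    obtain m where m: "m > 0" "\<And>x. m * norm x \<le> N x" using lower_bound by blast
    obtain u where u: "u \<noteq> 0" "inj_on (\<lambda>v. u \<bullet> v) V" using generic_direction[OF V] .
    define d where "d = 2 * 1 / m"
    have count: "1 * disk_area r \<le> card (V \<inter> cball 0 (r + d)) * D" if r: "r > 0" for r
    proof -
      define A where "A = V \<inter> cball 0 (r + d)"
      define Q' where "Q' = {W. \<exists>c. W = nearest V c \<and> convex hull W \<inter> cball 0 r \<noteq> {}}"
      \<comment> \<open>Degenerate polygons may be needed to cover the disk but have area 0;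
        triangles are counted in the others.\<close>
      define Q where "Q = {W\<in>Q'. interior (convex hull W) \<noteq> {}}"
      have fA: "finite A" using V by (simp add: A_def loc_finite_def)
      have Q'A: "W \<subseteq> A" if "W \<in> Q'" for W
      proof
        fix v assume v: "v \<in> W"
        obtain c where c1: "W = nearest V c" "convex hull W \<inter> cball 0 r \<noteq> {}" using \<open>W \<in> Q'\<close> unfolding Q'_def by blast
        then obtain x where "x \<in> convex hull W" "norm x \<le> r" by auto
        note c = c1(1) this
        have "norm (v - x) \<le> d"
          unfolding d_def using c hull_inc[OF v, of convex]
          by (intro nearest_hull_diameter[OF _ _ d1[of c] m]) auto
        then have "norm v \<le> r + d" using c(3) norm_triangle_sub[of v x] by simp
        then show "v \<in> A" using v c(1) by (auto simp: A_def nearest_def)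
      qed
      then have "Q' \<subseteq> Pow A" by blast
      then have fQ': "finite Q'" using fA finite_subset by blast
      have fW: "finite W" if "W \<in> Q'" for W using Q'A[OF that] fA finite_subset by blast
      have "cball 0 r \<subseteq> (\<Union>W\<in>Q'. convex hull W)"
      proof
        fix x :: "real^2" assume x: "x \<in> cball 0 r"
        obtain c where "x \<in> convex hull (nearest V c)" by (rule hull_nearest_cover[OF V \<rho>])
        then show "x \<in> (\<Union>W\<in>Q'. convex hull W)" using x unfolding Q'_def by blast
      qed
      then have "disk_area r \<le> area (\<Union>W\<in>Q'. convex hull W)"
        unfolding disk_area_def using fQ' fW lmeasurable_hull
        by (intro measure_mono_fmeasurable fmeasurable.finite_UN) auto
      also have "\<dots> \<le> (\<Sum>W\<in>Q'. area (convex hull W))"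
        using fQ' fW lmeasurable_hull by (intro measure_UNION_le) (auto intro: fmeasurableD)
      also have "\<dots> = (\<Sum>W\<in>Q. area (convex hull W))"
      proof (rule sum.mono_neutral_right[OF fQ'])
        show "\<forall>W\<in>Q' - Q. area (convex hull W) = 0"
          using negligible_convex_interior[OF convex_convex_hull] negligible_imp_measure0
          by (auto simp: Q_def)
      qed (auto simp: Q_def)
      also have "\<dots> \<le> (\<Sum>W\<in>Q. card (middle u W) * (D / 2))"
      proof (rule sum_mono)
        fix W assume W: "W \<in> Q"
        then have W': "W \<in> Q'" "interior (convex hull W) \<noteq> {}" by (auto simp: Q_def)
        obtain c where c: "W = nearest V c" using W' by (auto simp: Q'_def)
        have WV: "W \<subseteq> V" by (auto simp: c nearest_def)
        have "\<not> card W \<le> 1"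
        proof
          assume "card W \<le> 1"
          then have eq: "\<forall>x\<in>W. \<forall>y\<in>W. x = y" using card_le_Suc0_iff_eq[OF fW[OF W'(1)]] by simp
          obtain w where "W \<subseteq> {w}"
          proof (cases "W = {}")
            case False
            then obtain w where "w \<in> W" by blast
            then show thesis using that[of w] eq by blast
          qed (use that in blast)
          then have "convex hull W \<subseteq> {w}" by (intro hull_minimal) auto
          then have "interior (convex hull W) \<subseteq> interior {w}" by (rule interior_mono)
          then show False using W'(2) by simp
        qed
        then have c2: "card W \<ge> 2" by simp
        have in1: "N (x - c) \<le> 1" if "x \<in> W" for x
          using dist_to_nearest[of x V c] d1[of c] that c by simp
        have tri: "area (convex hull {x, y, z}) \<le> D / 2" if "x \<in> W" "y \<in> W" "z \<in> W" for x y z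
          using mx[OF in1[OF that(1)] in1[OF that(2)] in1[OF that(3)]] by (simp add: area_triangle)
        have "D / 2 \<ge> 0" using D by simp
        from area_hull_le[OF fW[OF W'(1)] c2 this tri]
        have "area (convex hull W) \<le> (card W - 2) * (D / 2)" by simp
        then show "area (convex hull W) \<le> card (middle u W) * (D / 2)"
          using card_middle[OF fW[OF W'(1)] c2 inj_on_subset[OF u(2) WV]] by simp
      qed
      also have "\<dots> = (\<Sum>W\<in>Q. card (middle u W)) * (D / 2)" by (simp add: sum_distrib_right)
      also have "\<dots> \<le> (2 * card A) * (D / 2)"
      proof -
        have QQ: "Q \<subseteq> Q'" unfolding Q_def by blast
        have "finite Q" using finite_subset[OF QQ fQ'] .
        moreover have "\<Union>Q \<subseteq> A" using QQ Q'A by blast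
        moreover have "Q \<subseteq> delaunay V" unfolding Q_def Q'_def delaunay_def by blast
        ultimately have "Q \<subseteq> delaunay V" "finite Q" "\<Union>Q \<subseteq> A" by blast+
        then have "(\<Sum>W\<in>Q. card (middle u W)) \<le> 2 * card A" using delaunay_count_le[OF V u(1) _ _ fA] by blast
        then have "real (\<Sum>W\<in>Q. card (middle u W)) \<le> real (2 * card A)" by (rule of_nat_mono)
        then show ?thesis using D by (intro mult_right_mono) auto
      qed
      finally show ?thesis by (simp add: A_def)
    qed
    have "ennreal (area ?K * 1 / D) \<le> density_of_covering (translates ?K V)"
      using count m(1) by (intro density_ge_count(1)[OF K D, where d = d]) (auto simp: d_def)
    then show ?thesis by simp
  qed
qed

lemma cov_density_unit_ball: "cov_density is_lattice {x. N x \<le> 1} \<le> cov_density (\<lambda>_. True) {x. N x \<le> 1}"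
proof -
  let ?K = "{x. N x \<le> 1}"
  have K: "convex_disk ?K" by (rule convex_disk_unit) simp
  have cK: "compact ?K" "?K \<noteq> {}" "convex ?K" using K convex_disk_nonempty[OF K] by (auto simp: convex_disk_def)
  obtain a q r where pqr: "a \<in> ?K" "q \<in> ?K" "r \<in> ?K"
    and mx: "\<And>x y z. x \<in> ?K \<Longrightarrow> y \<in> ?K \<Longrightarrow> z \<in> ?K \<Longrightarrow> \<bar>cross (y - x) (z - x)\<bar> \<le> \<bar>cross (q - a) (r - a)\<bar>"
    using max_triangle[OF cK(1,2)] by metis
  have "cross (q - a) (r - a) \<noteq> 0"
  proof -
    obtain x y z where "x \<in> ?K" "y \<in> ?K" "z \<in> ?K" "cross (y - x) (z - x) \<noteq> 0"
      using nonzero_cross_in_disk[OF K] by metis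
    then show ?thesis using mx[of x y z] by auto
  qed
  \<comment> \<open>The last two vertices are exchanged if necessary, to get positive
    orientation.\<close>
  then obtain b c where bc: "b \<in> ?K" "c \<in> ?K" "cross (b - a) (c - a) > 0"
    "\<bar>cross (q - a) (r - a)\<bar> = cross (b - a) (c - a)"
  proof (cases "cross (q - a) (r - a) > 0")
    case True
    then show ?thesis using that[of q r] pqr by simp
  next
    case False
    then show ?thesis
      using that[of r q] pqr cross_commute[of "q - a" "r - a"] \<open>cross (q - a) (r - a) \<noteq> 0\<close> by simp
  qed
  define L where "L = lin (b - a) (c - a) ` int_points"
  have ne: "cross (b - a) (c - a) \<noteq> 0" using bc(3) by simp
  have "cv ?K L"
    unfolding L_def
    by (rule max_triangle_lattice_covers[OF cK(3) _ pqr(1) bc(1,2) _ bc(3)]) (use mx bc(4) in auto)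
  moreover have "is_lattice L" using ne is_lattice_iff L_def by blast
  ultimately have "cov_density is_lattice ?K \<le> density_of_covering (translates ?K L)"
    unfolding cov_density_def by (intro INF_lower) auto
  also have "\<dots> = ennreal (area ?K / cross (b - a) (c - a))"
    unfolding L_def using lattice_density(2)[OF K ne] bc(3) by simp
  also have "\<dots> \<le> cov_density (\<lambda>_. True) ?K"
    unfolding cov_density_def[of "\<lambda>_. True"]
  proof (rule INF_greatest)
    fix V assume "V \<in> {V. True \<and> cv ?K V}"
    then show "ennreal (area ?K / cross (b - a) (c - a)) \<le> density_of_covering (translates ?K V)"
      using mx bc(4) by (intro covering_density_ge bc(3)) auto
  qed
  finally show ?thesis .
qed

end

section \<open>Packings by a symmetric disk\<close>

context strict_norm
begin

text \<open>If \<open>\<bar>i\<bar> \<noteq> \<bar>j\<bar>\<close>, the triangle inequality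
  suffices. Multiples of \<open>e - f\<close> are clear, and \<open>e + f\<close> has norm at least
  1 because its sum with \<open>e - f\<close> is twice \<open>e\<close>.\<close>

lemma lattice_norm_ge_1:
  assumes ef: "N e = 1" "N f = 1" "N (e - f) = 1" and z: "z \<in> int_points" "z \<noteq> 0"
  shows "N (lin e f z) \<ge> 1"
proof -
  obtain i j :: int where ij: "z $ 1 = of_int i" "z $ 2 = of_int j"
    using z(1) by (auto simp: int_points_def elim!: Ints_cases)
  have nz: "i \<noteq> 0 \<or> j \<noteq> 0" using z(2) ij by (auto simp: vec2_eq_iff)
  have 1: "\<bar>real_of_int i\<bar> - \<bar>real_of_int j\<bar> \<le> N (lin e f z)"
    using tri[of "lin e f z" "- (real_of_int j *\<^sub>R f)"] ef by (simp add: lin_def ij hom)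
  have 2: "\<bar>real_of_int j\<bar> - \<bar>real_of_int i\<bar> \<le> N (lin e f z)"
    using tri[of "lin e f z" "- (real_of_int i *\<^sub>R e)"] ef by (simp add: lin_def ij hom)
  consider "\<bar>i\<bar> \<noteq> \<bar>j\<bar>" | "i = j" | "i = - j" by linarith
  then show ?thesis
  proof cases
    case 1
    then have "\<bar>i\<bar> - \<bar>j\<bar> \<ge> 1 \<or> \<bar>j\<bar> - \<bar>i\<bar> \<ge> 1" by linarith
    then have "real_of_int (\<bar>i\<bar> - \<bar>j\<bar>) \<ge> 1 \<or> real_of_int (\<bar>j\<bar> - \<bar>i\<bar>) \<ge> 1" by linarith
    then show ?thesis using \<open>\<bar>real_of_int i\<bar> - \<bar>real_of_int j\<bar> \<le> N (lin e f z)\<close> 2 by auto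
  next
    case 2
    have "N (2 *\<^sub>R e) \<le> N (e + f) + N (e - f)"
      using tri[of "e + f" "e - f"] by (simp add: scaleR_2)
    then have p: "N (e + f) \<ge> 1" using ef by (simp add: hom)
    have "lin e f z = real_of_int i *\<^sub>R (e + f)" by (simp add: lin_def ij 2 scaleR_add_right)
    then have "N (lin e f z) = \<bar>real_of_int i\<bar> * N (e + f)" by (simp add: hom)
    moreover have "\<bar>real_of_int i\<bar> \<ge> 1" using nz 2 by linarith
    ultimately show ?thesis using mult_mono[of 1 "\<bar>real_of_int i\<bar>" 1 "N (e + f)"] p by simp
  next
    case 3
    have "lin e f z = real_of_int i *\<^sub>R (e - f)" by (simp add: lin_def ij 3 scaleR_diff_right)
    then have "N (lin e f z) = \<bar>real_of_int i\<bar>" using ef by (simp add: hom)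
    moreover have "\<bar>real_of_int i\<bar> \<ge> 1" using nz 3 by linarith
    ultimately show ?thesis by simp
  qed
qed

text \<open>Along the unit circle from \<open>e\<close> to \<open>- e\<close>, on the side given by
  \<open>\<sigma>\<close>, the distance to \<open>e\<close> runs continuously from 0 to 2 and takes
  the value 1.\<close>

lemma equilateral_exists:
  assumes e: "N e = 1" and \<sigma>: "\<sigma> \<noteq> 0"
  obtains f where "N f = 1" "N (f - e) = 1" "\<sigma> * cross e f > 0"
proof -
  have e0: "e \<noteq> 0" using e by auto
  define g where "g = \<sigma> *\<^sub>R rot e"
  have cg: "\<sigma> * cross e g > 0"
  proof -
    have "cross e (rot e) = e \<bullet> e" by (simp add: cross_def rot_def inner_vec2)
    then have "\<sigma> * cross e g = \<sigma>\<^sup>2 * (e \<bullet> e)" by (simp add: g_def cross_simps power2_eq_square)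
    then show ?thesis using e0 \<sigma> by simp
  qed
  define u where "u \<theta> = cos \<theta> *\<^sub>R e + sin \<theta> *\<^sub>R g" for \<theta> :: real
  have cu: "cross e (u \<theta>) = sin \<theta> * cross e g" for \<theta> by (simp add: u_def cross_simps)
  have cu2: "cross (u \<theta>) g = cos \<theta> * cross e g" for \<theta> by (simp add: u_def cross_simps)
  have "u \<theta> \<noteq> 0" for \<theta>
  proof
    assume "u \<theta> = 0"
    then have "sin \<theta> = 0" "cos \<theta> = 0" using cu[of \<theta>] cu2[of \<theta>] cg by (auto simp: cross_simps)
    then show False using sin_cos_squared_add[of \<theta>] by simp
  qed
  then have Nu: "N (u \<theta>) > 0" for \<theta> using pos by blast
  define h where "h \<theta> = (1 / N (u \<theta>)) *\<^sub>R u \<theta>" for \<theta>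
  have cont_u: "continuous_on {0..pi} u" unfolding u_def by (intro continuous_intros)
  have "continuous_on {0..pi} (\<lambda>\<theta>. N (h \<theta> - e))"
    unfolding h_def using Nu by (intro continuous_intros cont_u) (auto simp: less_imp_neq[symmetric])
  moreover have "N (h 0 - e) = 0" using e by (simp add: h_def u_def)
  moreover have "N (h pi - e) = 2"
  proof -
    have "h pi - e = - (2 *\<^sub>R e)" using e by (simp add: h_def u_def scaleR_2)
    then show ?thesis using e by (simp add: hom)
  qed
  ultimately obtain \<theta> where \<theta>: "0 \<le> \<theta>" "\<theta> \<le> pi" "N (h \<theta> - e) = 1"
    using IVT'[of "\<lambda>\<theta>. N (h \<theta> - e)" 0 1 pi] by auto
  have "\<theta> \<noteq> 0" "\<theta> \<noteq> pi" using \<theta>(3) \<open>N (h 0 - e) = 0\<close> \<open>N (h pi - e) = 2\<close> by auto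
  then have "sin \<theta> > 0" using \<theta> by (intro sin_gt_zero) auto
  moreover have "\<sigma> * cross e (h \<theta>) = (sin \<theta> / N (u \<theta>)) * (\<sigma> * cross e g)"
    by (simp add: h_def cross_simps cu)
  ultimately have "\<sigma> * cross e (h \<theta>) > 0" using Nu[of \<theta>] cg by simp
  moreover have "N (h \<theta>) = 1" using Nu[of \<theta>] by (simp add: h_def hom)
  ultimately show ?thesis using that \<theta>(3) by blast
qed

text \<open>The directions of the two chords form a basis, in which the vector required by
  \<open>disks_cross\<close> has two components; the sign of each component selects the end of the
  chord to be used.\<close>

lemma crossing_segments:
  assumes r: "r1 \<ge> r2" "r2 > 0" "r1 \<noteq> r2"
    and b: "N (b - z1) \<le> r1" "N (b' - z1) \<le> r1" "N (b - z2) \<ge> r2" "N (b' - z2) \<ge> r2"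
    and c: "N (c - z2) \<le> r2" "N (c' - z2) \<le> r2" "N (c - z1) \<ge> r1" "N (c' - z1) \<ge> r1"
    and p: "p = (1 - \<phi>) *\<^sub>R b + \<phi> *\<^sub>R b'" "p = (1 - \<theta>) *\<^sub>R c + \<theta> *\<^sub>R c'"
      "0 < \<phi>" "\<phi> < 1" "0 < \<theta>" "\<theta> < 1"
    and ind: "cross (b' - b) (c' - c) \<noteq> 0"
  shows False
proof -
  have bne: "b \<noteq> b'" and cne: "c \<noteq> c'" using ind by (auto simp: cross_simps)
  have pz: "p - z1 = (1 - \<phi>) *\<^sub>R (b - z1) + \<phi> *\<^sub>R (b' - z1)" "p - z2 = (1 - \<theta>) *\<^sub>R (c - z2) + \<theta> *\<^sub>R (c' - z2)"
    unfolding p(1) by (simp add: algebra_simps, unfold p(1)[symmetric] p(2), simp add: algebra_simps)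
  have Np: "N (p - z1) < r1" "N (p - z2) < r2"
    unfolding pz using b c p bne cne by (auto intro!: strict)
  have pb: "b - p = (- \<phi>) *\<^sub>R (b' - b)" "b' - p = (1 - \<phi>) *\<^sub>R (b' - b)"
    unfolding p(1) by (simp_all add: algebra_simps)
  have pc: "c - p = (- \<theta>) *\<^sub>R (c' - c)" "c' - p = (1 - \<theta>) *\<^sub>R (c' - c)"
    unfolding p(2) by (simp_all add: algebra_simps)
  define w where "w = p - (z1 + (r1 / r2) *\<^sub>R (p - z2))"
  define s where "s = cross w (c' - c) / cross (b' - b) (c' - c)"
  define t where "t = cross (b' - b) w / cross (b' - b) (c' - c)"
  have w: "w = s *\<^sub>R (b' - b) + t *\<^sub>R (c' - c)" unfolding s_def t_def by (rule cross_expand[OF ind])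
  have "\<exists>x w1. (x = b \<or> x = b') \<and> w1 \<ge> 0 \<and> s *\<^sub>R (b' - b) = w1 *\<^sub>R (x - p)"
  proof (cases "s \<ge> 0")
    case True
    then show ?thesis using p(3-6) by (intro exI[of _ b'] exI[of _ "s / (1 - \<phi>)"]) (simp add: pb)
  next
    case False
    then show ?thesis using p(3-6) by (intro exI[of _ b] exI[of _ "- s / \<phi>"]) (simp add: pb divide_nonpos_pos)
  qed
  then obtain x w1 where x: "x = b \<or> x = b'" "w1 \<ge> 0" "s *\<^sub>R (b' - b) = w1 *\<^sub>R (x - p)" by blast
  have "\<exists>y w2. (y = c \<or> y = c') \<and> w2 \<ge> 0 \<and> t *\<^sub>R (c' - c) = - (w2 *\<^sub>R (y - p))"
  proof (cases "t \<ge> 0")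
    case True
    then show ?thesis using p(3-6) by (intro exI[of _ c] exI[of _ "t / \<theta>"]) (simp add: pc)
  next
    case False
    then show ?thesis using p(3-6) by (intro exI[of _ c'] exI[of _ "- t / (1 - \<theta>)"]) (simp add: pc divide_nonpos_pos)
  qed
  then obtain y w2 where y: "y = c \<or> y = c'" "w2 \<ge> 0" "t *\<^sub>R (c' - c) = - (w2 *\<^sub>R (y - p))" by blast
  have "w = w1 *\<^sub>R (x - p) - w2 *\<^sub>R (y - p)" unfolding w x(3) y(3) by simp
  then have weq: "p - (z1 + (r1 / r2) *\<^sub>R (p - z2)) = w1 *\<^sub>R (x - p) - w2 *\<^sub>R (y - p)" by (simp add: w_def)
  have "x \<noteq> y"
  proof
    assume "x = y"
    then have "cross (x - p) (y - p) = 0" by (simp add: cross_simps)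
    moreover obtain i where "i \<noteq> 0" "x - p = i *\<^sub>R (b' - b)"
    proof (cases "x = b")
      case True
      then show thesis using that[of "- \<phi>"] pb(1) p(3) by simp
    next
      case False
      then show thesis using that[of "1 - \<phi>"] pb(2) p(4) x(1) by simp
    qed
    moreover obtain j where "j \<noteq> 0" "y - p = j *\<^sub>R (c' - c)"
    proof (cases "y = c")
      case True
      then show thesis using that[of "- \<theta>"] pc(1) p(5) by simp
    next
      case False
      then show thesis using that[of "1 - \<theta>"] pc(2) p(6) y(1) by simp
    qed
    ultimately have "j * (i * cross (b' - b) (c' - c)) = 0" "i \<noteq> 0" "j \<noteq> 0"
      by (simp_all add: cross_simps(5,6))
    then show False using ind by simp
  qed
  have xs: "N (x - z1) \<le> r1" "N (x - z2) \<ge> r2" and ys: "N (y - z2) \<le> r2" "N (y - z1) \<ge> r1"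
    using x(1) y(1) b c by auto
  show False
    by (rule disks_cross[OF r(1,2) xs ys Np weq x(2) y(2) \<open>x \<noteq> y\<close>]) (use r(3) in simp)
qed

text \<open>Coordinates are taken with respect to the basis \<open>e, f\<close>.  The disks of radius \<open>\<nu>\<close> around
  \<open>P\<close> and of radius \<open>1\<close> around \<open>f\<close> share the boundary points \<open>0\<close> and \<open>e\<close>; on the side of \<open>f\<close> the
  first contains \<open>C\<close> but not the topmost point \<open>q\<close> of the second, whose interior misses \<open>C\<close>.\<close>

lemma flat_triangle_contradiction:
  assumes ef: "N e = 1" "N f = 1" "N (f - e) = 1" "cross e f \<noteq> 0"
    and xy: "0 < y" "y < 1" "x \<ge> 2 - y"
    and P: "N P = \<nu>" "N (P - e) = \<nu>" "N (P - (x *\<^sub>R e + y *\<^sub>R f)) = \<nu>" "\<nu> < 1"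
  shows False
proof -
  define C where "C = x *\<^sub>R e + y *\<^sub>R f"
  define ht where "ht v = cross e v / cross e f" for v
  define s where "s = cross P f / cross e f"
  define t where "t = ht P"
  have Pst: "P = s *\<^sub>R e + t *\<^sub>R f" unfolding s_def t_def ht_def by (rule cross_expand[OF ef(4)])
  have ht: "ht (a + b) = ht a + ht b" "ht (a - b) = ht a - ht b" "ht (k *\<^sub>R a) = k * ht a"
    "ht e = 0" "ht f = 1" for a b k
    using ef(4) by (simp_all add: ht_def cross_simps add_divide_distrib diff_divide_distrib)
  have htC: "ht C = y" by (simp add: C_def ht)
  have nu: "\<nu> > 0"
  proof -
    have "N e \<le> N (e - P) + N P" using tri[of "e - P" P] by simp
    then show ?thesis using P(1,2) ef(1) commute[of e P] by simp
  qed
  \<comment> \<open>The center \<open>P\<close> cannot be higher than \<open>f\<close>: depending on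
    its position, \<open>P\<close> or \<open>P - e\<close> would have norm at least 1, hence more
    than \<open>\<nu>\<close>.\<close>
  have tle: "t \<le> 1"
  proof (rule ccontr)
    assume "\<not> t \<le> 1" then have t: "t > 1" by simp
    have A: "s \<ge> 0 \<Longrightarrow> False"
    proof -
      assume "s \<ge> 0"
      have "(s + t) *\<^sub>R f = 1 *\<^sub>R P + s *\<^sub>R (f - e)" unfolding Pst by (simp add: algebra_simps)
      then have "N ((s + t) *\<^sub>R f) \<le> 1 * N P + s * N (f - e)" using comb2[of 1 s P "f - e"] \<open>s \<ge> 0\<close> by simp
      then have "s + t \<le> \<nu> + s" using ef P(1) \<open>s \<ge> 0\<close> t by (simp add: hom)
      then show False using t P(4) by simp
    qed
    have B: "s \<le> 0 \<Longrightarrow> s + t \<ge> 1 \<Longrightarrow> False"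
    proof -
      assume h: "s \<le> 0" "s + t \<ge> 1"
      have "t *\<^sub>R f = 1 *\<^sub>R P + (- s) *\<^sub>R e" unfolding Pst by (simp add: algebra_simps)
      then have "N (t *\<^sub>R f) \<le> 1 * N P + (- s) * N e" using comb2[of 1 "- s" P e] h by simp
      then have "t \<le> \<nu> - s" using ef P(1) t by (simp add: hom)
      then show False using h P(4) by simp
    qed
    have D: "s + t \<le> 1 \<Longrightarrow> False"
    proof -
      assume h: "s + t \<le> 1"
      have "(1 - s) *\<^sub>R (f - e) = 1 *\<^sub>R (P - e) + (1 - s - t) *\<^sub>R f" unfolding Pst by (simp add: algebra_simps)
      then have "N ((1 - s) *\<^sub>R (f - e)) \<le> 1 * N (P - e) + (1 - s - t) * N f"
        using comb2[of 1 "1 - s - t" "P - e" f] h by simp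
      moreover have "1 - s \<ge> 0" using h t by simp
      ultimately have "1 - s \<le> \<nu> + (1 - s - t)" using ef P(2) by (simp add: hom)
      then show False using t P(4) by simp
    qed
    show False using A B D by linarith
  qed
  have Cf: "N (C - f) \<ge> 1"
  proof -
    have "x *\<^sub>R e = 1 *\<^sub>R (C - f) + (1 - y) *\<^sub>R f" unfolding C_def by (simp add: algebra_simps)
    then have "N (x *\<^sub>R e) \<le> 1 * N (C - f) + (1 - y) * N f" using comb2[of 1 "1 - y" "C - f" f] xy by simp
    then have "x \<le> N (C - f) + (1 - y)" using ef xy by (simp add: hom)
    then show ?thesis using xy by simp
  qed
  have "compact {v. N v \<le> 1}" "{v. N v \<le> 1} \<noteq> {}"
    using convex_disk_unit[of 1] convex_disk_nonempty by (auto simp: convex_disk_def)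
  moreover have "continuous_on {v. N v \<le> 1} ht" unfolding ht_def using ef(4) by (intro continuous_intros) auto
  ultimately obtain q0 where q0: "N q0 \<le> 1" "\<And>v. N v \<le> 1 \<Longrightarrow> ht v \<le> ht q0"
    using continuous_attains_sup[of "{v. N v \<le> 1}" ht] by blast
  define H where "H = ht q0"
  have H: "H \<ge> 1" unfolding H_def using q0(2)[of f] ef ht by simp
  define q where "q = f + q0"
  have htq: "ht q = 1 + H" by (simp add: q_def ht H_def)
  have qf: "N (q - f) \<le> 1" by (simp add: q_def q0)
  \<comment> \<open>The disk around \<open>P\<close> is smaller than the unit disk and its center is
    no higher than \<open>f\<close>, so it does not reach the height of \<open>q\<close>.\<close>
  have qP: "N (q - P) \<ge> \<nu>"
  proof (rule ccontr)
    assume "\<not> ?thesis"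
    moreover have "N ((1 / \<nu>) *\<^sub>R (q - P)) = (1 / \<nu>) * N (q - P)" unfolding hom using nu by simp
    ultimately have "N ((1 / \<nu>) *\<^sub>R (q - P)) \<le> 1" using nu by simp
    from q0(2)[OF this] have "(1 / \<nu>) * (ht q - ht P) \<le> H" by (simp add: ht H_def)
    then have "1 + H - t \<le> \<nu> * H" using nu by (simp add: htq t_def[symmetric] field_simps)
    moreover have "\<nu> * H < 1 * H" using P(4) H by (intro mult_strict_right_mono) auto
    ultimately show False using tle by simp
  qed
  define X where "X = cross q f / cross e f"
  define Y where "Y = 1 + H"
  have qXY: "q = X *\<^sub>R e + Y *\<^sub>R f"
    using cross_expand[OF ef(4), of q] htq by (simp add: X_def Y_def ht_def)
  have Y: "Y > y" "Y > 0" using H xy by (auto simp: Y_def)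
  have yY: "0 < y / Y" "y / Y < 1" using Y xy by auto
  have Cne: "C \<noteq> 0" "C \<noteq> e" "C \<noteq> q" using htC xy ht htq H by (auto simp: ht_def cross_simps)
  have c0: "N (0 - P) \<le> \<nu>" "N (0 - f) \<ge> 1" "N (0 - f) \<le> 1" "N (0 - P) \<ge> \<nu>" using P(1) ef by simp_all
  have ce: "N (e - P) \<le> \<nu>" "N (e - f) \<ge> 1" "N (e - f) \<le> 1" "N (e - P) \<ge> \<nu>"
    using P(2) ef commute by simp_all
  have cC: "N (C - P) \<le> \<nu>" using P(3) commute[of C P] by (simp add: C_def)
  have coords: "cross (a *\<^sub>R e + b *\<^sub>R f) (a' *\<^sub>R e + b' *\<^sub>R f) = (a * b' - b * a') * cross e f" for a b a' b'
    by (simp add: cross_def algebra_simps)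
  have r: "1 \<ge> \<nu>" "1 \<noteq> \<nu>" using P(4) by auto
  \<comment> \<open>At height \<open>y\<close> the triangle \<open>0, e, q\<close> extends from
    \<open>X * (y / Y)\<close> to \<open>1 + (X - 1) * (y / Y)\<close>. To the right of it, the
    segment from \<open>0\<close> to \<open>C\<close> crosses the one from \<open>e\<close> to
    \<open>q\<close>; to the left, the segment from \<open>e\<close> to \<open>C\<close> crosses the
    one from \<open>0\<close> to \<open>q\<close>; in between, \<open>C\<close> would be inside the
    unit disk around \<open>f\<close>.\<close>
  consider (right) "x > 1 + (X - 1) * (y / Y)" | (left) "x < X * (y / Y)"
    | (mid) "X * (y / Y) \<le> x" "x \<le> 1 + (X - 1) * (y / Y)" by linarith
  then show False
  proof cases
    case right
    define d where "d = x - (X - 1) * (y / Y)"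
    have d: "d > 1" using right by (simp add: d_def)
    \<comment> \<open>The crossing point has parameter \<open>\<theta>\<close> on the segment from
      \<open>0\<close> to \<open>C\<close> and parameter \<open>\<phi>\<close> on the segment from
      \<open>e\<close> to \<open>q\<close>.\<close>
    define \<theta> where "\<theta> = 1 / d"
    have \<theta>: "0 < \<theta>" "\<theta> < 1" "\<theta> * d = 1" using d by (simp_all add: \<theta>_def)
    define \<phi> where "\<phi> = \<theta> * (y / Y)"
    have "\<theta> * (y / Y) < 1 * 1"
      by (rule mult_strict_mono) (use \<theta> yY in \<open>simp_all add: less_imp_le\<close>)
    then have \<phi>: "0 < \<phi>" "\<phi> < 1"
      unfolding \<phi>_def using mult_pos_pos[OF \<theta>(1) yY(1)] by simp_all
    have \<phi>Y: "\<phi> * Y = \<theta> * y" using Y by (simp add: \<phi>_def)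
    have \<theta>x: "\<theta> * x = 1 + \<phi> * (X - 1)" using \<theta>(3) by (simp add: d_def \<phi>_def algebra_simps)
    have e1: "(1 - \<phi>) *\<^sub>R e + \<phi> *\<^sub>R q = (1 + \<phi> * (X - 1)) *\<^sub>R e + (\<phi> * Y) *\<^sub>R f"
      unfolding qXY by (simp add: algebra_simps)
    have e2: "(1 - \<theta>) *\<^sub>R 0 + \<theta> *\<^sub>R C = (1 - \<phi>) *\<^sub>R e + \<phi> *\<^sub>R q"
      unfolding e1 \<phi>Y \<theta>x[symmetric] by (simp add: C_def scaleR_add_right)
    have "cross (q - e) (C - 0) = ((X - 1) * y - Y * x) * cross e f"
      using coords[of "X - 1" Y x y] by (simp add: qXY C_def algebra_simps)
    moreover have "(X - 1) * y - Y * x = - Y * d" using Y by (simp add: d_def field_simps)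
    ultimately have "cross (q - e) (C - 0) \<noteq> 0" using Y d ef(4) by simp
    then show False
      using crossing_segments[of \<nu> 1 e f q P 0 C "(1 - \<phi>) *\<^sub>R e + \<phi> *\<^sub>R q" \<phi> \<theta>] r nu ce qf qP c0 cC Cf \<phi> \<theta> e2
      by simp
  next
    case left
    define d where "d = X * (y / Y) - x + 1"
    have d: "d > 1" using left by (simp add: d_def)
    define \<theta> where "\<theta> = 1 / d"
    have \<theta>: "0 < \<theta>" "\<theta> < 1" "\<theta> * d = 1" using d by (simp_all add: \<theta>_def)
    define \<phi> where "\<phi> = \<theta> * (y / Y)"
    have "\<theta> * (y / Y) < 1 * 1"
      by (rule mult_strict_mono) (use \<theta> yY in \<open>simp_all add: less_imp_le\<close>)
    then have \<phi>: "0 < \<phi>" "\<phi> < 1"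
      unfolding \<phi>_def using mult_pos_pos[OF \<theta>(1) yY(1)] by simp_all
    have \<phi>Y: "\<phi> * Y = \<theta> * y" using Y by (simp add: \<phi>_def)
    have \<phi>X: "\<phi> * X = 1 + \<theta> * (x - 1)" using \<theta>(3) by (simp add: d_def \<phi>_def algebra_simps)
    have e1: "(1 - \<theta>) *\<^sub>R e + \<theta> *\<^sub>R C = (1 + \<theta> * (x - 1)) *\<^sub>R e + (\<theta> * y) *\<^sub>R f"
      unfolding C_def by (simp add: algebra_simps)
    have e2: "(1 - \<theta>) *\<^sub>R e + \<theta> *\<^sub>R C = (1 - \<phi>) *\<^sub>R 0 + \<phi> *\<^sub>R q"
      unfolding e1 \<phi>Y[symmetric] \<phi>X[symmetric] by (simp add: qXY scaleR_add_right)
    have "cross (q - 0) (C - e) = (X * y - Y * (x - 1)) * cross e f"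
      using coords[of X Y "x - 1" y] by (simp add: qXY C_def algebra_simps)
    moreover have "X * y - Y * (x - 1) = Y * d" using Y by (simp add: d_def field_simps)
    ultimately have "cross (q - 0) (C - e) \<noteq> 0" using Y d ef(4) by simp
    then show False
      using crossing_segments[of \<nu> 1 0 f q P e C "(1 - \<theta>) *\<^sub>R e + \<theta> *\<^sub>R C" \<phi> \<theta>] r nu ce qf qP c0 cC Cf \<phi> \<theta> e2
      by simp
  next
    case mid
    define k where "k = x - X * (y / Y)"
    have "(X - 1) * (y / Y) = X * (y / Y) - y / Y" by (simp only: left_diff_distrib mult_1)
    then have k: "k \<ge> 0" "k + y / Y \<le> 1" using mid unfolding k_def by linarith+
    have "C - 0 = k *\<^sub>R (e - 0) + (y / Y) *\<^sub>R (q - 0)"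
      unfolding C_def qXY k_def using Y by (simp add: algebra_simps)
    then have "C \<in> convex hull {0, e, q}" using k yY by (intro mem_triangle[of k "y / Y"]) auto
    moreover have "convex hull {0, e, q} \<subseteq> {0, e, q} \<union> {v. N (v - f) < 1}"
      using c0 ce qf by (intro hull_on_circle) auto
    ultimately show False using Cne Cf by auto
  qed
qed

text \<open>The hexagon with vertices \<open>e\<close>, \<open>f\<close>, \<open>f - e\<close> and
  their negatives lies in the unit ball. At height \<open>y\<close> its interior spans
  \<open>-1 < x < 1 - y\<close>; a second copy, centered at \<open>e\<close>, extends this to
  \<open>x < 2 - y\<close>.\<close>

lemma hexagon_bound:
  assumes ef: "N e = 1" "N f = 1" "N (f - e) = 1"
    and xy: "0 < y" "y < 1" and C: "N (x *\<^sub>R e + y *\<^sub>R f) \<ge> 1" "N (x *\<^sub>R e + y *\<^sub>R f - e) \<ge> 1"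
  shows "x \<ge> 2 - y \<or> x \<le> - 1"
proof (rule ccontr)
  assume "\<not> ?thesis"
  then have x: "x < 2 - y" "x > - 1" by auto
  have upper: "N (a *\<^sub>R e + y *\<^sub>R f) < 1" if a: "- 1 < a" "a < 1 - y" for a
  proof -
    consider "a \<ge> 0" | "a < 0" "a + y \<ge> 0" | "a + y < 0" using xy by linarith
    then show ?thesis
    proof cases
      case 1
      then have "N (a *\<^sub>R e + y *\<^sub>R f) \<le> a * N e + y * N f" using xy by (intro comb2) auto
      then show ?thesis using ef a by simp
    next
      case 2
      have "a *\<^sub>R e + y *\<^sub>R f = (a + y) *\<^sub>R f + (- a) *\<^sub>R (f - e)" by (simp add: algebra_simps)
      then have "N (a *\<^sub>R e + y *\<^sub>R f) \<le> (a + y) * N f + (- a) * N (f - e)"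
        using comb2[of "a + y" "- a" f "f - e"] 2 by simp
      then show ?thesis using ef xy by simp
    next
      case 3
      have "a *\<^sub>R e + y *\<^sub>R f = y *\<^sub>R (f - e) + (- (a + y)) *\<^sub>R (- e)" by (simp add: algebra_simps)
      then have "N (a *\<^sub>R e + y *\<^sub>R f) \<le> y * N (f - e) + (- (a + y)) * N (- e)"
        using comb2[of y "- (a + y)" "f - e" "- e"] 3 xy by simp
      then show ?thesis using ef a by simp
    qed
  qed
  have eq: "x *\<^sub>R e + y *\<^sub>R f - e = (x - 1) *\<^sub>R e + y *\<^sub>R f" by (simp add: algebra_simps)
  have "\<not> x < 1 - y" using upper[of x] C(1) x by linarith
  moreover have "\<not> (- 1 < x - 1 \<and> x - 1 < 1 - y)" using upper[of "x - 1"] C(2)[unfolded eq] by linarith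
  ultimately show False using x xy by linarith
qed

text \<open>Of three points on a line, the middle one would be strictly inside the circle.\<close>

lemma not_collinear_on_circle:
  assumes "N P = \<nu>" "N (P - e) = \<nu>" "N (P - x *\<^sub>R e) = \<nu>" "x \<noteq> 0" "x \<noteq> 1" "e \<noteq> 0"
  shows False
proof -
  have mid: False if h: "N (a - P) = \<nu>" "N (b - P) = \<nu>" "N ((1 - t) *\<^sub>R a + t *\<^sub>R b - P) = \<nu>" "a \<noteq> b" "0 < t" "t < 1" for a b t
  proof -
    have "(1 - t) *\<^sub>R a + t *\<^sub>R b - P = (1 - t) *\<^sub>R (a - P) + t *\<^sub>R (b - P)" by (simp add: algebra_simps)
    then show False using strict[of "a - P" \<nu> "b - P" t] h by simp
  qed
  have c: "N (0 - P) = \<nu>" "N (e - P) = \<nu>" "N (x *\<^sub>R e - P) = \<nu>" using assms(1-3) commute by simp_all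
  have xe: "x *\<^sub>R e \<noteq> e" using assms(5,6) scaleR_cancel_right[of x e 1] by simp
  consider "x < 0" | "0 < x" "x < 1" | "x > 1" using assms(4,5) by linarith
  then show False
  proof cases
    case 1
    define t where "t = (- x) / (1 - x)"
    have t: "0 < t" "t < 1" "(1 - t) * x + t = 0" using 1 by (simp_all add: t_def field_simps)
    have "(1 - t) *\<^sub>R (x *\<^sub>R e) + t *\<^sub>R e = ((1 - t) * x + t) *\<^sub>R e" by (simp add: scaleR_add_left)
    then have "N ((1 - t) *\<^sub>R (x *\<^sub>R e) + t *\<^sub>R e - P) = \<nu>" using c(1) t(3) by simp
    then show False by (rule mid[OF c(3,2) _ xe t(1,2)])
  next
    case 2
    then show False using mid[of 0 e x] c assms(6) by simp
  next
    case 3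
    then show False using mid[of 0 "x *\<^sub>R e" "1 / x"] c assms(4,6) by simp
  qed
qed

text \<open>After scaling the shortest side to a unit vector \<open>e\<close>, let \<open>f\<close>
  complete an equilateral triangle on the side of the third vertex \<open>C\<close>. If
  \<open>C\<close> were lower than \<open>f\<close>, then \<open>hexagon_bound\<close> pushes it far
  to one side, and such a flat triangle contradicts a circumradius below 1. Thus the area is at
  least that of the equilateral triangle.\<close>

lemma empty_triangle_area:
  assumes adm: "\<And>e f. N e = 1 \<Longrightarrow> N f = 1 \<Longrightarrow> N (e - f) = 1 \<Longrightarrow> cross e f \<noteq> 0 \<Longrightarrow> \<bar>cross e f\<bar> \<ge> \<Delta>"
    and \<Delta>: "\<Delta> \<ge> 0"
    and circ: "N (a - p) = \<mu>" "N (b - p) = \<mu>" "N (c - p) = \<mu>" "\<mu> < 1"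
    and sep: "N (a - b) \<ge> 1" "N (a - c) \<ge> 1" "N (b - c) \<ge> 1"
    and short: "N (a - b) \<le> N (a - c)" "N (a - b) \<le> N (b - c)"
  shows "\<bar>cross (b - a) (c - a)\<bar> \<ge> \<Delta>"
proof -
  define l where "l = N (b - a)"
  have l: "l \<ge> 1" using sep(1) commute by (simp add: l_def)
  define e where "e = (1 / l) *\<^sub>R (b - a)"
  define C where "C = (1 / l) *\<^sub>R (c - a)"
  define P where "P = (1 / l) *\<^sub>R (p - a)"
  define \<nu> where "\<nu> = \<mu> / l"
  have mu: "\<mu> \<ge> 0" using circ(1) nonneg by metis
  have nu: "\<nu> < 1"
  proof -
    have "\<mu> < l" using circ(4) l by simp
    then show ?thesis using l by (simp add: \<nu>_def)
  qed
  have e1: "N e = 1" using l by (simp add: e_def hom l_def)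
  have C1: "N C \<ge> 1" using short(1) l commute[of a c] commute[of a b] by (simp add: C_def hom l_def)
  have "C - e = (1 / l) *\<^sub>R (c - b)" by (simp add: C_def e_def flip: scaleR_diff_right)
  then have Ce1: "N (C - e) \<ge> 1" using short(2) l commute[of b c] commute[of a b] by (simp add: hom l_def)
  have "P - e = (1 / l) *\<^sub>R (p - b)" "P - C = (1 / l) *\<^sub>R (p - c)"
    by (simp_all add: P_def C_def e_def flip: scaleR_diff_right)
  then have P: "N P = \<nu>" "N (P - e) = \<nu>" "N (P - C) = \<nu>"
    using circ l by (simp_all add: P_def hom \<nu>_def commute[of p])
  have cr: "cross (b - a) (c - a) = l\<^sup>2 * cross e C"
  proof -
    have ba: "b - a = l *\<^sub>R e" "c - a = l *\<^sub>R C" using l by (simp_all add: e_def C_def)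
    show ?thesis unfolding ba cross_simps(5,6) by (simp add: power2_eq_square)
  qed
  have e0: "e \<noteq> 0" using e1 by auto
  have nc: "cross e C \<noteq> 0"
  proof
    assume "cross e C = 0"
    then have "(e \<bullet> e) *\<^sub>R C = (e \<bullet> C) *\<^sub>R e" using rot_expand[of e C] by simp
    then have "(1 / (e \<bullet> e)) *\<^sub>R ((e \<bullet> e) *\<^sub>R C) = (1 / (e \<bullet> e)) *\<^sub>R ((e \<bullet> C) *\<^sub>R e)" by (rule arg_cong)
    then have Ceq: "C = ((e \<bullet> C) / (e \<bullet> e)) *\<^sub>R e" using e0 by simp
    define x where "x = (e \<bullet> C) / (e \<bullet> e)"
    have Cx: "C = x *\<^sub>R e" using Ceq by (simp add: x_def)
    have "x \<noteq> 0" using C1 by (auto simp: Cx)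
    moreover have "x \<noteq> 1" using Ce1 by (auto simp: Cx)
    ultimately show False using not_collinear_on_circle[OF P(1,2) P(3)[unfolded Cx]] e0 by blast
  qed
  obtain f where f: "N f = 1" "N (f - e) = 1" "cross e C * cross e f > 0"
    using equilateral_exists[OF e1 nc] by metis
  have cef: "cross e f \<noteq> 0" using f(3) by auto
  define x where "x = cross C f / cross e f"
  define y where "y = cross e C / cross e f"
  have Cxy: "C = x *\<^sub>R e + y *\<^sub>R f" unfolding x_def y_def by (rule cross_expand[OF cef])
  have y0: "y > 0" using f(3) by (auto simp: y_def zero_less_mult_iff divide_pos_pos divide_neg_neg)
  have "y \<ge> 1"
  proof (rule ccontr)
    assume "\<not> y \<ge> 1" then have y1: "y < 1" by simp
    consider "x \<ge> 2 - y" | "x \<le> - 1"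
      using hexagon_bound[OF e1 f(1,2) y0 y1] C1 Ce1 Cxy by auto
    then show False
    proof cases
      case 1
      show False by (rule flat_triangle_contradiction[OF e1 f(1,2) cef y0 y1 1 P(1,2) P(3)[unfolded Cxy] nu])
    next
      case 2
      \<comment> \<open>The ends of the side are exchanged: with origin \<open>e\<close> and basis
        \<open>- e\<close>, \<open>f - e\<close>, the third vertex has coordinates
        \<open>1 - x - y\<close> and \<open>y\<close>.\<close>
      have r1: "N (- e) = 1" "N (f - e) = 1" "N ((f - e) - (- e)) = 1" "cross (- e) (f - e) \<noteq> 0"
        using e1 f cef by (simp_all add: cross_simps)
      have r2: "1 - x - y \<ge> 2 - y" using 2 by simp
      have "(1 - x - y) *\<^sub>R (- e) + y *\<^sub>R (f - e) = C - e" unfolding Cxy by (simp add: algebra_simps)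
      then have r3: "N (P - e) = \<nu>" "N ((P - e) - (- e)) = \<nu>"
        "N ((P - e) - ((1 - x - y) *\<^sub>R (- e) + y *\<^sub>R (f - e))) = \<nu>" using P by simp_all
      show False by (rule flat_triangle_contradiction[OF r1 y0 y1 r2 r3 nu])
    qed
  qed
  have "\<Delta> \<le> \<bar>cross e f\<bar>" using adm[OF e1 f(1) _ cef] f(2) commute[of e f] by simp
  also have "\<dots> \<le> y * \<bar>cross e f\<bar>" using \<open>y \<ge> 1\<close> mult_right_mono[of 1 y "\<bar>cross e f\<bar>"] by simp
  also have "\<dots> = \<bar>cross e C\<bar>"
  proof -
    have "y * cross e f = cross e C" using cef by (simp add: y_def)
    then show ?thesis using y0 by (metis abs_mult abs_of_pos)
  qed
  also have "\<dots> \<le> l\<^sup>2 * \<bar>cross e C\<bar>"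
  proof -
    have "1 \<le> l\<^sup>2" using l by (simp add: one_le_power)
    then show ?thesis using mult_right_mono[of 1 "l\<^sup>2" "\<bar>cross e C\<bar>"] by simp
  qed
  also have "\<dots> = \<bar>cross (b - a) (c - a)\<bar>" unfolding cr by (simp add: abs_mult)
  finally show ?thesis .
qed

end

context strict_norm
begin

lemma pk_iff_separated:
  "pk {x. N x \<le> 1/2} V \<longleftrightarrow> (\<forall>v\<in>V. \<forall>w\<in>V. v \<noteq> w \<longrightarrow> N (v - w) \<ge> 1)"
proof
  assume pk: "pk {x. N x \<le> 1/2} V"
  show "\<forall>v\<in>V. \<forall>w\<in>V. v \<noteq> w \<longrightarrow> N (v - w) \<ge> 1"
  proof (intro ballI impI, rule ccontr)
    fix v w assume vw: "v \<in> V" "w \<in> V" "v \<noteq> w" and "\<not> N (v - w) \<ge> 1"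
    then have lt: "N (v - w) < 1" by simp
    have "open {x. N x < 1/2}" by (intro open_Collect_less continuous_N continuous_on_const)
    then have int: "{x. N x < 1/2} \<subseteq> interior {x. N x \<le> 1/2}" by (intro interior_maximal) auto
    define p where "p = (1/2) *\<^sub>R (v + w)"
    have "2 *\<^sub>R (p - v) = w - v" "2 *\<^sub>R (p - w) = v - w" by (simp_all add: p_def algebra_simps scaleR_2)
    then have "2 * N (p - v) = N (w - v)" "2 * N (p - w) = N (v - w)"
      using hom[of 2 "p - v"] hom[of 2 "p - w"] by simp_all
    then have "p - v \<in> interior {x. N x \<le> 1/2}" "p - w \<in> interior {x. N x \<le> 1/2}"
      using lt commute[of v w] int by auto
    then show False using pk vw unfolding pk_def by blast
  qed
next
  assume sep: "\<forall>v\<in>V. \<forall>w\<in>V. v \<noteq> w \<longrightarrow> N (v - w) \<ge> 1"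
  have "convex hull {x. N x \<le> 1/2} = {x. N x \<le> 1/2}"
    using convex_disk_set[of 0 "1/2"] by (simp add: hull_same)
  then have int: "N x < 1/2" if "x \<in> interior {x. N x \<le> 1/2}" for x
    using interior_hull_in_disk(1)[of x "{x. N x \<le> 1/2}" 0 "1/2"] that by simp
  show "pk {x. N x \<le> 1/2} V"
    unfolding pk_def
  proof (intro ballI allI impI, rule ccontr)
    fix v w x
    assume vw: "v \<in> V" "w \<in> V" "v \<noteq> w"
      and x: "x - v \<in> interior {x. N x \<le> 1/2}" "x - w \<in> interior {x. N x \<le> 1/2}"
    have "N (v - w) \<le> N (v - x) + N (x - w)" by (rule tri3)
    then have "N (v - w) < 1" using int[OF x(1)] int[OF x(2)] commute[of v x] by simp
    then show False using sep vw by force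
  qed
qed

text \<open>A maximal separated superset exists by Zorn's lemma, and a point at distance at least 1
  from all of it could be added. Saturation is what makes the circumradii of the Delaunay polygons
  less than 1.\<close>

lemma saturated_extension:
  assumes "\<forall>v\<in>V. \<forall>w\<in>V. v \<noteq> w \<longrightarrow> N (v - w) \<ge> 1"
  obtains U where "V \<subseteq> U" "\<forall>v\<in>U. \<forall>w\<in>U. v \<noteq> w \<longrightarrow> N (v - w) \<ge> 1" "\<And>x. \<exists>v\<in>U. N (v - x) < 1"
proof -
  let ?A = "{U. V \<subseteq> U \<and> (\<forall>v\<in>U. \<forall>w\<in>U. v \<noteq> w \<longrightarrow> N (v - w) \<ge> 1)}"
  have "\<exists>M\<in>?A. \<forall>X\<in>?A. M \<subseteq> X \<longrightarrow> X = M"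
  proof (rule subset_Zorn_nonempty)
    show "?A \<noteq> {}" using assms by blast
    fix C assume C: "C \<noteq> {}" "subset.chain ?A C"
    have CA: "C \<subseteq> ?A" and ch: "\<forall>X\<in>C. \<forall>Y\<in>C. X \<subseteq> Y \<or> Y \<subseteq> X"
      using C(2) unfolding subset_chain_def by (rule conjunct1, rule conjunct2)
    have "N (v - w) \<ge> 1" if vw: "v \<in> \<Union>C" "w \<in> \<Union>C" "v \<noteq> w" for v w
    proof -
      obtain X Y where XY: "X \<in> C" "Y \<in> C" "v \<in> X" "w \<in> Y" using vw(1,2) by blast
      have "X \<subseteq> Y \<or> Y \<subseteq> X" using ch XY(1,2) by simp
      then obtain Z where Z: "Z \<in> C" "v \<in> Z" "w \<in> Z"
      proof
        assume "X \<subseteq> Y"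
        show thesis by (rule that[OF XY(2) subsetD[OF \<open>X \<subseteq> Y\<close> XY(3)] XY(4)])
      next
        assume "Y \<subseteq> X"
        show thesis by (rule that[OF XY(1) XY(3) subsetD[OF \<open>Y \<subseteq> X\<close> XY(4)]])
      qed
      have "\<forall>v\<in>Z. \<forall>w\<in>Z. v \<noteq> w \<longrightarrow> N (v - w) \<ge> 1"
        using subsetD[OF CA Z(1)] by simp
      then show ?thesis using Z(2,3) vw(3) by simp
    qed
    moreover have "V \<subseteq> \<Union>C" using C(1) CA by blast
    ultimately show "\<Union>C \<in> ?A" by blast
  qed
  then obtain U where "U \<in> ?A" and max: "\<forall>X\<in>?A. U \<subseteq> X \<longrightarrow> X = U" by (rule bexE)
  then have U: "V \<subseteq> U" "\<forall>v\<in>U. \<forall>w\<in>U. v \<noteq> w \<longrightarrow> N (v - w) \<ge> 1" by simp_all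
  have "\<exists>v\<in>U. N (v - x) < 1" for x
  proof (rule ccontr)
    assume n: "\<not> ?thesis"
    have far: "N (v - x) \<ge> 1" if "v \<in> U" for v using n that by (meson not_le)
    have far': "N (x - v) \<ge> 1" if "v \<in> U" for v using far[OF that] commute[of x v] by simp
    have "\<forall>v\<in>insert x U. \<forall>w\<in>insert x U. v \<noteq> w \<longrightarrow> N (v - w) \<ge> 1"
      using U(2) far far' by (simp only: ball_insert) simp
    then have "insert x U \<in> ?A" using U(1) by (simp only: mem_Collect_eq) blast
    from bspec[OF max this] have "insert x U = U" by blast
    then have "x \<in> U" by blast
    from far[OF this] show False by simp
  qed
  with U show ?thesis by (rule that)
qed

text \<open>The polygons with a vertex in the disk contain at least two triangles per point, each of
  area at least \<open>\<Delta> / 2\<close>; they do not overlap and stay within the disk enlarged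
  by \<open>2 / m\<close>, a bound for their diameters.\<close>

lemma separated_count:
  fixes \<Delta> m :: real
  assumes sep: "\<forall>v\<in>U. \<forall>w\<in>U. v \<noteq> w \<longrightarrow> N (v - w) \<ge> 1" and sat: "\<And>x. \<exists>v\<in>U. N (v - x) < 1"
    and adm: "\<And>e f. N e = 1 \<Longrightarrow> N f = 1 \<Longrightarrow> N (e - f) = 1 \<Longrightarrow> cross e f \<noteq> 0 \<Longrightarrow> \<bar>cross e f\<bar> \<ge> \<Delta>"
    and \<Delta>: "\<Delta> > 0" and m: "m > 0" "\<And>x. m * norm x \<le> N x" and U: "loc_finite U"
  shows "card (U \<inter> cball 0 r) * \<Delta> \<le> disk_area (r + 2 / m)"
proof -
  have \<rho>: "\<exists>v\<in>U. N (v - c) \<le> 1" for c using sat[of c] by force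
  have d1: "dist_to U c < 1" for c
  proof -
    obtain v where "v \<in> U" "N (v - c) < 1" using sat by blast
    then show ?thesis using dist_to_le[of v U c] by simp
  qed
  obtain u where u: "u \<noteq> 0" "inj_on (\<lambda>v. u \<bullet> v) U" using generic_direction[OF U] .
  define A where "A = U \<inter> cball 0 r"
  define B where "B = U \<inter> cball 0 (r + 2 / m)"
  define Q where "Q = {W. \<exists>c. W = nearest U c \<and> W \<inter> A \<noteq> {} \<and> card W \<ge> 3}"
  have fA: "finite A" "finite B" using U by (auto simp: A_def B_def loc_finite_def)
  have hullB: "convex hull W \<subseteq> cball 0 (r + 2 / m)" if "W \<in> Q" for W
  proof
    fix x assume x: "x \<in> convex hull W"
    obtain c where c: "W = nearest U c" "W \<inter> A \<noteq> {}" using \<open>W \<in> Q\<close> unfolding Q_def by blast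
    then obtain v where v: "v \<in> W" "v \<in> A" by blast
    have "norm (x - v) \<le> 2 * 1 / m"
      using x hull_inc[OF v(1), of convex] d1[of c] unfolding c(1)
      by (intro nearest_hull_diameter[OF _ _ _ m]) auto
    moreover have "norm v \<le> r" using v(2) by (simp add: A_def)
    ultimately show "x \<in> cball 0 (r + 2 / m)" using norm_triangle_sub[of x v] by simp
  qed
  have QB: "W \<subseteq> B" if "W \<in> Q" for W
  proof -
    have "W \<subseteq> U" using that by (auto simp: Q_def nearest_def)
    moreover have "W \<subseteq> convex hull W" by (rule hull_subset)
    ultimately show ?thesis using hullB[OF that] unfolding B_def by blast
  qed
  then have "Q \<subseteq> Pow B" by blast
  then have fQ: "finite Q" using fA(2) finite_subset by blast
  have fW: "finite W" if "W \<in> Q" for W using QB[OF that] fA(2) finite_subset by blast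
  have "2 * card A \<le> (\<Sum>W\<in>Q. card (middle u W))"
  proof (rule delaunay_count_ge[OF U \<rho> u fA(1) _ fQ])
    show "A \<subseteq> U" by (simp add: A_def)
    show "nearest U c \<in> Q" if "nearest U c \<inter> A \<noteq> {}" "3 \<le> card (nearest U c)" for c
      unfolding Q_def using that by blast
    show "\<exists>c. W = nearest U c" if "W \<in> Q" for W using that unfolding Q_def by blast
  qed
  then have "real (2 * card A) \<le> real (\<Sum>W\<in>Q. card (middle u W))" by (rule of_nat_mono)
  then have "real (2 * card A) * (\<Delta> / 2) \<le> real (\<Sum>W\<in>Q. card (middle u W)) * (\<Delta> / 2)"
    using \<Delta> by (intro mult_right_mono) auto
  also have "\<dots> = (\<Sum>W\<in>Q. card (middle u W) * (\<Delta> / 2))" by (simp add: sum_distrib_right)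
  also have "\<dots> \<le> (\<Sum>W\<in>Q. area (convex hull W))"
  proof (rule sum_mono)
    fix W assume W: "W \<in> Q"
    then obtain c where c: "W = nearest U c" "card W \<ge> 3" unfolding Q_def by blast
    have WU: "W \<subseteq> U" by (auto simp: c nearest_def)
    have circ: "N (x - c) = dist_to U c" if "x \<in> W" for x using dist_to_nearest that c(1) by simp
    have sepW: "N (x - y) \<ge> 1" if "x \<in> W" "y \<in> W" "x \<noteq> y" for x y using sep WU that by blast
    have tri: "\<Delta> / 2 \<le> area (convex hull {x, y, z})"
      if xyz: "x \<in> W" "y \<in> W" "z \<in> W" "x \<noteq> y" "x \<noteq> z" "y \<noteq> z" for x y z
    proof -
      \<comment> \<open>\<open>empty_triangle_area\<close> wants the shortest side first; the area
        does not depend on the order of the vertices.\<close>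
      have short: "\<Delta> / 2 \<le> area (convex hull {a, b, d})"
        if h: "a \<in> W" "b \<in> W" "d \<in> W" "a \<noteq> b" "a \<noteq> d" "b \<noteq> d" "N (a - b) \<le> N (a - d)" "N (a - b) \<le> N (b - d)" for a b d
      proof -
        have "\<Delta> \<le> \<bar>cross (b - a) (d - a)\<bar>"
          using \<Delta> by (intro empty_triangle_area[OF adm _ circ[OF h(1)] circ[OF h(2)] circ[OF h(3)] d1]
              sepW h) auto
        then show ?thesis by (simp add: area_triangle)
      qed
      consider "N (x - y) \<le> N (x - z)" "N (x - y) \<le> N (y - z)"
        | "N (x - z) \<le> N (x - y)" "N (x - z) \<le> N (y - z)"
        | "N (y - z) \<le> N (x - y)" "N (y - z) \<le> N (x - z)" by linarith
      then show ?thesis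
      proof cases
        case 1
        then show ?thesis using short[of x y z] xyz by blast
      next
        case 2
        then have "\<Delta> / 2 \<le> area (convex hull {x, z, y})"
          using short[of x z y] xyz commute[of y z] by auto
        then show ?thesis by (simp add: insert_commute)
      next
        case 3
        then have "\<Delta> / 2 \<le> area (convex hull {y, z, x})"
          using short[of y z x] xyz commute[of y x] commute[of z x] by auto
        then show ?thesis by (simp add: insert_commute)
      qed
    qed
    have c2: "card W \<ge> 2" using c(2) by simp
    have "\<Delta> / 2 > 0" using \<Delta> by simp
    from area_hull_ge[OF fW[OF W] c2 this circ tri]
    have "real (card W - 2) * (\<Delta> / 2) \<le> area (convex hull W)" by simp
    then show "card (middle u W) * (\<Delta> / 2) \<le> area (convex hull W)"
      using card_middle[OF fW[OF W] c2 inj_on_subset[OF u(2) WU]] by simp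
  qed
  also have "\<dots> = area (\<Union>W\<in>Q. convex hull W)"
  proof (rule measure_negligible_finite_Union_image[symmetric, OF fQ])
    show "convex hull W \<in> lmeasurable" if "W \<in> Q" for W using fW[OF that] by (rule lmeasurable_hull)
    show "pairwise (\<lambda>W W'. negligible (convex hull W \<inter> convex hull W')) Q"
    proof (rule pairwiseI)
      fix W W' assume W: "W \<in> Q" "W' \<in> Q" "W \<noteq> W'"
      then obtain c c' where c: "W = nearest U c" "W' = nearest U c'" unfolding Q_def by blast
      have "interior (convex hull W) \<inter> interior (convex hull W') = {}"
        using nearest_disjoint[of U c c'] fW W unfolding c by blast
      then have "convex hull W \<inter> convex hull W' \<subseteq> frontier (convex hull W) \<union> frontier (convex hull W')"
        using closure_subset[of "convex hull W"] closure_subset[of "convex hull W'"]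
        unfolding frontier_def by blast
      moreover have "negligible (frontier (convex hull W) \<union> frontier (convex hull W'))"
        by (intro negligible_Un negligible_convex_frontier convex_convex_hull)
      ultimately show "negligible (convex hull W \<inter> convex hull W')" by (rule negligible_subset[rotated])
    qed
  qed
  also have "\<dots> \<le> area (cball 0 (r + 2 / m))"
  proof (rule measure_mono_fmeasurable)
    show "(\<Union>W\<in>Q. convex hull W) \<subseteq> cball 0 (r + 2 / m)" using hullB by blast
    have "(\<Union>W\<in>Q. convex hull W) \<in> lmeasurable"
      using fQ fW lmeasurable_hull by (intro fmeasurable.finite_UN) auto
    then show "(\<Union>W\<in>Q. convex hull W) \<in> sets lebesgue" by (rule fmeasurableD)
  qed simp
  finally show ?thesis by (simp add: A_def disk_area_def)
qed

lemma pack_density_unit_ball: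
  "pack_density (\<lambda>_. True) {x. N x \<le> 1/2} \<le> pack_density is_lattice {x. N x \<le> 1/2}"
proof -
  let ?K = "{x. N x \<le> 1/2}"
  have K: "convex_disk ?K" by (rule convex_disk_unit) simp
  have pos_area: "area ?K > 0" using convex_disk_area_pos[OF K] .
  obtain m where m: "m > 0" "\<And>x. m * norm x \<le> N x" using lower_bound by blast
  define \<delta> where "\<delta> = enn2real (pack_density is_lattice ?K)"
  have \<delta>: "ennreal \<delta> = pack_density is_lattice ?K" "\<delta> \<ge> 0"
    using pack_density_le_1[OF K, of is_lattice]
    by (auto simp: \<delta>_def ennreal_enn2real_if top_unique)
  have adm: "area ?K / \<bar>cross e f\<bar> \<le> \<delta>"
    if ef: "N e = 1" "N f = 1" "N (e - f) = 1" "cross e f \<noteq> 0" for e f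
  proof -
    define L where "L = lin e f ` int_points"
    have "pk ?K L"
      unfolding pk_iff_separated
    proof (intro ballI impI)
      fix v w assume "v \<in> L" "w \<in> L" "v \<noteq> w"
      then obtain z z' where z: "z \<in> int_points" "z' \<in> int_points" "v = lin e f z" "w = lin e f z'" "z \<noteq> z'"
        by (auto simp: L_def)
      then have "1 \<le> N (lin e f (z - z'))" by (intro lattice_norm_ge_1[OF ef(1-3)] int_points_simps) auto
      then show "1 \<le> N (v - w)" by (simp add: z lin_simps)
    qed
    moreover have "is_lattice L" using ef(4) is_lattice_iff L_def by blast
    ultimately have "density_of_packing (translates ?K L) \<le> ennreal \<delta>"
      unfolding \<delta>(1) pack_density_def by (intro SUP_upper) auto
    then have "ennreal (area ?K / \<bar>cross e f\<bar>) \<le> ennreal \<delta>"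
      unfolding L_def lattice_density(1)[OF K ef(4)] .
    then show ?thesis using \<delta>(2) by simp
  qed
  have "\<delta> > 0"
  proof -
    define e :: "real^2" where "e = (1 / N (axis 1 1)) *\<^sub>R axis 1 (1::real)"
    have "N (axis 1 1) > 0" by (rule pos) (simp add: axis_eq_0_iff)
    then have e: "N e = 1" by (simp add: e_def hom)
    obtain f where f: "N f = 1" "N (f - e) = 1" "1 * cross e f > 0"
      using equilateral_exists[OF e, of 1] by auto
    have "area ?K / \<bar>cross e f\<bar> > 0" using pos_area f(3) by simp
    then show ?thesis using adm[OF e f(1)] f commute[of e f] by simp
  qed
  \<comment> \<open>Defined through the lattice density in place of a minimum over equilateral
    triangles; by \<open>adm\<close> it is a lower bound for \<open>\<bar>cross e f\<bar>\<close> on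
    all of them.\<close>
  define \<Delta> where "\<Delta> = area ?K / \<delta>"
  have \<Delta>: "\<Delta> > 0" using pos_area \<open>\<delta> > 0\<close> by (simp add: \<Delta>_def)
  have adm': "\<Delta> \<le> \<bar>cross e f\<bar>" if "N e = 1" "N f = 1" "N (e - f) = 1" "cross e f \<noteq> 0" for e f
    using adm[OF that] \<open>\<delta> > 0\<close> that(4) by (simp add: \<Delta>_def field_simps)
  show ?thesis
    unfolding pack_density_def[of "\<lambda>_. True"]
  proof (rule SUP_least)
    fix V assume "V \<in> {V. True \<and> pk ?K V}"
    then have "pk ?K V" by blast
    then have sepV: "\<forall>v\<in>V. \<forall>w\<in>V. v \<noteq> w \<longrightarrow> N (v - w) \<ge> 1" unfolding pk_iff_separated .
    obtain U where U: "V \<subseteq> U" "\<forall>v\<in>U. \<forall>w\<in>U. v \<noteq> w \<longrightarrow> N (v - w) \<ge> 1" "\<And>x. \<exists>v\<in>U. N (v - x) < 1"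
      using saturated_extension[OF sepV] by metis
    have "pk ?K U" unfolding pk_iff_separated by (rule U(2))
    obtain R where R: "K \<subseteq> cball 0 R" if "K = ?K" for K using convex_disk_bounded[OF K] by metis
    have fin: "finite (U \<inter> cball 0 r)" for r using pk_count[OF K R[OF refl] \<open>pk ?K U\<close>] by blast
    then have lf: "loc_finite U" by (simp add: loc_finite_def)
    have "density_of_packing (translates ?K V) \<le> ennreal (area ?K * 1 / \<Delta>)"
    proof (rule density_le_count(1)[OF K \<Delta>, where d = "2 / m"])
      fix r :: real
      have sub: "V \<inter> cball 0 r \<subseteq> U \<inter> cball 0 r" using U(1) by blast
      have "real (card (V \<inter> cball 0 r)) * \<Delta> \<le> card (U \<inter> cball 0 r) * \<Delta>"
        using card_mono[OF fin sub] \<Delta> by (intro mult_right_mono) auto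
      also have "\<dots> \<le> disk_area (r + 2 / m)" by (rule separated_count[OF U(2,3) adm' \<Delta> m lf])
      finally show "finite (V \<inter> cball 0 r) \<and> card (V \<inter> cball 0 r) * \<Delta> \<le> 1 * disk_area (r + 2 / m)"
        using finite_subset[OF sub fin] by simp
    qed (use m in auto)
    also have "area ?K * 1 / \<Delta> = \<delta>" using pos_area by (simp add: \<Delta>_def)
    finally show "density_of_packing (translates ?K V) \<le> pack_density is_lattice ?K" by (simp add: \<delta>(1))
  qed
qed

end

section \<open>Equality of translative and lattice densities\<close>

text \<open>The gauge of \<open>K\<close>, obtained as the support function of the polar body
  \<open>P\<close>, which makes the triangle inequality immediate. That \<open>K\<close> is its unit
  ball is the bipolar theorem, proved by separation.\<close>

lemma symmetric_disk_norm:
  assumes K: "normal_position K" "uminus ` K = K"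
  obtains N where "\<And>x y. N (x + y) \<le> N x + N y" "\<And>a x. N (a *\<^sub>R x) = \<bar>a\<bar> * N x"
    "\<And>x. N x \<ge> 0" "K = {x. N x \<le> 1}"
proof -
  define P where "P = {u. \<forall>k\<in>K. u \<bullet> k \<le> 1}"
  define N where "N x = (SUP u\<in>P. x \<bullet> u)" for x
  have cK: "compact K" "convex K" "cball 0 (1/8) \<subseteq> K" using K by (auto simp: normal_position_def)
  have "P = (\<Inter>k\<in>K. {u. u \<bullet> k \<le> 1})" by (auto simp: P_def)
  then have "closed P" by (auto intro!: closed_INT closed_halfspace_component_le simp: inner_commute closed_halfspace_le)
  moreover have "P \<subseteq> cball 0 8"
  proof
    fix u assume u: "u \<in> P"
    show "u \<in> cball 0 8"
    proof (cases "u = 0")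
      case False
      \<comment> \<open>This multiple of \<open>u\<close> has norm 1/8; testing \<open>u\<close>
        against it forces \<open>norm u \<le> 8\<close>.\<close>
      have "(1 / (8 * norm u)) *\<^sub>R u \<in> K" using cK(3) False by (auto simp: subset_iff)
      then have "u \<bullet> ((1 / (8 * norm u)) *\<^sub>R u) \<le> 1" using u unfolding P_def by blast
      then show ?thesis using False by (simp add: dot_square_norm power2_eq_square)
    qed simp
  qed
  ultimately have cP: "compact P" using bounded_subset[OF bounded_cball] compact_eq_bounded_closed by blast
  have P0: "0 \<in> P" by (simp add: P_def)
  then have "P \<noteq> {}" by blast
  note sp = support_point[OF cP this]
  have at: "\<exists>u\<in>P. N x = x \<bullet> u" and ge: "u \<in> P \<Longrightarrow> x \<bullet> u \<le> N x" for x u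
    using sp[of x] by (auto simp: N_def)
  have symK: "- k \<in> K" if "k \<in> K" for k using K(2) that by blast
  have symP: "- u \<in> P" if "u \<in> P" for u
    unfolding P_def
  proof (rule CollectI, rule ballI)
    fix k assume "k \<in> K"
    then have "u \<bullet> (- k) \<le> 1" using symK that unfolding P_def by blast
    then show "- u \<bullet> k \<le> 1" by simp
  qed
  have N0: "N x \<ge> 0" for x using ge[OF P0, of x] by simp
  have tri: "N (x + y) \<le> N x + N y" for x y
  proof -
    obtain u where "u \<in> P" "N (x + y) = (x + y) \<bullet> u" using at by blast
    then show ?thesis using ge[of u x] ge[of u y] by (simp add: inner_add_left)
  qed
  have homle: "N (a *\<^sub>R x) \<le> \<bar>a\<bar> * N x" for a x
  proof -
    obtain u where u: "u \<in> P" "N (a *\<^sub>R x) = (a *\<^sub>R x) \<bullet> u" using at by blast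
    have "a * (x \<bullet> u) \<le> \<bar>a\<bar> * N x"
    proof (cases "a \<ge> 0")
      case True
      then show ?thesis using ge[OF u(1), of x] by (simp add: mult_left_mono)
    next
      case False
      then have "(- a) * (x \<bullet> (- u)) \<le> (- a) * N x"
        using ge[OF symP[OF u(1)], of x] by (intro mult_left_mono) auto
      then show ?thesis using False by simp
    qed
    then show ?thesis using u(2) by simp
  qed
  have hom: "N (a *\<^sub>R x) = \<bar>a\<bar> * N x" for a x
  proof (cases "a = 0")
    case True
    then show ?thesis using homle[of 0 x] N0[of 0] by simp
  next
    case False
    have "N x \<le> \<bar>1 / a\<bar> * N (a *\<^sub>R x)" using homle[of "1 / a" "a *\<^sub>R x"] False by simp
    then have "\<bar>a\<bar> * N x \<le> N (a *\<^sub>R x)" using False by (simp add: field_simps)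
    then show ?thesis using homle[of a x] by simp
  qed
  have "K = {x. N x \<le> 1}"
  proof
    show "K \<subseteq> {x. N x \<le> 1}"
    proof
      fix x assume x: "x \<in> K"
      obtain u where u: "u \<in> P" "N x = x \<bullet> u" using at by blast
      have "u \<bullet> x \<le> 1" using u(1) x unfolding P_def by blast
      then show "x \<in> {x. N x \<le> 1}" using u(2) inner_commute[of x u] by simp
    qed
    show "{x. N x \<le> 1} \<subseteq> K"
    proof (rule subsetI, rule ccontr)
      fix x assume x: "x \<in> {x. N x \<le> 1}" "x \<notin> K"
      obtain a b where ab: "a \<bullet> x < b" "\<forall>k\<in>K. b < a \<bullet> k"
        using separating_hyperplane_closed_point[OF cK(2) compact_imp_closed[OF cK(1)] x(2)] by blast
      have "0 \<in> K" using cK(3) by auto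
      then have b: "b < 0" using ab(2) by force
      define u where "u = (1 / b) *\<^sub>R a"
      have "u \<in> P" unfolding P_def u_def using ab(2) b by (auto simp: field_simps less_imp_le)
      moreover have "x \<bullet> u > 1" using ab(1) b by (simp add: u_def inner_commute field_simps)
      ultimately show False using ge[of u x] x(1) by simp
    qed
  qed
  then show ?thesis using that[of N] tri hom N0 by blast
qed

text \<open>Equality in the Euclidean triangle inequality needs parallel vectors of the same
  direction, and two such vectors with equal perturbed norm coincide. If the perturbed norms differ,
  the ordinary triangle inequality already gives a strict estimate.\<close>

lemma strict_norm_perturbation:
  assumes tri: "\<And>x y. N (x + y) \<le> N x + N y" and hom: "\<And>a x. N (a *\<^sub>R x) = \<bar>a\<bar> * N x"
    and N0: "\<And>x. N x \<ge> 0" and ke: "k > 0" "e > 0"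
  shows "strict_norm (\<lambda>x. k * (N x + e * norm x))"
proof
  define M where "M x = k * (N x + e * norm x)" for x
  have M: "M (x + y) \<le> M x + M y" "M (a *\<^sub>R x) = \<bar>a\<bar> * M x" for x y a
  proof -
    have "e * norm (x + y) \<le> e * norm x + e * norm y"
      using ke mult_left_mono[OF norm_triangle_ineq[of x y], of e] by (simp add: distrib_left)
    then have "N (x + y) + e * norm (x + y) \<le> (N x + e * norm x) + (N y + e * norm y)" using tri[of x y] by simp
    then show "M (x + y) \<le> M x + M y"
      unfolding M_def using ke mult_left_mono[of _ _ k] by (simp flip: distrib_left)
    show "M (a *\<^sub>R x) = \<bar>a\<bar> * M x" by (simp add: M_def hom algebra_simps)
  qed
  have Mpos: "M x > 0" if "x \<noteq> 0" for x
    unfolding M_def using ke that N0[of x] by (intro mult_pos_pos add_nonneg_pos) auto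
  show "k * (N (x + y) + e * norm (x + y)) \<le> k * (N x + e * norm x) + k * (N y + e * norm y)" for x y
    using M(1) unfolding M_def .
  show "k * (N (a *\<^sub>R x) + e * norm (a *\<^sub>R x)) = \<bar>a\<bar> * (k * (N x + e * norm x))" for a x
    using M(2) unfolding M_def .
  show "k * (N x + e * norm x) > 0" if "x \<noteq> 0" for x
    using Mpos[OF that] unfolding M_def .
  have "M ((1 - t) *\<^sub>R x + t *\<^sub>R y) < r"
    if h: "M x \<le> r" "M y \<le> r" "x \<noteq> y" "0 < t" "t < 1" for x y r t
  proof (cases "M x = M y")
    case False
    have "M ((1 - t) *\<^sub>R x + t *\<^sub>R y) \<le> (1 - t) * M x + t * M y"
      using M(1)[of "(1 - t) *\<^sub>R x" "t *\<^sub>R y"] h by (simp add: M(2))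
    also have "\<dots> < r"
    proof (cases "M x < r")
      case True
      then have "(1 - t) * M x < (1 - t) * r" "t * M y \<le> t * r" using h by auto
      then show ?thesis by (simp add: algebra_simps)
    next
      case False
      then have "M y < r" using h \<open>M x \<noteq> M y\<close> by simp
      then have "(1 - t) * M x \<le> (1 - t) * r" "t * M y < t * r" using h by auto
      then show ?thesis by (simp add: algebra_simps)
    qed
    finally show ?thesis .
  next
    case True
    have "norm ((1 - t) *\<^sub>R x + t *\<^sub>R y) \<noteq> norm ((1 - t) *\<^sub>R x) + norm (t *\<^sub>R y)"
    proof
      assume "norm ((1 - t) *\<^sub>R x + t *\<^sub>R y) = norm ((1 - t) *\<^sub>R x) + norm (t *\<^sub>R y)"
      then have "norm ((1 - t) *\<^sub>R x) *\<^sub>R (t *\<^sub>R y) = norm (t *\<^sub>R y) *\<^sub>R ((1 - t) *\<^sub>R x)"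
        by (simp only: norm_triangle_eq)
      then have "((1 - t) * t) *\<^sub>R (norm x *\<^sub>R y) = ((1 - t) * t) *\<^sub>R (norm y *\<^sub>R x)"
        using h(4,5) by (simp add: mult_ac)
      moreover have "(1 - t) * t \<noteq> 0" using h(4,5) by simp
      ultimately have par: "norm x *\<^sub>R y = norm y *\<^sub>R x" unfolding scaleR_cancel_left by blast
      then have "norm x * M y = norm y * M x" using M(2)[of "norm x" y] M(2)[of "norm y" x] by simp
      then have "norm x = norm y \<or> M x = 0" using True by auto
      then show False
      proof
        assume "norm x = norm y"
        then show False using par h(3) by (cases "norm x = 0") auto
      next
        assume "M x = 0"
        then have "x = 0" "y = 0" using Mpos[of x] Mpos[of y] True by auto
        then show False using h(3) by simp
      qed
    qed
    then have "norm ((1 - t) *\<^sub>R x + t *\<^sub>R y) < norm ((1 - t) *\<^sub>R x) + norm (t *\<^sub>R y)"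
      using norm_triangle_ineq[of "(1 - t) *\<^sub>R x" "t *\<^sub>R y"] by simp
    then have "e * norm ((1 - t) *\<^sub>R x + t *\<^sub>R y) < e * (norm ((1 - t) *\<^sub>R x) + norm (t *\<^sub>R y))"
      using ke by (intro mult_strict_left_mono) auto
    then have "N ((1 - t) *\<^sub>R x + t *\<^sub>R y) + e * norm ((1 - t) *\<^sub>R x + t *\<^sub>R y) <
        (N ((1 - t) *\<^sub>R x) + e * norm ((1 - t) *\<^sub>R x)) + (N (t *\<^sub>R y) + e * norm (t *\<^sub>R y))"
      using tri[of "(1 - t) *\<^sub>R x" "t *\<^sub>R y"] by (simp add: distrib_left)
    then have "M ((1 - t) *\<^sub>R x + t *\<^sub>R y) < M ((1 - t) *\<^sub>R x) + M (t *\<^sub>R y)"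
      unfolding M_def using ke mult_strict_left_mono[of _ _ k] by (simp flip: distrib_left)
    also have "\<dots> = (1 - t) * M x + t * M x" using h True by (simp add: M(2))
    also have "\<dots> = M x" by (simp add: algebra_simps)
    finally show ?thesis using h(1) by simp
  qed
  then show "k * (N ((1 - t) *\<^sub>R x + t *\<^sub>R y) + e * norm ((1 - t) *\<^sub>R x + t *\<^sub>R y)) < r"
    if "k * (N x + e * norm x) \<le> r" "k * (N y + e * norm y) \<le> r" "x \<noteq> y" "0 < t" "t < 1" for x y r t
    using that unfolding M_def .
qed

lemma pack_density_lattice_le: "pack_density is_lattice K \<le> pack_density (\<lambda>_. True) K"
  unfolding pack_density_def by (rule SUP_subset_mono) auto

lemma cov_density_lattice_ge: "cov_density (\<lambda>_. True) K \<le> cov_density is_lattice K"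
  unfolding cov_density_def by (rule INF_superset_mono) auto

text \<open>Here \<open>1 + 3 * e\<close> is the dilation between a body and its strictly convex
  approximation; a passage in each direction costs a fourth power.\<close>

lemma le_of_power_mult:
  fixes x y :: real
  assumes "\<And>e. e > 0 \<Longrightarrow> x \<le> (1 + 3 * e) ^ 8 * y"
  shows "x \<le> y"
proof -
  have "(\<lambda>n. 1 / real (Suc n)) \<longlonglongrightarrow> 0" using LIMSEQ_Suc[OF lim_1_over_n] by simp
  then have "(\<lambda>n. (1 + 3 * (1 / real (Suc n))) ^ 8 * y) \<longlonglongrightarrow> (1 + 3 * 0) ^ 8 * y"
    by (intro tendsto_intros)
  then have "x \<le> (1 + 3 * 0) ^ 8 * y"
    by (rule LIMSEQ_le_const) (intro exI[of _ 0] allI impI assms, simp)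
  then show ?thesis by simp
qed

text \<open>The inequalities hold for the unit ball \<open>K'\<close> of
  \<open>N x + e * norm x\<close>, whose norm is strictly convex. Since
  \<open>K \<subseteq> cball 0 3\<close>, the bodies \<open>K\<close> and \<open>K'\<close> lie in
  each other's dilates by \<open>1 + 3 * e\<close>, and the inequalities pass to \<open>K\<close> as
  \<open>e\<close> tends to 0.\<close>

lemma translative_eq_lattice_normal:
  assumes K: "normal_position K" "uminus ` K = K"
  shows "delta_T K = delta_L K \<and> theta_T K = theta_L K"
proof -
  have cd: "convex_disk K" by (rule normal_position_convex_disk[OF K(1)])
  obtain N where N: "\<And>x y. N (x + y) \<le> N x + N y" "\<And>a x. N (a *\<^sub>R x) = \<bar>a\<bar> * N x"
    "\<And>x. N x \<ge> 0" "K = {x. N x \<le> 1}" using symmetric_disk_norm[OF K] by metis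
  have K3: "norm x \<le> 3" if "x \<in> K" for x using K(1) that by (auto simp: normal_position_def)
  have approx: "delta_T K \<le> (1 + 3 * e) ^ 8 * delta_L K \<and> theta_L K \<le> (1 + 3 * e) ^ 8 * theta_T K"
    if e: "e > 0" for e
  proof -
    define c where "c = 1 + 3 * e"
    have c: "c > 0" "c \<ge> 1" using e by (auto simp: c_def)
    define M where "M x = N x + e * norm x" for x
    define K' where "K' = {x. M x \<le> 1}"
    \<comment> \<open>The same body \<open>K'\<close> occurs as the ball of radius 1 of one norm,
      for coverings, and as the ball of radius 1/2 of half that norm, for packings.\<close>
    interpret A: strict_norm "\<lambda>x. 1 * (N x + e * norm x)"
      by (rule strict_norm_perturbation[OF N(1-3) _ e]) simp
    interpret B: strict_norm "\<lambda>x. (1/2) * (N x + e * norm x)"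
      by (rule strict_norm_perturbation[OF N(1-3) _ e]) simp
    have KA: "{x. 1 * (N x + e * norm x) \<le> 1} = K'" and KB: "{x. (1/2) * (N x + e * norm x) \<le> 1/2} = K'"
      by (auto simp: K'_def M_def)
    have cd': "convex_disk K'" using A.convex_disk_unit[of 1] unfolding KA by simp
    have mem: "x \<in> (*\<^sub>R) c ` S" if "(1 / c) *\<^sub>R x \<in> S" for S and x :: "real^2"
    proof (rule image_eqI)
      show "x = c *\<^sub>R ((1 / c) *\<^sub>R x)" using c(1) by simp
    qed (rule that)
    have Mc: "M ((1 / c) *\<^sub>R x) = M x / c" "N ((1 / c) *\<^sub>R x) = N x / c" for x
      using c by (simp_all add: M_def N(2) add_divide_distrib)
    have sub1: "K' \<subseteq> (*\<^sub>R) c ` K"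
    proof
      fix x assume "x \<in> K'"
      then have "N x + e * norm x \<le> 1" by (simp add: K'_def M_def)
      moreover have "e * norm x \<ge> 0" using e by simp
      ultimately have "N x \<le> c" using c by linarith
      then show "x \<in> (*\<^sub>R) c ` K" using c by (intro mem) (simp add: N(4) Mc)
    qed
    have sub2: "K \<subseteq> (*\<^sub>R) c ` K'"
    proof
      fix x assume x: "x \<in> K"
      have "e * norm x \<le> e * 3" using K3[OF x] e by (intro mult_left_mono) auto
      moreover have "N x \<le> 1" using x N(4) by simp
      ultimately have "M x \<le> c" by (simp add: M_def c_def)
      then show "x \<in> (*\<^sub>R) c ` K'" using c by (intro mem) (simp add: K'_def Mc)
    qed
    note ad = affine_density_densities
    note s1 = affine_density_sandwich[OF _ cd cd' c(1) sub1 sub2]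
      and s2 = affine_density_sandwich[OF _ cd' cd c(1) sub2 sub1]
    have "delta_T K' \<le> delta_L K'"
      unfolding densities_eq[OF cd']
      using B.pack_density_unit_ball pack_density_le_1[OF cd', of is_lattice] unfolding KB
      by (intro enn2real_mono) (auto intro: order.strict_trans1)
    then have "c ^ 4 * delta_T K' \<le> c ^ 4 * delta_L K'" using c by (intro mult_left_mono) auto
    also have "\<dots> \<le> c ^ 4 * (c ^ 4 * delta_L K)" using c s2[OF ad(2)] by (intro mult_left_mono) auto
    finally have 1: "delta_T K \<le> c ^ 4 * (c ^ 4 * delta_L K)" using s1[OF ad(1)] by simp
    have "theta_L K' \<le> theta_T K'"
      unfolding densities_eq[OF cd']
      using A.cov_density_unit_ball cov_density_finite[OF cd', of "\<lambda>_. True"] unfolding KA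
      by (intro enn2real_mono) auto
    then have "c ^ 4 * theta_L K' \<le> c ^ 4 * theta_T K'" using c by (intro mult_left_mono) auto
    also have "\<dots> \<le> c ^ 4 * (c ^ 4 * theta_T K)" using c s2[OF ad(3)] by (intro mult_left_mono) auto
    finally have 2: "theta_L K \<le> c ^ 4 * (c ^ 4 * theta_T K)" using s1[OF ad(4)] by simp
    have "c ^ 4 * (c ^ 4 * z) = c ^ 8 * z" for z :: real by (simp add: mult.assoc[symmetric] flip: power_add)
    then show ?thesis using 1 2 unfolding c_def by simp
  qed
  have "delta_T K \<le> delta_L K" "theta_L K \<le> theta_T K"
    using approx by (blast intro: le_of_power_mult)+
  moreover have "delta_L K \<le> delta_T K"
    unfolding densities_eq[OF cd]
    using pack_density_lattice_le pack_density_le_1[OF cd, of "\<lambda>_. True"]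
    by (intro enn2real_mono) (auto intro: order.strict_trans1)
  moreover have "theta_T K \<le> theta_L K"
    unfolding densities_eq[OF cd]
    by (intro enn2real_mono cov_density_lattice_ge cov_density_finite[OF cd])
  ultimately show ?thesis by simp
qed

lemma translative_eq_lattice:
  assumes "convex_disk K" "centrally_symmetric K"
  shows "delta_T K = delta_L K \<and> theta_T K = theta_L K"
proof -
  obtain K' where K': "normal_position K'" "uminus ` K' = K'" "\<forall>F. affine_density F \<longrightarrow> F K' = F K"
    using normalize_symmetric_disk[OF assms] by blast
  then have "F K' = F K" if "affine_density F" for F using that by blast
  from affine_density_densities[THEN this] show ?thesis
    using translative_eq_lattice_normal[OF K'(1,2)] by simp
qed

theorem mainTheorem2:
  shows "compact Omega_T \<and> compact Omega_L \<and> Omega_T_sym = Omega_L_sym \<and> compact Omega_T_sym"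
proof -
  have "Omega_T_sym = Omega_L_sym"
    unfolding Omega_T_sym_def Omega_L_sym_def
    using translative_eq_lattice by (intro Collect_cong ex_cong1) auto
  then show ?thesis using compact_Omegas by simp
qed

end
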